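(* Let $(\xi_t)_{t\ge 0}$ be the wall process on $\mathcal X$ (the Markov process with generator $\mathcal L$) started from the flat configuration $\xi_0(x)=x \pmod 2\in\{0,1\}$, $x\in\mathbb Z$. Then there exist positive constants $c_1$ and $c_2$ such that, for all sufficiently large $t$, $$c_1 t^{1/4}\le \mathbb E\,\xi_t(0)\le c_2\, t^{1/4}\log t .$$
   Context: Let $\mathbb N=\{0,1,2,\dots\}$ and $$\mathcal X=\{\xi\in\mathbb N^{\mathbb Z}: |\xi(x)-\xi(x+1)|=1 \text{ for all } x\in\mathbb Z,\ \xi(0)\text{ even}\}.$$ For $\xi\in\mathbb Z^{\mathbb Z}$ the discrete Laplacian is $\Delta\xi(x)=\xi(x+1)-2\xi(x)+\xi(x-1)$, and $\delta_x\in\mathbb Z^{\mathbb Z}$ is the configuration equal to $1$ at $x$ and $0$ elsewhere. The wall process is the continuous-time Markov process on $\mathcal X$ with generator $$\mathcal L f(\xi)=\frac12\sum_{x\in\mathbb Z}\mathbf 1\{\xi+\Delta\xi(x)\,\delta_x\ge 0\}\,[f(\xi+\Delta\xi(x)\,\delta_x)-f(\xi)],$$ where $\ge 0$ is understood coordinatewise. That is, at each site $x$ with $\Delta\xi(x)=\pm2$, at rate $\frac12$ the height $\xi(x)$ is changed by $\Delta\xi(x)$, except that jumps making the height negative are suppressed. Equivalently, the process is built from independent Poisson processes of rate $\frac12$ attached to the sites $x\in\mathbb Z$: at each event attached to $x$ the height at $x$ is replaced by $\xi(x)+\Delta\xi(x)$ if this is nonnegative, and is left unchanged otherwise. *)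

theory Defs
  imports "HOL-Probability.Probability"
begin

definition wall_configs :: "(int \<Rightarrow> int) set" where
  "wall_configs = {\<xi>. (\<forall>x. 0 \<le> \<xi> x) \<and> (\<forall>x. \<bar>\<xi> x - \<xi> (x + 1)\<bar> = 1) \<and> even (\<xi> 0)}"

definition laplacian :: "(int \<Rightarrow> int) \<Rightarrow> int \<Rightarrow> int" where
  "laplacian \<xi> x = \<xi> (x + 1) - 2 * \<xi> x + \<xi> (x - 1)"

text \<open>The new height at \<open>x\<close> after an event attached to \<open>x\<close>; all other heights are unaffected.\<close>

definition wall_update :: "(int \<Rightarrow> int) \<Rightarrow> int \<Rightarrow> int" where
  "wall_update \<xi> x = (if 0 \<le> \<xi> x + laplacian \<xi> x then \<xi> x + laplacian \<xi> x else \<xi> x)"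

text \<open>Counting-process definition, with time index in \<open>[0, \<infinity>)\<close>.  The truncated subtraction
  on \<^typ>\<open>nat\<close> is harmless since almost every path is nondecreasing.\<close>

definition poisson_process :: "'w measure \<Rightarrow> real \<Rightarrow> (real \<Rightarrow> 'w \<Rightarrow> nat) \<Rightarrow> bool" where
  "poisson_process M r N \<longleftrightarrow>
     (\<forall>t\<ge>0. N t \<in> measurable M (count_space UNIV)) \<and>
     (AE \<omega> in M. N 0 \<omega> = 0 \<and> mono_on {0..} (\<lambda>t. N t \<omega>) \<and>
        (\<forall>t\<ge>0. continuous (at_right t) (\<lambda>s. N s \<omega>))) \<and>
     (\<forall>s t. 0 \<le> s \<and> s < t \<longrightarrow>
        distr M (count_space UNIV) (\<lambda>\<omega>. N t \<omega> - N s \<omega>) = measure_pmf (poisson_pmf (r * (t - s)))) \<and>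
     (\<forall>u :: nat \<Rightarrow> real. 0 \<le> u 0 \<and> mono u \<longrightarrow>
        prob_space.indep_vars M (\<lambda>_. count_space UNIV) (\<lambda>k \<omega>. N (u (Suc k)) \<omega> - N (u k) \<omega>) UNIV)"

definition indep_poisson_processes ::
    "'w measure \<Rightarrow> real \<Rightarrow> ('i \<Rightarrow> real \<Rightarrow> 'w \<Rightarrow> nat) \<Rightarrow> bool" where
  "indep_poisson_processes M r N \<longleftrightarrow>
     (\<forall>x. poisson_process M r (N x)) \<and>
     prob_space.indep_vars M (\<lambda>_. PiM {0..} (\<lambda>_. count_space UNIV)) (\<lambda>x \<omega>. \<lambda>t\<in>{0..}. N x t \<omega>) UNIV"

text \<open>The jump times of a nondecreasing path \<open>n\<close> on \<open>[0, \<infinity>)\<close>.\<close>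

definition event_times :: "(real \<Rightarrow> nat) \<Rightarrow> real set" where
  "event_times n = {t. 0 < t \<and> (\<forall>s\<in>{0..<t}. n s < n t)}"

text \<open>Graphical construction: \<open>\<xi>\<close> is the wall process started from \<open>\<eta>\<close> and driven by the
  clocks \<open>N\<close>.  The height at \<open>x\<close> is constant on time intervals without events attached to \<open>x\<close>,
  and at an event attached to \<open>x\<close> it is updated according to the configuration just before it
  (the one at all times \<open>s < t\<close> close enough to \<open>t\<close>).  Almost surely the event times at each
  site are locally finite and distinct sites have no common event time.\<close>

definition wall_process ::
    "'w measure \<Rightarrow> (int \<Rightarrow> real \<Rightarrow> 'w \<Rightarrow> nat) \<Rightarrow> (int \<Rightarrow> int) \<Rightarrow> (real \<Rightarrow> 'w \<Rightarrow> int \<Rightarrow> int) \<Rightarrow> bool" where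
  "wall_process M N \<eta> \<xi> \<longleftrightarrow>
     prob_space M \<and>
     indep_poisson_processes M (1 / 2) N \<and>
     (\<forall>t\<ge>0. \<forall>\<omega>\<in>space M. \<xi> t \<omega> \<in> wall_configs) \<and>
     (\<forall>t\<ge>0. \<forall>x. (\<lambda>\<omega>. \<xi> t \<omega> x) \<in> measurable M (count_space UNIV)) \<and>
     (AE \<omega> in M.
        \<xi> 0 \<omega> = \<eta> \<and>
        (\<forall>x s t. 0 \<le> s \<and> s \<le> t \<and> {s<..t} \<inter> event_times (\<lambda>u. N x u \<omega>) = {} \<longrightarrow>
           \<xi> t \<omega> x = \<xi> s \<omega> x) \<and>
        (\<forall>x. \<forall>t\<in>event_times (\<lambda>u. N x u \<omega>).
           \<forall>\<^sub>F s in at_left t. \<xi> t \<omega> x = wall_update (\<xi> s \<omega>) x))"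

end

theory Submission
  imports Defs "HOL-Real_Asymp.Real_Asymp"
begin

text \<open>
  Without the wall, an event at \<open>x\<close> adds \<open>\<Delta>\<zeta>(x)\<close> to the height, so heights have linear drift: the mean
  solves the discrete heat equation, and \<open>\<zeta>\<^sub>t(0)\<close> minus its mean is the end value of a martingale with
  jumps at most 2 and bracket at most a constant times \<open>\<integral> \<Sum>\<^sub>y p\<^sub>s(0,y)\<^sup>2 ds\<close>, which is of order \<open>\<surd>t\<close>.
  Hence \<open>\<zeta>\<^sub>t(0)\<close> has exponential moments on the scale \<open>t\<^sup>1\<^sup>/\<^sup>4\<close>.  The bracket is also at least of this order,
  because the slopes at adjacent edges are negatively correlated up to their means.

  Lower bound: the wall process dominates the free one in law and is nonnegative, and second and
  fourth moments give \<open>E \<zeta>\<^sub>t(0)\<^sup>+ \<ge> c t\<^sup>1\<^sup>/\<^sup>4\<close>.  Upper bound: start the wall process higher by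
  \<open>H \<approx> 2 t\<^sup>1\<^sup>/\<^sup>4 log t\<close>.  The wall pushes only at sites of height at most 1, and the probability of such a
  height is bounded by that for the free process, at most \<open>const / t\<close>; so \<open>E \<xi>\<^sub>t(0) \<le> H + const\<close>.

  All this is done for a discrete-time chain in a finite box that updates at most one uniformly chosen
  site per step.  The actual process agrees with this chain at the origin, except on an event of
  small probability: two events in one time step, or influence from outside the box, which
  propagates by one site at a time at rate \<open>1/2\<close>.

  Driving two configurations by the same clocks does not preserve their order (the lower one may
  jump up over the higher one), but flipping local minima and local maxima by separate clocks does, and
  it gives the same law.
\<close>

section \<open>Finite-box chains and the discrete heat equation\<close>

text \<open>In infinite volume the mean height is not known in advance to be finite. In a box the
  one-step operator \<open>pick_op\<close>, the identity plus \<open>q\<close> times a generator,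
  acts on arbitrary real functions, so moment bounds and couplings become inequalities between
  powers of operators, proved by induction on the number of steps without joint laws or
  measurability. Probability enters only when such a power is identified with an expectation over
  independent choices. The chain bounds depend on the number of steps through \<open>q * k\<close>,
  of order t, up to errors that a fine mesh makes small; hence box and mesh can be chosen last,
  depending on t. With r = t^(1/4), the free parameters are set to \<open>R\<close> of order r^2
  (the diffusive length) and \<open>l\<close> = 1/r (the inverse height fluctuation). The logarithm
  is the price for making exp (- l H) at most of order 1/t, because the wall can push during a time
  of order t. The upper bound is first proved for heights truncated at \<open>A\<close>, uniformly
  in \<open>A\<close> although box and mesh depend on \<open>A\<close>; monotone convergence then
  gives the integrability on which the lower bound relies.\<close>

definition pick_op :: "real \<Rightarrow> int set \<Rightarrow> (int \<Rightarrow> 's \<Rightarrow> 's) \<Rightarrow> ('s \<Rightarrow> real) \<Rightarrow> 's \<Rightarrow> real" where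
  "pick_op q B u f s = f s + q * (\<Sum>x\<in>B. f (u x s) - f s)"

definition lap :: "(int \<Rightarrow> real) \<Rightarrow> int \<Rightarrow> real" where
  "lap g x = g (x + 1) - 2 * g x + g (x - 1)"

text \<open>The factor 2 in \<open>q_card\<close> leaves room for two clocks per site in the
  couplings. \<open>q_le\<close> keeps the weights nonnegative when four sites act on a pair of
  slopes, and makes \<open>heat\<close> an average over neighbours.\<close>

locale box_chain =
  fixes q :: real and B :: "int set"
  assumes finite_B [simp]: "finite B" and q_nonneg: "0 \<le> q"
    and q_card: "2 * q * card B \<le> 1" and q_le: "4 * q \<le> 1"
begin

definition expec :: "(int \<Rightarrow> 's \<Rightarrow> 's) \<Rightarrow> nat \<Rightarrow> ('s \<Rightarrow> real) \<Rightarrow> 's \<Rightarrow> real" where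
  "expec u k f = (pick_op q B u ^^ k) f"

definition closed_under :: "(int \<Rightarrow> 's \<Rightarrow> 's) \<Rightarrow> 's set \<Rightarrow> bool" where
  "closed_under u S \<longleftrightarrow> (\<forall>x\<in>B. \<forall>s\<in>S. u x s \<in> S)"

lemma expec_0 [simp]: "expec u 0 f = f"
  by (simp add: expec_def)

text \<open>Conditions on the last step; \<open>expec_Suc'\<close> conditions on the first. The
  moment bounds use the former, because their one-step estimates rewrite the test function.\<close>

lemma expec_Suc: "expec u (Suc k) f = expec u k (pick_op q B u f)"
  by (simp add: expec_def funpow_swap1)

lemma expec_Suc': "expec u (Suc k) f = pick_op q B u (expec u k f)"
  by (simp add: expec_def)

lemma pick_op_alt: "pick_op q B u f s = (1 - q * card B) * f s + q * (\<Sum>x\<in>B. f (u x s))"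
  by (simp add: pick_op_def sum_subtractf algebra_simps)

lemma q_card': "q * card B \<le> 1"
proof -
  have "0 \<le> q * card B" using q_nonneg by simp
  then show ?thesis using q_card by linarith
qed

lemma pick_op_mono:
  assumes "closed_under u S" "\<And>s. s \<in> S \<Longrightarrow> f s \<le> g s" "s \<in> S"
  shows "pick_op q B u f s \<le> pick_op q B u g s"
  unfolding pick_op_alt
  using assms q_nonneg q_card'
  by (intro add_mono mult_left_mono sum_mono) (auto simp: closed_under_def)

lemma expec_mono:
  assumes "closed_under u S" "\<And>s. s \<in> S \<Longrightarrow> f s \<le> g s" "s \<in> S"
  shows "expec u k f s \<le> expec u k g s"
  using assms(2)
proof (induction k arbitrary: f g)
  case 0
  then show ?case using assms(3) by simp
next
  case (Suc k)
  show ?case unfolding expec_Suc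
    by (rule Suc.IH, rule pick_op_mono[OF assms(1)]) (use Suc.prems in auto)
qed

lemma expec_cong:
  assumes "closed_under u S" "\<And>s. s \<in> S \<Longrightarrow> f s = g s" "s \<in> S"
  shows "expec u k f s = expec u k g s"
  by (intro antisym expec_mono[OF assms(1) _ assms(3)]) (simp_all add: assms(2))

lemma expec_add: "expec u k (\<lambda>s. f s + g s) s = expec u k f s + expec u k g s"
proof (induction k arbitrary: s)
  case (Suc k)
  then show ?case by (simp add: expec_Suc' pick_op_def sum.distrib sum_subtractf algebra_simps)
qed simp

lemma expec_cmult: "expec u k (\<lambda>s. c * f s) s = c * expec u k f s"
proof (induction k arbitrary: s)
  case (Suc k)
  then show ?case
    by (simp add: expec_Suc' pick_op_def sum_subtractf sum_distrib_left[symmetric] algebra_simps)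
qed simp

lemma expec_const: "expec u k (\<lambda>s. c) s = c"
  by (induction k arbitrary: s) (simp_all add: expec_Suc' pick_op_def)

lemma expec_diff: "expec u k (\<lambda>s. f s - g s) s = expec u k f s - expec u k g s"
  using expec_add[of u k f "\<lambda>s. -1 * g s" s] expec_cmult[of u k "-1" g s] by simp

lemma expec_sum: "expec u k (\<lambda>s. \<Sum>i\<in>I. f i s) s = (\<Sum>i\<in>I. expec u k (f i) s)"
proof (induction I rule: infinite_finite_induct)
  case (insert i I)
  then show ?case by (simp add: expec_add)
qed (simp_all add: expec_const)

section \<open>Couplings as inequalities between transition operators\<close>

definition splits :: "'a \<Rightarrow> 'a \<Rightarrow> 'a \<Rightarrow> 'a \<Rightarrow> bool" where
  "splits a b s t \<longleftrightarrow> a = s \<and> b = t \<or> a = t \<and> b = s"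

text \<open>Each site gets an up clock and a down clock. In a given state one of them performs
  \<open>u x\<close> and the other idles, so both with weight \<open>q\<close> give the same law as
  \<open>u\<close> alone with weight \<open>q\<close>. When both halves preserve \<open>R\<close>,
  expectations can be compared without constructing a joint chain.\<close>

definition coupled ::
    "('a \<Rightarrow> 'b \<Rightarrow> bool) \<Rightarrow> (int \<Rightarrow> 'a \<Rightarrow> 'a) \<Rightarrow> (int \<Rightarrow> 'a \<Rightarrow> 'a) \<Rightarrow> (int \<Rightarrow> 'a \<Rightarrow> 'a) \<Rightarrow>
      (int \<Rightarrow> 'b \<Rightarrow> 'b) \<Rightarrow> (int \<Rightarrow> 'b \<Rightarrow> 'b) \<Rightarrow> (int \<Rightarrow> 'b \<Rightarrow> 'b) \<Rightarrow> bool" where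
  "coupled R u up dn v up' dn' \<longleftrightarrow> (\<forall>x s s'. R s s' \<longrightarrow>
     splits (up x s) (dn x s) s (u x s) \<and> splits (up' x s') (dn' x s') s' (v x s') \<and>
     R (up x s) (up' x s') \<and> R (dn x s) (dn' x s'))"

lemma split_sum:
  assumes "splits a b s t"
  shows "f t = f a + f b - (f s :: real)"
  using assms by (auto simp: splits_def)

lemma pick_op_coupled:
  assumes "coupled R u up dn v up' dn'" "\<And>s s'. R s s' \<Longrightarrow> f s \<le> g s'" "R s s'"
  shows "pick_op q B u f s \<le> pick_op q B v g s'"
proof -
  note * = assms(1)[unfolded coupled_def, rule_format, OF assms(3)]
  have 1: "pick_op q B u f s = (1 - 2 * q * card B) * f s + q * (\<Sum>x\<in>B. f (up x s) + f (dn x s))"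
  proof -
    have "(\<Sum>x\<in>B. f (u x s)) = (\<Sum>x\<in>B. f (up x s) + f (dn x s) - f s)"
      using * by (intro sum.cong refl split_sum) auto
    also have "\<dots> = (\<Sum>x\<in>B. f (up x s) + f (dn x s)) - card B * f s"
      by (simp only: sum_subtractf sum_constant)
    finally show ?thesis unfolding pick_op_alt by (simp only:) (simp add: algebra_simps)
  qed
  have 2: "pick_op q B v g s' = (1 - 2 * q * card B) * g s' + q * (\<Sum>x\<in>B. g (up' x s') + g (dn' x s'))"
  proof -
    have "(\<Sum>x\<in>B. g (v x s')) = (\<Sum>x\<in>B. g (up' x s') + g (dn' x s') - g s')"
      using * by (intro sum.cong refl split_sum) auto
    also have "\<dots> = (\<Sum>x\<in>B. g (up' x s') + g (dn' x s')) - card B * g s'"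
      by (simp only: sum_subtractf sum_constant)
    finally show ?thesis unfolding pick_op_alt by (simp only:) (simp add: algebra_simps)
  qed
  show ?thesis unfolding 1 2
    using q_nonneg q_card assms(2,3) *
    by (intro add_mono mult_left_mono sum_mono) auto
qed

lemma expec_coupled:
  assumes "coupled R u up dn v up' dn'" "\<And>s s'. R s s' \<Longrightarrow> f s \<le> g s'" "R s s'"
  shows "expec u k f s \<le> expec v k g s'"
  using assms(2)
proof (induction k arbitrary: f g)
  case 0
  then show ?case using assms(3) by simp
next
  case (Suc k)
  show ?case unfolding expec_Suc
    by (rule Suc.IH, rule pick_op_coupled[OF assms(1)]) (use Suc.prems in auto)
qed

section \<open>Heat semigroup with frozen boundary values\<close>

definition heat :: "(int \<Rightarrow> real) \<Rightarrow> int \<Rightarrow> real" where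
  "heat g x = (if x \<in> B then g x + q * lap g x else g x)"

definition ip :: "(int \<Rightarrow> real) \<Rightarrow> (int \<Rightarrow> real) \<Rightarrow> real" where
  "ip a b = (\<Sum>x\<in>B. a x * b x)"

abbreviation vanishing :: "(int \<Rightarrow> real) \<Rightarrow> bool" where
  "vanishing a \<equiv> \<forall>x. x \<notin> B \<longrightarrow> a x = 0"

lemma heat_mono:
  assumes "\<And>x. f x \<le> g x"
  shows "heat f x \<le> heat g x"
proof -
  have *: "h x + q * lap h x = (1 - 2 * q) * h x + q * h (x + 1) + q * h (x - 1)" for h
    by (simp add: lap_def algebra_simps)
  show ?thesis unfolding heat_def *
    using assms q_nonneg q_le by (auto intro!: add_mono mult_left_mono)
qed

lemma heat_const: "heat (\<lambda>_. c) x = c"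
  by (simp add: heat_def lap_def)

lemma heat_off: "x \<notin> B \<Longrightarrow> (heat ^^ k) g x = g x"
  by (induction k) (auto simp: heat_def)

lemma heat_Suc: "(heat ^^ Suc k) g = (heat ^^ k) (heat g)"
  by (simp add: funpow_swap1)

lemma heat_pow_bounds:
  assumes "\<And>x. c \<le> g x" "\<And>x. g x \<le> d"
  shows "c \<le> (heat ^^ k) g x" "(heat ^^ k) g x \<le> d"
proof -
  have "c \<le> (heat ^^ k) g x \<and> (heat ^^ k) g x \<le> d"
  proof (induction k arbitrary: x)
    case (Suc k)
    have "heat (\<lambda>_. c) x \<le> heat ((heat ^^ k) g) x" "heat ((heat ^^ k) g) x \<le> heat (\<lambda>_. d) x"
      using Suc by (intro heat_mono; blast)+
    then show ?case by (simp add: heat_const)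
  qed (use assms in auto)
  then show "c \<le> (heat ^^ k) g x" "(heat ^^ k) g x \<le> d" by auto
qed

lemma ip_shift:
  assumes "vanishing a" "vanishing b"
  shows "(\<Sum>x\<in>B. a x * b (x + 1)) = (\<Sum>x\<in>B. a (x - 1) * b x)"
  by (rule sum.reindex_bij_witness_not_neutral[where S' = "{x\<in>B. x + 1 \<notin> B}"
        and T' = "{x\<in>B. x - 1 \<notin> B}" and i = "\<lambda>x. x - 1" and j = "\<lambda>x. x + 1"])
    (use assms in auto)

text \<open>Symmetry of the Dirichlet Laplacian: both functions vanish off \<open>B\<close>, so
  moving a shift from one factor to the other produces no boundary term.\<close>

lemma ip_heat:
  assumes "vanishing a" "vanishing b"
  shows "ip (heat a) b = ip a (heat b)"
proof -
  have "ip (heat a) b = (\<Sum>x\<in>B. (1 - 2 * q) * (a x * b x) + q * (a (x + 1) * b x) + q * (a (x - 1) * b x))"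
    unfolding ip_def by (intro sum.cong) (auto simp: heat_def lap_def algebra_simps)
  also have "\<dots> = (\<Sum>x\<in>B. (1 - 2 * q) * (a x * b x)) + q * (\<Sum>x\<in>B. b x * a (x + 1))
      + q * (\<Sum>x\<in>B. a (x - 1) * b x)"
    by (simp add: sum.distrib sum_distrib_left mult_ac)
  also have "\<dots> = (\<Sum>x\<in>B. (1 - 2 * q) * (a x * b x)) + q * (\<Sum>x\<in>B. b (x - 1) * a x)
      + q * (\<Sum>x\<in>B. a x * b (x + 1))"
    using ip_shift[OF assms] ip_shift[OF assms(2,1)] by simp
  also have "\<dots> = (\<Sum>x\<in>B. (1 - 2 * q) * (a x * b x) + q * (b (x - 1) * a x) + q * (a x * b (x + 1)))"
    by (simp add: sum.distrib sum_distrib_left mult_ac)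
  also have "\<dots> = ip a (heat b)"
    unfolding ip_def by (intro sum.cong) (auto simp: heat_def lap_def algebra_simps)
  finally show ?thesis .
qed

lemma ip_heat_pow:
  assumes "vanishing a" "vanishing b"
  shows "ip ((heat ^^ j) a) b = ip a ((heat ^^ j) b)"
  using assms
proof (induction j arbitrary: b)
  case (Suc j)
  have "ip ((heat ^^ Suc j) a) b = ip ((heat ^^ j) a) (heat b)"
    using Suc.prems by (simp add: ip_heat heat_off)
  also have "\<dots> = ip a ((heat ^^ j) (heat b))"
    using Suc.prems heat_off[of _ 1] by (intro Suc.IH) auto
  finally show ?case by (simp only: heat_Suc)
qed simp

section \<open>Green function and energy of the heat kernel\<close>

definition delta :: "int \<Rightarrow> int \<Rightarrow> real" where
  "delta z x = (if x = z then 1 else 0)"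

lemma ip_delta: "z \<in> B \<Longrightarrow> ip (delta z) b = b z" "z \<in> B \<Longrightarrow> ip b (delta z) = b z"
proof -
  assume z: "z \<in> B"
  have "(\<Sum>x\<in>B. delta z x * b x) = (\<Sum>x\<in>B. if x = z then b x else 0)"
    by (intro sum.cong) (auto simp: delta_def)
  then show *: "ip (delta z) b = b z" using z by (simp add: ip_def)
  then show "ip b (delta z) = b z" by (simp add: ip_def mult.commute)
qed

lemma delta_pow_bounds: "0 \<le> (heat ^^ k) (delta z) x" "(heat ^^ k) (delta z) x \<le> 1"
  using heat_pow_bounds[of 0 "delta z" 1] by (simp_all add: delta_def)

text \<open>The bound is a supersolution: \<open>(\<bar>x - z\<bar> - R)\<^sup>2 / (4 R)\<close> is nonnegative and has Laplacian
  \<open>1 / (2 R) - \<delta>\<^sub>z\<close>; the term \<open>q k / (2 R)\<close> absorbs the first summand.\<close>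

lemma green_bound:
  assumes "z \<in> B" "R > 0"
  shows "q * (\<Sum>i<k. (heat ^^ i) (delta z) x)
    \<le> (real_of_int (x - z)^2 / (2 * R) - \<bar>real_of_int (x - z)\<bar> + R / 2 + q * k / R) / 2"
proof (induction k arbitrary: x)
  case 0
  have "real_of_int (x - z)^2 / (2 * R) - \<bar>real_of_int (x - z)\<bar> + R / 2 = (\<bar>real_of_int (x - z)\<bar> - R)^2 / (2 * R)"
    using assms by (simp add: power2_diff field_simps power2_eq_square)
  then show ?case using assms by simp
next
  case (Suc k)
  define \<phi> where "\<phi> x = (real_of_int (x - z)^2 / (2 * R) - \<bar>real_of_int (x - z)\<bar> + R / 2 + q * k / R) / 2" for x :: int
  have \<phi>0: "0 \<le> \<phi> x" for x
  proof -
    have "real_of_int (x - z)^2 / (2 * R) - \<bar>real_of_int (x - z)\<bar> + R / 2 = (\<bar>real_of_int (x - z)\<bar> - R)^2 / (2 * R)"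
      using assms by (simp add: power2_diff field_simps power2_eq_square)
    then show ?thesis using assms q_nonneg by (simp add: \<phi>_def)
  qed
  define s where "s x = q * (\<Sum>i<k. (heat ^^ i) (delta z) x)" for x
  have s: "s x \<le> \<phi> x" for x unfolding s_def \<phi>_def by (rule Suc)
  have S: "q * (\<Sum>i<Suc k. (heat ^^ i) (delta z) x) = q * delta z x + heat s x" if "x \<in> B"
  proof -
    have "heat s x = q * (\<Sum>i<k. heat ((heat ^^ i) (delta z)) x)"
      using that by (simp add: heat_def s_def lap_def sum.distrib sum_subtractf sum_distrib_left algebra_simps)
    then show ?thesis
      by (simp add: sum.lessThan_Suc_shift algebra_simps del: sum.lessThan_Suc)
  qed
  have lapabs: "\<bar>y + 1\<bar> - 2 * \<bar>y\<bar> + \<bar>y - 1\<bar> = (if y = 0 then 2 else 0)" for y :: int by auto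
  have "lap \<phi> x = ((real_of_int (x - z + 1)^2 - 2 * real_of_int (x - z)^2 + real_of_int (x - z - 1)^2) / (2 * R)
      - real_of_int (\<bar>x - z + 1\<bar> - 2 * \<bar>x - z\<bar> + \<bar>x - z - 1\<bar>)) / 2"
    using assms by (simp add: lap_def \<phi>_def field_simps power2_eq_square)
  also have "\<dots> = 1 / (2 * R) - delta z x"
    unfolding lapabs using assms by (simp add: delta_def field_simps power2_eq_square)
  finally have lap: "lap \<phi> x = 1 / (2 * R) - delta z x" .
  have eq: "\<phi> x + q / (2 * R) = (real_of_int (x - z)^2 / (2 * R) - \<bar>real_of_int (x - z)\<bar> + R / 2 + q * Suc k / R) / 2"
    using assms by (simp add: \<phi>_def field_simps)
  show ?case
  proof (cases "x \<in> B")
    case True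
    have "q * (\<Sum>i<Suc k. (heat ^^ i) (delta z) x) \<le> q * delta z x + heat \<phi> x"
      unfolding S[OF True] using heat_mono[of s \<phi> x] s by simp
    moreover have "q * delta z x + heat \<phi> x = \<phi> x + q / (2 * R)"
      using True unfolding heat_def lap by (simp add: algebra_simps)
    ultimately show ?thesis using eq by linarith
  next
    case False
    then have "(heat ^^ i) (delta z) x = 0" for i
      using assms by (auto simp: heat_off delta_def)
    then have "q * (\<Sum>i<Suc k. (heat ^^ i) (delta z) x) = 0"
      by (simp only: sum.neutral_const mult_zero_right)
    moreover have "0 \<le> \<phi> x + q / (2 * R)" using \<phi>0[of x] q_nonneg assms by simp
    ultimately show ?thesis using eq by linarith
  qed
qed

text \<open>By symmetry the sum of squares at time \<open>j\<close> is the return probability at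
  time \<open>2 * j\<close>. These even times are among the first \<open>2 * k\<close>, so
  \<open>green_bound\<close> at \<open>x = z\<close> applies. The choice of \<open>R\<close> near
  the square root of \<open>q * k\<close> balances the two terms.\<close>

lemma energy_upper:
  assumes "z \<in> B" "R > 0"
  shows "q * (\<Sum>j<k. \<Sum>x\<in>B. ((heat ^^ j) (delta z) x)\<^sup>2) \<le> R / 4 + q * k / R"
proof -
  have d: "vanishing (delta z)" using assms by (auto simp: delta_def)
  have "(\<Sum>x\<in>B. ((heat ^^ j) (delta z) x)\<^sup>2) = (heat ^^ (2 * j)) (delta z) z" for j
  proof -
    have "(\<Sum>x\<in>B. ((heat ^^ j) (delta z) x)\<^sup>2) = ip ((heat ^^ j) (delta z)) ((heat ^^ j) (delta z))"
      by (simp add: ip_def power2_eq_square)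
    also have "\<dots> = ip (delta z) ((heat ^^ j) ((heat ^^ j) (delta z)))"
      by (rule ip_heat_pow) (use d in \<open>auto simp: heat_off\<close>)
    also have "\<dots> = (heat ^^ (2 * j)) (delta z) z"
      using assms by (simp add: ip_delta mult_2 funpow_add)
    finally show ?thesis .
  qed
  then have "(\<Sum>j<k. \<Sum>x\<in>B. ((heat ^^ j) (delta z) x)\<^sup>2) = (\<Sum>j<k. (heat ^^ (2 * j)) (delta z) z)"
    by simp
  also have "\<dots> = (\<Sum>i\<in>(\<lambda>j. 2 * j) ` {..<k}. (heat ^^ i) (delta z) z)"
    by (subst sum.reindex) (auto simp: inj_on_def)
  also have "\<dots> \<le> (\<Sum>i<2 * k. (heat ^^ i) (delta z) z)"
    by (rule sum_mono2) (auto simp: delta_pow_bounds)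
  finally have "q * (\<Sum>j<k. \<Sum>x\<in>B. ((heat ^^ j) (delta z) x)\<^sup>2) \<le> q * (\<Sum>i<2 * k. (heat ^^ i) (delta z) z)"
    using q_nonneg by (rule mult_left_mono)
  also have "\<dots> \<le> (R / 2 + q * (2 * k) / R) / 2"
    using green_bound[OF assms, where k = "2 * k" and x = z] by simp
  finally show ?thesis using assms by (simp add: field_simps)
qed

text \<open>The left-hand side is a subsolution: the parabola has Laplacian
  \<open>- 2 / R^2\<close>, which the term in \<open>j\<close> compensates. Off \<open>B\<close> the
  parabola is at most 0, since there the distance from 0 is at least \<open>R\<close>, while the
  solution stays nonnegative.\<close>

lemma heat_pow_lower:
  assumes "R > 0" "\<And>x. \<bar>x\<bar> < R \<Longrightarrow> x \<in> B" "\<And>x. 1 - x^2 / R^2 \<le> g x"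
    "\<And>x. 0 \<le> g x"
  shows "1 - real_of_int x ^ 2 / R^2 - 2 * q * j / R^2 \<le> (heat ^^ j) g x"
proof (induction j arbitrary: x)
  case 0
  then show ?case using assms(3) by simp
next
  case (Suc j)
  define \<phi> where "\<phi> x = 1 - real_of_int x ^ 2 / R^2 - 2 * q * j / R^2" for x
  have lap: "lap \<phi> x = - 2 / R^2"
    using assms(1) by (simp add: lap_def \<phi>_def field_simps power2_eq_square)
  show ?case
  proof (cases "x \<in> B")
    case True
    have "heat \<phi> x \<le> heat ((heat ^^ j) g) x"
      by (rule heat_mono) (use Suc in \<open>simp add: \<phi>_def\<close>)
    moreover have "heat \<phi> x = \<phi> x + q * (- 2 / R^2)"
      using True lap by (simp add: heat_def)
    ultimately show ?thesis
      by (simp add: \<phi>_def algebra_simps add_divide_distrib del: of_int_power)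
  next
    case False
    then have "\<not> \<bar>x\<bar> < R" using assms(2) by blast
    then have "real_of_int x ^ 2 \<ge> R ^ 2"
      using assms(1) by (metis abs_ge_self abs_le_square_iff abs_of_pos not_less of_int_abs)
    then have "1 - real_of_int x ^ 2 / R^2 \<le> 0"
      using assms(1) by simp
    moreover have "0 \<le> 2 * q * Suc j / R^2" using q_nonneg by simp
    moreover have "0 \<le> (heat ^^ Suc j) g x"
      using False assms(4) by (simp add: heat_off del: funpow.simps)
    ultimately show ?thesis by linarith
  qed
qed

text \<open>Pairing the kernel with the truncated parabola \<open>g\<close> shows that mass at least
  1/2 is still within distance \<open>R\<close>, thus on at most \<open>2 * R + 1\<close> sites.
  Cauchy-Schwarz turns this into a lower bound for the sum of squares.\<close>

lemma energy_lower:
  assumes R: "R > 0" "\<And>x. \<bar>x\<bar> < R \<Longrightarrow> x \<in> B" and j: "4 * q * j \<le> R^2"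
  shows "1 / (4 * (2 * R + 1)) \<le> (\<Sum>x\<in>B. ((heat ^^ j) (delta 0) x)\<^sup>2)"
proof -
  define g where "g x = max 0 (1 - real_of_int x ^ 2 / R^2)" for x
  define a where "a = (heat ^^ j) (delta 0)"
  define I where "I = {x::int. \<bar>x\<bar> < R}"
  have z: "0 \<in> B" using R by simp
  have I: "I \<subseteq> B" using R by (auto simp: I_def)
  have fI: "finite I" using I finite_B finite_subset by blast
  have out: "g x = 0" if "x \<notin> I" for x
  proof -
    have "R \<le> \<bar>real_of_int x\<bar>" using that by (simp add: I_def)
    then have "R^2 \<le> real_of_int x ^ 2"
      using R by (metis abs_le_square_iff abs_of_pos)
    then show ?thesis using R by (simp add: g_def)
  qed
  have "1 / 2 \<le> (heat ^^ j) g 0"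
  proof -
    have "1 - 2 * q * j / R^2 \<le> (heat ^^ j) g 0"
      using heat_pow_lower[OF R, of g 0 j] by (simp add: g_def)
    moreover have "2 * q * j / R^2 \<le> 1/2" using j R by (simp add: field_simps)
    ultimately show ?thesis by linarith
  qed
  also have "(heat ^^ j) g 0 = ip (delta 0) ((heat ^^ j) g)" using z by (simp add: ip_delta)
  also have "\<dots> = ip a g" unfolding a_def
    by (rule ip_heat_pow[symmetric]) (use z out I in \<open>auto simp: delta_def\<close>)
  also have "\<dots> = (\<Sum>x\<in>I. a x * g x)"
    unfolding ip_def using I out by (intro sum.mono_neutral_right) auto
  also have "\<dots> \<le> (\<Sum>x\<in>I. a x * 1)"
    by (intro sum_mono mult_left_mono) (auto simp: g_def a_def delta_pow_bounds)
  finally have "1 / 2 \<le> (\<Sum>x\<in>I. a x * 1)" .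
  then have "(1 / 2)^2 \<le> (\<Sum>x\<in>I. a x * 1)^2" by (intro power_mono) auto
  also have "\<dots> \<le> (\<Sum>x\<in>I. (a x)^2) * (\<Sum>x\<in>I. 1^2)" by (rule Cauchy_Schwarz_ineq_sum)
  also have "\<dots> = (\<Sum>x\<in>I. (a x)^2) * card I" by simp
  also have "\<dots> \<le> (\<Sum>x\<in>B. (a x)^2) * (2 * R + 1)"
  proof (rule mult_mono)
    show "(\<Sum>x\<in>I. (a x)^2) \<le> (\<Sum>x\<in>B. (a x)^2)" using I by (intro sum_mono2) auto
    have "I \<subseteq> {-\<lfloor>R\<rfloor>..\<lfloor>R\<rfloor>}" unfolding I_def by (auto simp: le_floor_iff; linarith)
    then have "card I \<le> card {-\<lfloor>R\<rfloor>..\<lfloor>R\<rfloor>}" by (intro card_mono) auto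
    then have "real (card I) \<le> real (nat (2 * \<lfloor>R\<rfloor> + 1))" by simp
    also have "\<dots> = 2 * real_of_int \<lfloor>R\<rfloor> + 1" using R by simp
    also have "\<dots> \<le> 2 * R + 1" by simp
    finally show "real (card I) \<le> 2 * R + 1" .
  qed (auto intro: sum_nonneg)
  finally show ?thesis using R by (simp add: a_def field_simps power2_eq_square)
qed

end

section \<open>The free process: exponential and second moments\<close>

text \<open>No sign condition, since the free process may become negative. Parity fixes the
  sublattice of the heights: two configurations differ at each site by an even number, which the
  couplings need (\<open>configs_gap\<close>).\<close>

definition configs :: "(int \<Rightarrow> int) set" where
  "configs = {\<zeta>. (\<forall>x. \<bar>\<zeta> x - \<zeta> (x + 1)\<bar> = 1) \<and> (\<forall>x. even (\<zeta> x - x))}"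

definition flip :: "int \<Rightarrow> (int \<Rightarrow> int) \<Rightarrow> int \<Rightarrow> int" where
  "flip x \<zeta> = \<zeta>(x := \<zeta> x + laplacian \<zeta> x)"

definition wall_flip :: "int \<Rightarrow> (int \<Rightarrow> int) \<Rightarrow> int \<Rightarrow> int" where
  "wall_flip x \<xi> = \<xi>(x := wall_update \<xi> x)"

definition dev :: "(int \<Rightarrow> real) \<Rightarrow> (int \<Rightarrow> int) \<Rightarrow> int \<Rightarrow> real" where
  "dev h \<zeta> x = real_of_int (\<zeta> x) - h x"

definition slope :: "(int \<Rightarrow> int) \<Rightarrow> int \<Rightarrow> real" where
  "slope \<zeta> e = real_of_int (\<zeta> (e + 1)) - real_of_int (\<zeta> e)"

lemma configs_neighbours:
  assumes "\<zeta> \<in> configs"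
  shows "\<zeta> (x + 1) = \<zeta> x + 1 \<or> \<zeta> (x + 1) = \<zeta> x - 1" "\<zeta> (x - 1) = \<zeta> x + 1 \<or> \<zeta> (x - 1) = \<zeta> x - 1"
proof -
  have "\<bar>\<zeta> x - \<zeta> (x + 1)\<bar> = 1" "\<bar>\<zeta> (x - 1) - \<zeta> (x - 1 + 1)\<bar> = 1"
    using assms unfolding configs_def by blast+
  then show "\<zeta> (x + 1) = \<zeta> x + 1 \<or> \<zeta> (x + 1) = \<zeta> x - 1" "\<zeta> (x - 1) = \<zeta> x + 1 \<or> \<zeta> (x - 1) = \<zeta> x - 1"
    by auto
qed

lemma configs_flip:
  assumes "\<zeta> \<in> configs"
  shows "flip x \<zeta> \<in> configs"
proof -
  have "\<bar>flip x \<zeta> y - flip x \<zeta> (y + 1)\<bar> = 1" for y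
    using configs_neighbours[OF assms, of x] configs_neighbours(1)[OF assms, of y]
    by (cases "y = x"; cases "y = x - 1") (auto simp: flip_def laplacian_def)
  moreover have "even (flip x \<zeta> y - y)" for y
  proof -
    have "even (\<zeta> y - y)" using assms by (auto simp: configs_def)
    moreover have "even (laplacian \<zeta> y)"
      using configs_neighbours[OF assms, of y] by (auto simp: laplacian_def)
    ultimately show ?thesis by (auto simp: flip_def)
  qed
  ultimately show ?thesis by (simp add: configs_def)
qed

lemma wall_flip_same: "wall_flip x \<xi> x = wall_update \<xi> x"
  by (simp add: wall_flip_def)

lemma wall_flip_other: "y \<noteq> x \<Longrightarrow> wall_flip x \<xi> y = \<xi> y"
  by (simp add: wall_flip_def)

lemma wall_flip_cases: "wall_flip x \<xi> = flip x \<xi> \<or> wall_flip x \<xi> = \<xi>"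
  by (simp add: wall_flip_def flip_def wall_update_def)

lemma configs_wall_flip: "\<xi> \<in> configs \<Longrightarrow> wall_flip x \<xi> \<in> configs"
  using wall_flip_cases[of x \<xi>] configs_flip by metis

lemma wall_flip_nonneg: "(\<And>y. 0 \<le> \<xi> y) \<Longrightarrow> 0 \<le> wall_flip x \<xi> y"
  by (simp add: wall_flip_def wall_update_def)

section \<open>Split flips and preservation of order\<close>

definition flip_up :: "int \<Rightarrow> (int \<Rightarrow> int) \<Rightarrow> int \<Rightarrow> int" where
  "flip_up x \<zeta> = (if laplacian \<zeta> x > 0 then flip x \<zeta> else \<zeta>)"

definition flip_down :: "int \<Rightarrow> (int \<Rightarrow> int) \<Rightarrow> int \<Rightarrow> int" where
  "flip_down x \<zeta> = (if laplacian \<zeta> x > 0 then \<zeta> else flip x \<zeta>)"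

definition wall_flip_down :: "int \<Rightarrow> (int \<Rightarrow> int) \<Rightarrow> int \<Rightarrow> int" where
  "wall_flip_down x \<zeta> = (if laplacian \<zeta> x > 0 then \<zeta> else wall_flip x \<zeta>)"

lemma configs_gap:
  assumes "\<zeta> \<in> configs" "\<xi> \<in> configs" "\<zeta> x \<le> \<xi> x"
  shows "\<zeta> x = \<xi> x \<or> \<zeta> x + 2 \<le> \<xi> x"
proof -
  have "even (\<zeta> x - x)" "even (\<xi> x - x)" using assms by (auto simp: configs_def)
  then have "even (\<zeta> x - \<xi> x)" by simp
  then show ?thesis using assms(3) by presburger
qed

text \<open>With a gap of at least 2 the lower height can at most catch up. With equal heights a
  local minimum of the lower configuration forces one of the upper, so both flip. For
  \<open>flip_down_mono\<close> the two configurations exchange roles.\<close>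

lemma flip_up_mono:
  assumes "\<zeta> \<in> configs" "\<xi> \<in> configs" "\<And>y. \<zeta> y \<le> \<xi> y"
  shows "flip_up x \<zeta> y \<le> flip_up x \<xi> y"
proof (cases "y = x")
  case True
  have "flip_up x \<zeta> x \<le> flip_up x \<xi> x"
    using configs_gap[OF assms(1,2) assms(3), of x] assms(3)[of "x + 1"] assms(3)[of "x - 1"]
      configs_neighbours[OF assms(1), of x] configs_neighbours[OF assms(2), of x]
    by (simp add: flip_up_def flip_def laplacian_def) linarith
  then show ?thesis using True by simp
next
  case False
  then show ?thesis using assms(3)[of y] by (simp add: flip_up_def flip_def laplacian_def)
qed

lemma flip_down_mono:
  assumes "\<zeta> \<in> configs" "\<xi> \<in> configs" "\<And>y. \<zeta> y \<le> \<xi> y"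
  shows "flip_down x \<zeta> y \<le> flip_down x \<xi> y"
proof (cases "y = x")
  case True
  have "flip_down x \<zeta> x \<le> flip_down x \<xi> x"
    using configs_gap[OF assms(1,2) assms(3), of x] assms(3)[of "x + 1"] assms(3)[of "x - 1"]
      configs_neighbours[OF assms(1), of x] configs_neighbours[OF assms(2), of x]
    by (simp add: flip_down_def flip_def laplacian_def) linarith
  then show ?thesis using True by simp
next
  case False
  then show ?thesis using assms(3)[of y] by (simp add: flip_down_def flip_def laplacian_def)
qed

lemma wall_flip_down_ge: "\<xi> \<in> configs \<Longrightarrow> (\<And>y. 0 \<le> \<xi> y) \<Longrightarrow> flip_down x \<xi> y \<le> wall_flip_down x \<xi> y"
  by (auto simp: flip_down_def wall_flip_down_def flip_def wall_flip_def wall_update_def)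

text \<open>At equal heights a local maximum of the upper configuration forces one of the lower, and
  the wall suppresses both jumps or neither; with a gap of at least 2 the upper height drops at most
  to the lower one.\<close>

lemma wall_flip_down_mono:
  assumes "\<zeta> \<in> configs" "\<xi> \<in> configs" "\<And>y. \<zeta> y \<le> \<xi> y"
  shows "wall_flip_down x \<zeta> y \<le> wall_flip_down x \<xi> y"
proof (cases "y = x")
  case True
  have "wall_flip_down x \<zeta> x \<le> wall_flip_down x \<xi> x"
    using configs_gap[OF assms(1,2) assms(3), of x] assms(3)[of "x + 1"] assms(3)[of "x - 1"]
      configs_neighbours[OF assms(1), of x] configs_neighbours[OF assms(2), of x]
    by (simp add: wall_flip_down_def wall_flip_def wall_update_def laplacian_def) linarith
  then show ?thesis using True by simp
next
  case False
  then show ?thesis using assms(3)[of y] by (simp add: wall_flip_down_def wall_flip_def wall_update_def laplacian_def)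
qed

lemma configs_ups:
  assumes "\<zeta> \<in> configs"
  shows "flip_up x \<zeta> \<in> configs" "flip_down x \<zeta> \<in> configs" "wall_flip_down x \<zeta> \<in> configs"
  using assms configs_flip configs_wall_flip
  by (simp_all add: flip_up_def flip_down_def wall_flip_down_def)

lemma lap_of_int: "lap (\<lambda>x. real_of_int (\<zeta> x)) x = real_of_int (laplacian \<zeta> x)"
  by (simp add: lap_def laplacian_def)

lemma abs_lap_le:
  assumes "\<zeta> \<in> configs"
  shows "\<bar>lap (\<lambda>x. real_of_int (\<zeta> x)) x\<bar> \<le> 2"
  using configs_neighbours[OF assms, of x] unfolding lap_of_int laplacian_def by auto

lemma exp_le_quadratic:
  fixes z :: real
  assumes "\<bar>z\<bar> \<le> 1"
  shows "exp z \<le> 1 + z + z\<^sup>2"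
proof (cases "0 \<le> z")
  case True
  then show ?thesis using exp_bound[of z] assms by simp
next
  case False
  define y where "y = - z"
  have y: "0 \<le> y" using False by (simp add: y_def)
  \<comment> \<open>The quadratic Taylor lower bound for \<open>exp y\<close> reduces the claim to a
    polynomial inequality; in the product all negative terms cancel.\<close>
  have "1 \<le> (1 - y + y\<^sup>2) * (1 + y + y\<^sup>2 / 2)"
  proof -
    have "(1 - y + y\<^sup>2) * (1 + y + y\<^sup>2 / 2) = 1 + y^2/2 + y^3/2 + y^4/2"
      by (simp add: field_simps power2_eq_square power3_eq_cube power4_eq_xxxx)
    then show ?thesis using y by simp
  qed
  also have "\<dots> \<le> (1 - y + y\<^sup>2) * exp y"
  proof (rule mult_left_mono)
    show "0 \<le> 1 - y + y\<^sup>2" using assms False by (simp add: y_def)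
  qed (use exp_lower_Taylor_quadratic[OF y] in simp)
  finally have "exp (- y) \<le> 1 - y + y\<^sup>2"
    by (simp add: exp_minus field_simps)
  then show ?thesis by (simp add: y_def)
qed

section \<open>Martingale duality and moments of the free chain\<close>

context box_chain
begin

text \<open>Contains all that the chain can reach from \<open>\<zeta>0\<close>. Agreement off
  \<open>B\<close> makes deviations from the mean vanish there, as \<open>ip_heat\<close>
  requires.\<close>

definition frozen :: "(int \<Rightarrow> int) \<Rightarrow> (int \<Rightarrow> int) set" where
  "frozen \<zeta>0 = {\<zeta> \<in> configs. \<forall>x. x \<notin> B \<longrightarrow> \<zeta> x = \<zeta>0 x}"

lemma closed_flip: "closed_under flip (frozen \<zeta>0)"
  using configs_flip by (auto simp: closed_under_def frozen_def flip_def)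

lemma closed_wall_flip: "closed_under wall_flip (frozen \<zeta>0 \<inter> {\<xi>. \<forall>x. 0 \<le> \<xi> x})"
  using configs_wall_flip by (auto simp: closed_under_def frozen_def wall_flip_def wall_update_def)

lemma mean_flip: "expec flip k (\<lambda>\<zeta>. real_of_int (\<zeta> x)) \<zeta>0 = (heat ^^ k) (\<lambda>x. real_of_int (\<zeta>0 x)) x"
proof (induction k arbitrary: x)
  case (Suc k)
  have pick: "pick_op q B flip (\<lambda>\<zeta>. real_of_int (\<zeta> x)) \<zeta> = heat (\<lambda>x. real_of_int (\<zeta> x)) x" for \<zeta>
  proof -
    have "(\<Sum>y\<in>B. real_of_int (flip y \<zeta> x) - real_of_int (\<zeta> x))
        = (\<Sum>y\<in>B. if y = x then lap (\<lambda>x. real_of_int (\<zeta> x)) x else 0)"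
      by (intro sum.cong) (auto simp: flip_def lap_of_int)
    then show ?thesis by (simp add: pick_op_def heat_def)
  qed
  have "expec flip (Suc k) (\<lambda>\<zeta>. real_of_int (\<zeta> x)) \<zeta>0 = expec flip k (\<lambda>\<zeta>. heat (\<lambda>x. real_of_int (\<zeta> x)) x) \<zeta>0"
    unfolding expec_Suc pick ..
  also have "\<dots> = heat (\<lambda>x. expec flip k (\<lambda>\<zeta>. real_of_int (\<zeta> x)) \<zeta>0) x"
    by (cases "x \<in> B")
      (simp_all add: heat_def lap_def expec_add expec_diff expec_cmult)
  finally show ?case using Suc by (simp add: funpow.simps(2)[of k heat] del: funpow.simps cong: if_cong)
qed simp

lemma ip_flip:
  assumes "x \<in> B"
  shows "ip a (dev h (flip x \<zeta>)) = ip a (dev h \<zeta>) + a x * lap (\<lambda>x. real_of_int (\<zeta> x)) x"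
proof -
  have "ip a (dev h (flip x \<zeta>)) =
      (\<Sum>y\<in>B. a y * dev h \<zeta> y + (if y = x then a x * lap (\<lambda>x. real_of_int (\<zeta> x)) x else 0))"
    unfolding ip_def by (intro sum.cong) (auto simp: dev_def flip_def lap_of_int algebra_simps)
  then show ?thesis using assms by (simp add: sum.distrib ip_def)
qed

text \<open>Duality: the mean effect of a step on the heights is transferred to \<open>a\<close>. It
  makes the pairing of \<open>(heat ^^ (k - j)) a\<close> with the deviation from the mean at time
  \<open>j\<close> a martingale in \<open>j\<close>.\<close>

lemma ip_drift:
  assumes "vanishing a" "\<And>x. x \<notin> B \<Longrightarrow> real_of_int (\<zeta> x) = h x"
  shows "ip a (dev (heat h) \<zeta>) + q * (\<Sum>x\<in>B. a x * lap (\<lambda>x. real_of_int (\<zeta> x)) x)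
    = ip (heat a) (dev h \<zeta>)"
proof -
  have "ip (heat a) (dev h \<zeta>) = ip a (heat (dev h \<zeta>))"
    by (rule ip_heat) (use assms in \<open>auto simp: dev_def\<close>)
  also have "\<dots> = (\<Sum>x\<in>B. a x * dev (heat h) \<zeta> x + q * (a x * lap (\<lambda>x. real_of_int (\<zeta> x)) x))"
    unfolding ip_def by (intro sum.cong) (auto simp: dev_def heat_def lap_def algebra_simps)
  finally show ?thesis by (simp add: sum.distrib sum_distrib_left ip_def)
qed

text \<open>Since jumps are at most 2 and \<bar>l\<bar> is at most 1/2,
  \<open>exp_le_quadratic\<close> applies to every increment. Its linear terms are the drift that
  turns \<open>a\<close> into \<open>heat a\<close>; its quadratic terms are at most
  \<open>4 * l\<^sup>2 * (a x)\<^sup>2\<close>.\<close>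

lemma exp_moment_step:
  assumes a: "vanishing a" "\<And>x. 0 \<le> a x" "\<And>x. a x \<le> 1" and l: "\<bar>l\<bar> \<le> 1 / 2"
    and \<zeta>: "\<zeta> \<in> configs" "\<And>x. x \<notin> B \<Longrightarrow> real_of_int (\<zeta> x) = h x"
  shows "pick_op q B flip (\<lambda>\<zeta>. exp (l * ip a (dev (heat h) \<zeta>))) \<zeta>
    \<le> exp (l * ip (heat a) (dev h \<zeta>)) * exp (4 * q * l\<^sup>2 * (\<Sum>x\<in>B. (a x)\<^sup>2))"
proof -
  define X where "X = l * ip a (dev (heat h) \<zeta>)"
  define d where "d x = lap (\<lambda>x. real_of_int (\<zeta> x)) x" for x
  have d: "\<bar>d x\<bar> \<le> 2" for x unfolding d_def by (rule abs_lap_le[OF \<zeta>(1)])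
  have z: "\<bar>l * (a x * d x)\<bar> \<le> 1" "(l * (a x * d x))\<^sup>2 \<le> 4 * l\<^sup>2 * (a x)\<^sup>2" for x
  proof -
    have "\<bar>a x * d x\<bar> \<le> 1 * 2" unfolding abs_mult using a d[of x] by (intro mult_mono) auto
    then have "\<bar>l\<bar> * \<bar>a x * d x\<bar> \<le> (1/2) * 2" using l by (intro mult_mono) auto
    then show "\<bar>l * (a x * d x)\<bar> \<le> 1" by (simp add: abs_mult)
    have "(d x)\<^sup>2 \<le> 2\<^sup>2" using d[of x] by (subst abs_le_square_iff[symmetric]) simp
    then have "(l * a x)\<^sup>2 * (d x)\<^sup>2 \<le> (l * a x)\<^sup>2 * 2\<^sup>2" by (intro mult_left_mono) auto
    then show "(l * (a x * d x))\<^sup>2 \<le> 4 * l\<^sup>2 * (a x)\<^sup>2" by (simp add: power_mult_distrib mult_ac)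
  qed
  have "pick_op q B flip (\<lambda>\<zeta>. exp (l * ip a (dev (heat h) \<zeta>))) \<zeta>
      = exp X + q * (\<Sum>x\<in>B. exp (X + l * (a x * d x)) - exp X)"
    unfolding pick_op_def X_def d_def
    by (intro arg_cong2[where f = "(+)"] arg_cong2[where f = "(*)"] sum.cong refl)
      (simp add: ip_flip algebra_simps)
  also have "\<dots> = exp X * (1 + q * (\<Sum>x\<in>B. exp (l * (a x * d x)) - 1))"
    by (simp add: exp_add sum_distrib_left algebra_simps)
  also have "\<dots> \<le> exp X * (1 + q * (\<Sum>x\<in>B. l * (a x * d x) + 4 * l\<^sup>2 * (a x)\<^sup>2))"
  proof (intro mult_left_mono add_left_mono sum_mono)
    fix x
    show "exp (l * (a x * d x)) - 1 \<le> l * (a x * d x) + 4 * l\<^sup>2 * (a x)\<^sup>2"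
      using exp_le_quadratic[OF z(1)[of x]] z(2)[of x] by linarith
  qed (use q_nonneg in auto)
  also have "\<dots> \<le> exp X * exp (q * (\<Sum>x\<in>B. l * (a x * d x) + 4 * l\<^sup>2 * (a x)\<^sup>2))"
    by (intro mult_left_mono) auto
  also have "\<dots> = exp (l * (ip a (dev (heat h) \<zeta>) + q * (\<Sum>x\<in>B. a x * d x))) * exp (4 * q * l\<^sup>2 * (\<Sum>x\<in>B. (a x)\<^sup>2))"
    unfolding X_def exp_add[symmetric]
    by (simp add: sum.distrib sum_distrib_left algebra_simps)
  also have "\<dots> = exp (l * ip (heat a) (dev h \<zeta>)) * exp (4 * q * l\<^sup>2 * (\<Sum>x\<in>B. (a x)\<^sup>2))"
    unfolding d_def by (subst ip_drift[OF a(1) \<zeta>(2)]) auto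
  finally show ?thesis .
qed

lemma heat_01:
  assumes "\<And>x. 0 \<le> a x" "\<And>x. a x \<le> 1" "vanishing a"
  shows "0 \<le> heat a x" "heat a x \<le> 1" "x \<notin> B \<Longrightarrow> heat a x = 0"
  using heat_pow_bounds[of 0 a 1 1 x] heat_off[of x 1 a] assms by auto

text \<open>The induction removes the last step and replaces \<open>a\<close> by
  \<open>heat a\<close>; this is why \<open>a\<close> is general although \<open>delta z\<close> is
  the case of interest.\<close>

lemma exp_moment:
  assumes a: "vanishing a" "\<And>x. 0 \<le> a x" "\<And>x. a x \<le> 1" and l: "\<bar>l\<bar> \<le> 1 / 2"
    and \<zeta>0: "\<zeta>0 \<in> configs"
  shows "expec flip k (\<lambda>\<zeta>. exp (l * ip a (dev ((heat ^^ k) (\<lambda>x. real_of_int (\<zeta>0 x))) \<zeta>))) \<zeta>0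
    \<le> exp (4 * q * l\<^sup>2 * (\<Sum>j<k. \<Sum>x\<in>B. ((heat ^^ j) a x)\<^sup>2))"
  using a
proof (induction k arbitrary: a)
  case 0
  then show ?case by (simp add: ip_def dev_def)
next
  case (Suc k)
  define h where "h = (heat ^^ k) (\<lambda>x. real_of_int (\<zeta>0 x))"
  define c where "c = 4 * q * l\<^sup>2 * (\<Sum>x\<in>B. (a x)\<^sup>2)"
  have h: "h x = real_of_int (\<zeta>0 x)" if "x \<notin> B" for x
    using that by (simp add: h_def heat_off)
  have "expec flip (Suc k) (\<lambda>\<zeta>. exp (l * ip a (dev ((heat ^^ Suc k) (\<lambda>x. real_of_int (\<zeta>0 x))) \<zeta>))) \<zeta>0
      = expec flip k (pick_op q B flip (\<lambda>\<zeta>. exp (l * ip a (dev (heat h) \<zeta>)))) \<zeta>0"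
    by (simp add: expec_Suc h_def)
  also have "\<dots> \<le> expec flip k (\<lambda>\<zeta>. exp c * exp (l * ip (heat a) (dev h \<zeta>))) \<zeta>0"
  proof (rule expec_mono[OF closed_flip[of \<zeta>0]])
    show "\<zeta>0 \<in> frozen \<zeta>0" using \<zeta>0 by (simp add: frozen_def)
    fix \<zeta> assume "\<zeta> \<in> frozen \<zeta>0"
    then show "pick_op q B flip (\<lambda>\<zeta>. exp (l * ip a (dev (heat h) \<zeta>))) \<zeta>
        \<le> exp c * exp (l * ip (heat a) (dev h \<zeta>))"
      using exp_moment_step[OF Suc.prems l, of \<zeta> h] h by (simp add: frozen_def c_def mult.commute)
  qed
  also have "\<dots> \<le> exp c * exp (4 * q * l\<^sup>2 * (\<Sum>j<k. \<Sum>x\<in>B. ((heat ^^ j) (heat a) x)\<^sup>2))"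
    unfolding expec_cmult h_def
    by (intro mult_left_mono Suc.IH) (use heat_01[of a] Suc.prems in auto)
  also have "\<dots> = exp (4 * q * l\<^sup>2 * (\<Sum>j<Suc k. \<Sum>x\<in>B. ((heat ^^ j) a x)\<^sup>2))"
    unfolding exp_add[symmetric] c_def sum.lessThan_Suc_shift heat_Suc
    by (simp add: algebra_simps)
  finally show ?case .
qed

lemma exp_moment_height:
  assumes "z \<in> B" "R > 0" "\<bar>l\<bar> \<le> 1 / 2" "\<zeta>0 \<in> configs"
  shows "expec flip k (\<lambda>\<zeta>. exp (l * (real_of_int (\<zeta> z) - (heat ^^ k) (\<lambda>x. real_of_int (\<zeta>0 x)) z))) \<zeta>0
    \<le> exp (4 * l\<^sup>2 * (R / 4 + q * k / R))"
proof -
  have "expec flip k (\<lambda>\<zeta>. exp (l * ip (delta z) (dev ((heat ^^ k) (\<lambda>x. real_of_int (\<zeta>0 x))) \<zeta>))) \<zeta>0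
      \<le> exp (4 * q * l\<^sup>2 * (\<Sum>j<k. \<Sum>x\<in>B. ((heat ^^ j) (delta z) x)\<^sup>2))"
    using assms by (intro exp_moment) (auto simp: delta_def)
  also have "\<dots> \<le> exp (4 * l\<^sup>2 * (R / 4 + q * k / R))"
    using mult_left_mono[OF energy_upper[OF assms(1,2), of k], of "4 * l\<^sup>2"] by (simp add: mult_ac)
  finally show ?thesis using assms(1) by (simp add: ip_delta dev_def)
qed

text \<open>A conditional variance is a second moment minus a squared drift. In a discrete step the
  latter does not vanish, hence the subtracted term of order \<open>q\<^sup>2\<close>.\<close>

lemma second_moment_step:
  assumes a: "vanishing a" and \<zeta>: "\<And>x. x \<notin> B \<Longrightarrow> real_of_int (\<zeta> x) = h x"
  shows "pick_op q B flip (\<lambda>\<zeta>. (ip a (dev (heat h) \<zeta>))\<^sup>2) \<zeta>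
    = (ip (heat a) (dev h \<zeta>))\<^sup>2 + q * (\<Sum>x\<in>B. (a x)\<^sup>2 * (lap (\<lambda>x. real_of_int (\<zeta> x)) x)\<^sup>2)
      - q\<^sup>2 * (\<Sum>x\<in>B. a x * lap (\<lambda>x. real_of_int (\<zeta> x)) x)\<^sup>2"
proof -
  define X where "X = ip a (dev (heat h) \<zeta>)"
  define d where "d x = lap (\<lambda>x. real_of_int (\<zeta> x)) x" for x
  define L where "L = (\<Sum>x\<in>B. a x * d x)"
  have "pick_op q B flip (\<lambda>\<zeta>. (ip a (dev (heat h) \<zeta>))\<^sup>2) \<zeta>
      = X\<^sup>2 + q * (\<Sum>x\<in>B. (X + a x * d x)\<^sup>2 - X\<^sup>2)"
    unfolding pick_op_def X_def d_def
    by (intro arg_cong2[where f = "(+)"] arg_cong2[where f = "(*)"] sum.cong refl)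
      (simp add: ip_flip)
  also have "(\<Sum>x\<in>B. (X + a x * d x)\<^sup>2 - X\<^sup>2) = (\<Sum>x\<in>B. 2 * X * (a x * d x) + (a x)\<^sup>2 * (d x)\<^sup>2)"
    by (intro sum.cong) (auto simp: power2_eq_square algebra_simps)
  also have "\<dots> = 2 * X * L + (\<Sum>x\<in>B. (a x)\<^sup>2 * (d x)\<^sup>2)"
    by (simp add: L_def sum.distrib sum_distrib_left)
  also have "X\<^sup>2 + q * (2 * X * L + (\<Sum>x\<in>B. (a x)\<^sup>2 * (d x)\<^sup>2))
      = (X + q * L)\<^sup>2 + q * (\<Sum>x\<in>B. (a x)\<^sup>2 * (d x)\<^sup>2) - q\<^sup>2 * L\<^sup>2"
    by (simp add: power2_eq_square algebra_simps)
  also have "X + q * L = ip (heat a) (dev h \<zeta>)"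
    unfolding X_def L_def d_def by (rule ip_drift) (use assms in auto)
  finally show ?thesis by (simp add: L_def d_def)
qed

text \<open>\<open>lower\<close> bounds the mean square jump at each site, and so the bracket, from
  below. The squared drift costs at most \<open>q\<^sup>2 * (2 * real (card B))\<^sup>2\<close> per
  step, which a fine mesh makes negligible in total.\<close>

lemma second_moment:
  assumes a: "vanishing a" "\<And>x. 0 \<le> a x" "\<And>x. a x \<le> 1" and \<zeta>0: "\<zeta>0 \<in> configs"
    and lower: "\<And>k x. k < K \<Longrightarrow> x \<in> B \<Longrightarrow> 1 \<le> expec flip k (\<lambda>\<zeta>. (lap (\<lambda>x. real_of_int (\<zeta> x)) x)\<^sup>2) \<zeta>0"
    and k: "k \<le> K"
  shows "q * (\<Sum>j<k. \<Sum>x\<in>B. ((heat ^^ j) a x)\<^sup>2) - 4 * q\<^sup>2 * (real (card B))\<^sup>2 * k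
    \<le> expec flip k (\<lambda>\<zeta>. (ip a (dev ((heat ^^ k) (\<lambda>x. real_of_int (\<zeta>0 x))) \<zeta>))\<^sup>2) \<zeta>0"
  using a k
proof (induction k arbitrary: a)
  case 0
  then show ?case by (simp add: ip_def dev_def)
next
  case (Suc k)
  define h where "h = (heat ^^ k) (\<lambda>x. real_of_int (\<zeta>0 x))"
  have h: "h x = real_of_int (\<zeta>0 x)" if "x \<notin> B" for x
    using that by (simp add: h_def heat_off)
  define d where "d \<zeta> x = lap (\<lambda>x. real_of_int (\<zeta> x)) x" for \<zeta> x
  have "expec flip (Suc k) (\<lambda>\<zeta>. (ip a (dev ((heat ^^ Suc k) (\<lambda>x. real_of_int (\<zeta>0 x))) \<zeta>))\<^sup>2) \<zeta>0
      = expec flip k (pick_op q B flip (\<lambda>\<zeta>. (ip a (dev (heat h) \<zeta>))\<^sup>2)) \<zeta>0"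
    by (simp add: expec_Suc h_def)
  also have "\<dots> \<ge> expec flip k (\<lambda>\<zeta>. (ip (heat a) (dev h \<zeta>))\<^sup>2 + q * (\<Sum>x\<in>B. (a x)\<^sup>2 * (d \<zeta> x)\<^sup>2)
      - q\<^sup>2 * (2 * real (card B))\<^sup>2) \<zeta>0" (is "?l \<le> _")
  proof (rule expec_mono[OF closed_flip[of \<zeta>0]])
    show "\<zeta>0 \<in> frozen \<zeta>0" using \<zeta>0 by (simp add: frozen_def)
    fix \<zeta> assume \<zeta>: "\<zeta> \<in> frozen \<zeta>0"
    have "\<bar>\<Sum>x\<in>B. a x * d \<zeta> x\<bar> \<le> (\<Sum>x\<in>B. \<bar>a x * d \<zeta> x\<bar>)" by (rule sum_abs)
    also have "\<dots> \<le> (\<Sum>x\<in>B. 1 * 2)"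
      unfolding abs_mult using Suc.prems abs_lap_le[of \<zeta>] \<zeta>
      by (intro sum_mono mult_mono) (auto simp: frozen_def d_def)
    finally have "(\<Sum>x\<in>B. a x * d \<zeta> x)\<^sup>2 \<le> (2 * real (card B))\<^sup>2"
      by (subst abs_le_square_iff[symmetric]) simp
    then have "q\<^sup>2 * (\<Sum>x\<in>B. a x * d \<zeta> x)\<^sup>2 \<le> q\<^sup>2 * (2 * real (card B))\<^sup>2"
      by (intro mult_left_mono) auto
    moreover have "\<And>x. x \<notin> B \<Longrightarrow> real_of_int (\<zeta> x) = h x" using \<zeta> h by (auto simp: frozen_def)
    ultimately show "(ip (heat a) (dev h \<zeta>))\<^sup>2 + q * (\<Sum>x\<in>B. (a x)\<^sup>2 * (d \<zeta> x)\<^sup>2)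
      - q\<^sup>2 * (2 * real (card B))\<^sup>2 \<le> pick_op q B flip (\<lambda>\<zeta>. (ip a (dev (heat h) \<zeta>))\<^sup>2) \<zeta>"
      using second_moment_step[OF Suc.prems(1), of \<zeta> h] by (simp add: d_def)
  qed
  moreover have "?l = expec flip k (\<lambda>\<zeta>. (ip (heat a) (dev h \<zeta>))\<^sup>2) \<zeta>0
      + q * (\<Sum>x\<in>B. (a x)\<^sup>2 * expec flip k (\<lambda>\<zeta>. (d \<zeta> x)\<^sup>2) \<zeta>0) - q\<^sup>2 * (2 * real (card B))\<^sup>2"
    by (simp only: expec_add expec_diff expec_cmult expec_sum expec_const)
  moreover have "q * (\<Sum>j<k. \<Sum>x\<in>B. ((heat ^^ j) (heat a) x)\<^sup>2) - 4 * q\<^sup>2 * (real (card B))\<^sup>2 * k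
      \<le> expec flip k (\<lambda>\<zeta>. (ip (heat a) (dev h \<zeta>))\<^sup>2) \<zeta>0"
    unfolding h_def by (intro Suc.IH) (use heat_01[of a] Suc.prems in auto)
  moreover have "q * (\<Sum>x\<in>B. (a x)\<^sup>2) \<le> q * (\<Sum>x\<in>B. (a x)\<^sup>2 * expec flip k (\<lambda>\<zeta>. (d \<zeta> x)\<^sup>2) \<zeta>0)"
  proof (intro mult_left_mono sum_mono)
    fix x assume "x \<in> B"
    then have "(a x)\<^sup>2 * 1 \<le> (a x)\<^sup>2 * expec flip k (\<lambda>\<zeta>. (d \<zeta> x)\<^sup>2) \<zeta>0"
      unfolding d_def using lower[of k x] Suc.prems by (intro mult_left_mono) auto
    then show "(a x)\<^sup>2 \<le> (a x)\<^sup>2 * expec flip k (\<lambda>\<zeta>. (d \<zeta> x)\<^sup>2) \<zeta>0" by simp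
  qed (use q_nonneg in auto)
  moreover have "q * (\<Sum>j<Suc k. \<Sum>x\<in>B. ((heat ^^ j) a x)\<^sup>2)
      = q * (\<Sum>x\<in>B. (a x)\<^sup>2) + q * (\<Sum>j<k. \<Sum>x\<in>B. ((heat ^^ j) (heat a) x)\<^sup>2)"
    unfolding sum.lessThan_Suc_shift heat_Suc by (simp add: algebra_simps)
  moreover have "4 * q\<^sup>2 * (real (card B))\<^sup>2 * Suc k = 4 * q\<^sup>2 * (real (card B))\<^sup>2 * k + q\<^sup>2 * (2 * real (card B))\<^sup>2"
    by (simp add: algebra_simps power2_eq_square)
  ultimately show ?case by linarith
qed

end

section \<open>Monotone coupling and bounds for the box chain\<close>

lemma raised_configs:
  assumes "even c"
  shows "(\<lambda>x. c + x mod 2) \<in> configs"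
proof -
  have "\<bar>(c + x mod 2) - (c + (x + 1) mod 2)\<bar> = 1" for x :: int by presburger
  moreover have "even (c + x mod 2 - x)" for x :: int using assms by presburger
  ultimately show ?thesis by (simp add: configs_def)
qed

lemma flat_configs: "(\<lambda>x. x mod 2) \<in> configs"
  using raised_configs[of 0] by simp

text \<open>A flip exchanges the slopes on the two edges at \<open>x\<close>, as in the stirring
  representation of symmetric exclusion.\<close>

lemma slope_flip:
  "slope (flip x \<zeta>) e = (if x = e then slope \<zeta> (e - 1) else if x = e + 1 then slope \<zeta> (e + 1) else slope \<zeta> e)"
  by (auto simp: slope_def flip_def laplacian_def)

text \<open>The bound y/4 \<le> exp (y/4) is raised to the fourth power; 256 is
  \<open>4 ^ 4\<close>.\<close>

lemma exp_ge_power4: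
  fixes z :: real
  shows "z ^ 4 \<le> 256 * (exp z + exp (- z))"
proof -
  have pos: "y ^ 4 \<le> 256 * exp y" if "0 \<le> y" for y :: real
  proof -
    have "y / 4 \<le> exp (y / 4)"
      using exp_ge_add_one_self[of "y / 4"] by linarith
    then have "(y / 4) ^ 4 \<le> exp (y / 4) ^ 4"
      using that by (intro power_mono) auto
    also have "\<dots> = exp y" by (simp add: exp_of_nat_mult[symmetric])
    finally show ?thesis by (simp add: power_divide)
  qed
  have le: "a \<le> 256 * (x + y)" if "a \<le> 256 * max x y" "0 < x" "0 < y" for a x y :: real
    using that by (auto simp: max_def split: if_splits)
  have "z ^ 4 \<le> 256 * exp \<bar>z\<bar>" using pos[of "\<bar>z\<bar>"] by simp
  also have "exp \<bar>z\<bar> = max (exp z) (exp (- z))" by (simp add: abs_real_def max_def)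
  finally show ?thesis by (rule le) simp_all
qed

text \<open>Truncation at level \<open>s\<close>: below it the square of z is at most s
  \<bar>z\<bar>, above it the left-hand side is not positive. In the mean this turns a lower bound
  on the second moment and an upper bound on the fourth into a lower bound on the first.\<close>

lemma abs_ge_moments:
  fixes z :: real
  assumes "0 < s"
  shows "(z\<^sup>2 - z ^ 4 / s\<^sup>2) / s \<le> \<bar>z\<bar>"
proof (cases "\<bar>z\<bar> \<le> s")
  case True
  have "z\<^sup>2 = \<bar>z\<bar> * \<bar>z\<bar>" by (simp add: power2_eq_square)
  also have "\<dots> \<le> \<bar>z\<bar> * s" using True by (intro mult_left_mono) auto
  finally have "z\<^sup>2 - z ^ 4 / s\<^sup>2 \<le> \<bar>z\<bar> * s" using zero_le_even_power[of 4 z] assms by (smt (verit) divide_nonneg_nonneg even_numeral zero_le_power2)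
  then show ?thesis using assms by (simp add: pos_divide_le_eq)
next
  case False
  then have "s\<^sup>2 \<le> z\<^sup>2" using assms by (subst abs_le_square_iff[symmetric]) auto
  then have "z\<^sup>2 * s\<^sup>2 \<le> z\<^sup>2 * z\<^sup>2" by (intro mult_left_mono) auto
  then have "z\<^sup>2 \<le> z ^ 4 / s\<^sup>2" using assms by (simp add: field_simps power2_eq_square power4_eq_xxxx)
  then have "(z\<^sup>2 - z ^ 4 / s\<^sup>2) / s \<le> 0" using assms by (simp add: divide_nonpos_pos)
  then show ?thesis by linarith
qed

text \<open>Only the upper configuration has to be nonnegative, because the lower one may belong to
  the free chain; \<open>coupled_wall_wall\<close> adds the sign condition on the lower one.\<close>

definition ordered_pair :: "(int \<Rightarrow> int) \<Rightarrow> (int \<Rightarrow> int) \<Rightarrow> bool" where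
  "ordered_pair \<zeta> \<xi> \<longleftrightarrow> \<zeta> \<in> configs \<and> \<xi> \<in> configs \<and> (\<forall>x. \<zeta> x \<le> \<xi> x) \<and> (\<forall>x. 0 \<le> \<xi> x)"

lemma flip_up_nonneg: "(\<And>y. 0 \<le> \<xi> y) \<Longrightarrow> 0 \<le> flip_up x \<xi> y"
  by (simp add: flip_up_def flip_def)

lemma wall_flip_down_nonneg: "(\<And>y. 0 \<le> \<xi> y) \<Longrightarrow> 0 \<le> wall_flip_down x \<xi> y"
  by (simp add: wall_flip_down_def wall_flip_nonneg)

context box_chain
begin

lemma splits_flip: "splits (flip_up x \<zeta>) (flip_down x \<zeta>) \<zeta> (flip x \<zeta>)"
  by (simp add: splits_def flip_up_def flip_down_def)

text \<open>A local minimum moves upwards, where the wall does not interfere; so only the down half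
  needs a wall version.\<close>

lemma splits_wall_flip:
  assumes "\<And>y. 0 \<le> \<xi> y"
  shows "splits (flip_up x \<xi>) (wall_flip_down x \<xi>) \<xi> (wall_flip x \<xi>)"
  using assms[of x]
  by (auto simp: splits_def flip_up_def wall_flip_down_def wall_flip_def flip_def wall_update_def)

lemma coupled_free_wall:
  "coupled ordered_pair flip flip_up flip_down wall_flip flip_up wall_flip_down"
  unfolding coupled_def
proof (intro allI impI conjI)
  fix x \<zeta> \<xi> assume R: "ordered_pair \<zeta> \<xi>"
  then have *: "\<zeta> \<in> configs" "\<xi> \<in> configs" "\<And>y. \<zeta> y \<le> \<xi> y" "\<And>y. 0 \<le> \<xi> y"
    by (auto simp: ordered_pair_def)
  show "splits (flip_up x \<zeta>) (flip_down x \<zeta>) \<zeta> (flip x \<zeta>)" by (rule splits_flip)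
  show "splits (flip_up x \<xi>) (wall_flip_down x \<xi>) \<xi> (wall_flip x \<xi>)" by (rule splits_wall_flip[OF *(4)])
  show "ordered_pair (flip_up x \<zeta>) (flip_up x \<xi>)"
    using * configs_ups flip_up_mono flip_up_nonneg by (auto simp: ordered_pair_def)
  have "flip_down x \<zeta> y \<le> wall_flip_down x \<xi> y" for y
    using flip_down_mono[OF *(1-3), of x y] wall_flip_down_ge[OF *(2,4), of x y] by linarith
  then show "ordered_pair (flip_down x \<zeta>) (wall_flip_down x \<xi>)"
    using * configs_ups wall_flip_down_nonneg by (auto simp: ordered_pair_def)
qed

lemma coupled_wall_wall:
  "coupled (\<lambda>\<zeta> \<xi>. ordered_pair \<zeta> \<xi> \<and> (\<forall>y. 0 \<le> \<zeta> y))
    wall_flip flip_up wall_flip_down wall_flip flip_up wall_flip_down"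
  unfolding coupled_def
proof (intro allI impI)
  fix x \<zeta> \<xi> assume R: "ordered_pair \<zeta> \<xi> \<and> (\<forall>y. 0 \<le> \<zeta> y)"
  then have *: "\<zeta> \<in> configs" "\<xi> \<in> configs" "\<And>y. \<zeta> y \<le> \<xi> y" "\<And>y. 0 \<le> \<xi> y" "\<And>y. 0 \<le> \<zeta> y"
    by (auto simp: ordered_pair_def)
  show "splits (flip_up x \<zeta>) (wall_flip_down x \<zeta>) \<zeta> (wall_flip x \<zeta>) \<and>
    splits (flip_up x \<xi>) (wall_flip_down x \<xi>) \<xi> (wall_flip x \<xi>) \<and>
    (ordered_pair (flip_up x \<zeta>) (flip_up x \<xi>) \<and> (\<forall>y. 0 \<le> flip_up x \<zeta> y)) \<and>
    ordered_pair (wall_flip_down x \<zeta>) (wall_flip_down x \<xi>) \<and> (\<forall>y. 0 \<le> wall_flip_down x \<zeta> y)"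
    using * configs_ups flip_up_mono flip_up_nonneg wall_flip_down_nonneg wall_flip_down_mono
      splits_wall_flip[of \<zeta> x] splits_wall_flip[of \<xi> x]
    by (auto simp: ordered_pair_def)
qed

section \<open>Two-point function of the slopes\<close>

lemma pick_slopes:
  fixes \<zeta> e f
  defines "c \<equiv> \<lambda>x. if x \<in> B then q else 0" and "\<eta> \<equiv> slope \<zeta>"
  shows "e + 1 < f \<Longrightarrow> pick_op q B flip (\<lambda>\<zeta>. slope \<zeta> e * slope \<zeta> f) \<zeta> = \<eta> e * \<eta> f
      + c e * (\<eta> (e - 1) * \<eta> f - \<eta> e * \<eta> f) + c (e + 1) * (\<eta> (e + 1) * \<eta> f - \<eta> e * \<eta> f)
      + c f * (\<eta> e * \<eta> (f - 1) - \<eta> e * \<eta> f) + c (f + 1) * (\<eta> e * \<eta> (f + 1) - \<eta> e * \<eta> f)"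
    and "pick_op q B flip (\<lambda>\<zeta>. slope \<zeta> e * slope \<zeta> (e + 1)) \<zeta> = \<eta> e * \<eta> (e + 1)
      + c e * (\<eta> (e - 1) * \<eta> (e + 1) - \<eta> e * \<eta> (e + 1))
      + c (e + 2) * (\<eta> e * \<eta> (e + 2) - \<eta> e * \<eta> (e + 1))"
proof -
  have c: "q * (\<Sum>x\<in>B. if x = y then d else 0) = c y * d" for y d
    by (simp add: c_def)
  assume f: "e + 1 < f"
  have "(\<Sum>x\<in>B. slope (flip x \<zeta>) e * slope (flip x \<zeta>) f - slope \<zeta> e * slope \<zeta> f)
    = (\<Sum>x\<in>B. (if x = e then \<eta> (e - 1) * \<eta> f - \<eta> e * \<eta> f else 0)
        + (if x = e + 1 then \<eta> (e + 1) * \<eta> f - \<eta> e * \<eta> f else 0)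
        + (if x = f then \<eta> e * \<eta> (f - 1) - \<eta> e * \<eta> f else 0)
        + (if x = f + 1 then \<eta> e * \<eta> (f + 1) - \<eta> e * \<eta> f else 0))"
    using f by (intro sum.cong) (auto simp: slope_flip \<eta>_def)
  then show "pick_op q B flip (\<lambda>\<zeta>. slope \<zeta> e * slope \<zeta> f) \<zeta> = \<eta> e * \<eta> f
      + c e * (\<eta> (e - 1) * \<eta> f - \<eta> e * \<eta> f) + c (e + 1) * (\<eta> (e + 1) * \<eta> f - \<eta> e * \<eta> f)
      + c f * (\<eta> e * \<eta> (f - 1) - \<eta> e * \<eta> f) + c (f + 1) * (\<eta> e * \<eta> (f + 1) - \<eta> e * \<eta> f)"
    unfolding pick_op_def by (simp only: sum.distrib distrib_left c) (simp add: \<eta>_def)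
next
  have c: "q * (\<Sum>x\<in>B. if x = y then d else 0) = c y * d" for y d
    by (simp add: c_def)
  \<comment> \<open>A flip at the common site \<open>e + 1\<close> swaps the two factors and leaves
    the product unchanged; only the outer sites contribute.\<close>
  have "(\<Sum>x\<in>B. slope (flip x \<zeta>) e * slope (flip x \<zeta>) (e + 1) - slope \<zeta> e * slope \<zeta> (e + 1))
    = (\<Sum>x\<in>B. (if x = e then \<eta> (e - 1) * \<eta> (e + 1) - \<eta> e * \<eta> (e + 1) else 0)
        + (if x = e + 2 then \<eta> e * \<eta> (e + 2) - \<eta> e * \<eta> (e + 1) else 0))"
    by (intro sum.cong) (auto simp: slope_flip \<eta>_def algebra_simps)
  then show "pick_op q B flip (\<lambda>\<zeta>. slope \<zeta> e * slope \<zeta> (e + 1)) \<zeta> = \<eta> e * \<eta> (e + 1)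
      + c e * (\<eta> (e - 1) * \<eta> (e + 1) - \<eta> e * \<eta> (e + 1))
      + c (e + 2) * (\<eta> e * \<eta> (e + 2) - \<eta> e * \<eta> (e + 1))"
    unfolding pick_op_def by (simp only: sum.distrib distrib_left c) (simp add: \<eta>_def)
qed

text \<open>The two-point function of the slopes is compared with the product of their means, i.e. two
  exclusion particles with two independent ones.  The latter solve the same equation up to the
  double moves, of order \<open>q\<^sup>2\<close>, and a term of favourable sign, a square, on adjacent edges.\<close>

lemma two_point_step:
  fixes g :: "int \<Rightarrow> real" and G :: "int \<Rightarrow> int \<Rightarrow> real" and M :: real
  defines "c \<equiv> \<lambda>x. if x \<in> B then q else 0"
  assumes G: "\<And>e f. e < f \<Longrightarrow> G e f \<le> g e * g f + M" and g: "\<And>e. \<bar>g e\<bar> \<le> 1"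
    and g': "\<And>e. g' e = g e + c e * (g (e - 1) - g e) + c (e + 1) * (g (e + 1) - g e)"
  shows "e + 1 < f \<Longrightarrow> G e f + c e * (G (e - 1) f - G e f) + c (e + 1) * (G (e + 1) f - G e f)
      + c f * (G e (f - 1) - G e f) + c (f + 1) * (G e (f + 1) - G e f) \<le> g' e * g' f + M + 16 * q\<^sup>2"
    and "G e (e + 1) + c e * (G (e - 1) (e + 1) - G e (e + 1))
      + c (e + 2) * (G e (e + 2) - G e (e + 1)) \<le> g' e * g' (e + 1) + M + 16 * q\<^sup>2"
proof -
  have c: "0 \<le> c x" "c x \<le> q" for x using q_nonneg by (auto simp: c_def)
  have c4: "c x \<le> 1 / 4" for x using c(2)[of x] q_le by linarith
  have inc: "\<bar>g' e - g e\<bar> \<le> 4 * q" for e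
  proof -
    have "\<bar>c e * (g (e - 1) - g e)\<bar> \<le> q * 2" "\<bar>c (e + 1) * (g (e + 1) - g e)\<bar> \<le> q * 2"
      unfolding abs_mult using c g[of e] g[of "e - 1"] g[of "e + 1"] q_nonneg by (intro mult_mono; auto)+
    then show ?thesis unfolding g' by linarith
  qed
  have prod: "(g' e - g e) * (g' f - g f) \<ge> - (16 * q\<^sup>2)" for e f
  proof -
    have "\<bar>(g' e - g e) * (g' f - g f)\<bar> \<le> (4 * q) * (4 * q)"
      unfolding abs_mult using inc[of e] inc[of f] q_nonneg by (intro mult_mono) auto
    then show ?thesis by (simp add: power2_eq_square)
  qed
  {
    assume f: "e + 1 < f"
    have "G e f + c e * (G (e - 1) f - G e f) + c (e + 1) * (G (e + 1) f - G e f)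
        + c f * (G e (f - 1) - G e f) + c (f + 1) * (G e (f + 1) - G e f)
      = (1 - c e - c (e + 1) - c f - c (f + 1)) * G e f + c e * G (e - 1) f + c (e + 1) * G (e + 1) f
        + c f * G e (f - 1) + c (f + 1) * G e (f + 1)"
      by (simp add: algebra_simps)
    also have "\<dots> \<le> (1 - c e - c (e + 1) - c f - c (f + 1)) * (g e * g f + M)
        + c e * (g (e - 1) * g f + M) + c (e + 1) * (g (e + 1) * g f + M)
        + c f * (g e * g (f - 1) + M) + c (f + 1) * (g e * g (f + 1) + M)"
      using f c c4[of e] c4[of f] c4[of "e + 1"] c4[of "f + 1"]
      by (intro add_mono mult_left_mono G) auto
    also have "\<dots> = g' e * g' f + M - (g' e - g e) * (g' f - g f)"
      unfolding g' by (simp add: algebra_simps)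
    finally show "G e f + c e * (G (e - 1) f - G e f) + c (e + 1) * (G (e + 1) f - G e f)
        + c f * (G e (f - 1) - G e f) + c (f + 1) * (G e (f + 1) - G e f) \<le> g' e * g' f + M + 16 * q\<^sup>2"
      using prod[of e f] by linarith
  }
  have "G e (e + 1) + c e * (G (e - 1) (e + 1) - G e (e + 1)) + c (e + 2) * (G e (e + 2) - G e (e + 1))
    = (1 - c e - c (e + 2)) * G e (e + 1) + c e * G (e - 1) (e + 1) + c (e + 2) * G e (e + 2)"
    by (simp add: algebra_simps)
  also have "\<dots> \<le> (1 - c e - c (e + 2)) * (g e * g (e + 1) + M) + c e * (g (e - 1) * g (e + 1) + M)
      + c (e + 2) * (g e * g (e + 2) + M)"
    using c c4[of e] c4[of "e + 2"] by (intro add_mono mult_left_mono G) auto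
  also have "\<dots> = g' e * g' (e + 1) + M - (g' e - g e) * (g' (e + 1) - g (e + 1)) - c (e + 1) * (g (e + 1) - g e)\<^sup>2"
    unfolding g' by (simp add: algebra_simps power2_eq_square)
  finally show "G e (e + 1) + c e * (G (e - 1) (e + 1) - G e (e + 1))
      + c (e + 2) * (G e (e + 2) - G e (e + 1)) \<le> g' e * g' (e + 1) + M + 16 * q\<^sup>2"
    using prod[of e "e + 1"] c(1)[of "e + 1"] by (smt (verit) mult_nonneg_nonneg zero_le_power2)
qed

lemma two_point:
  fixes \<zeta>0 :: "int \<Rightarrow> int"
  defines "h \<equiv> \<lambda>k. (heat ^^ k) (\<lambda>x. real_of_int (\<zeta>0 x))"
  assumes g: "\<And>k e. \<bar>h k (e + 1) - h k e\<bar> \<le> 1" and "e < f"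
  shows "expec flip k (\<lambda>\<zeta>. slope \<zeta> e * slope \<zeta> f) \<zeta>0
    \<le> (h k (e + 1) - h k e) * (h k (f + 1) - h k f) + 16 * q\<^sup>2 * k"
  using \<open>e < f\<close>
proof (induction k arbitrary: e f)
  case 0
  then show ?case by (simp add: h_def slope_def)
next
  case (Suc k)
  define c where "c x = (if x \<in> B then q else 0)" for x
  define G where "G e f = expec flip k (\<lambda>\<zeta>. slope \<zeta> e * slope \<zeta> f) \<zeta>0" for e f
  define g where "g e = h k (e + 1) - h k e" for e
  define g' where "g' e = h (Suc k) (e + 1) - h (Suc k) e" for e
  have g1: "\<bar>g e\<bar> \<le> 1" for e unfolding g_def by (rule assms)
  have g': "g' e = g e + c e * (g (e - 1) - g e) + c (e + 1) * (g (e + 1) - g e)" for e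
  proof -
    have hS: "h (Suc k) x = h k x + c x * (h k (x + 1) - 2 * h k x + h k (x - 1))" for x
      by (simp add: h_def heat_def[of "(heat ^^ k) a" for a] c_def lap_def)
    show ?thesis unfolding g'_def g_def hS by (simp add: algebra_simps)
  qed
  have IH: "e < f \<Longrightarrow> G e f \<le> g e * g f + 16 * q\<^sup>2 * k" for e f
    unfolding G_def g_def by (rule Suc.IH)
  note step = two_point_step[of G g "16 * q\<^sup>2 * k" g', folded c_def, OF IH g1 g']
  consider "e + 1 < f" | "f = e + 1" using Suc.prems by linarith
  then have "expec flip (Suc k) (\<lambda>\<zeta>. slope \<zeta> e * slope \<zeta> f) \<zeta>0 \<le> g' e * g' f + 16 * q\<^sup>2 * k + 16 * q\<^sup>2"
  proof cases
    case 1
    have "expec flip (Suc k) (\<lambda>\<zeta>. slope \<zeta> e * slope \<zeta> f) \<zeta>0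
      = G e f + c e * (G (e - 1) f - G e f) + c (e + 1) * (G (e + 1) f - G e f)
      + c f * (G e (f - 1) - G e f) + c (f + 1) * (G e (f + 1) - G e f)"
      unfolding expec_Suc pick_slopes(1)[OF 1, folded c_def]
      by (simp only: expec_add expec_diff expec_cmult G_def)
    then show ?thesis using step(1)[OF _ 1] by simp
  next
    case 2
    have "expec flip (Suc k) (\<lambda>\<zeta>. slope \<zeta> e * slope \<zeta> f) \<zeta>0
      = G e (e + 1) + c e * (G (e - 1) (e + 1) - G e (e + 1)) + c (e + 2) * (G e (e + 2) - G e (e + 1))"
      unfolding expec_Suc 2 pick_slopes(2)[folded c_def]
      by (simp only: expec_add expec_diff expec_cmult G_def)
    then show ?thesis using step(2)[of e] 2 by simp
  qed
  then show ?case by (simp add: g'_def algebra_simps)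
qed

section \<open>The chain started from flat and raised flat configurations\<close>

lemma flat_mean_bounds:
  "0 \<le> (heat ^^ k) (\<lambda>x. real_of_int (x mod 2)) x" "(heat ^^ k) (\<lambda>x. real_of_int (x mod 2)) x \<le> 1"
proof -
  have *: "0 \<le> real_of_int (x mod 2)" "real_of_int (x mod 2) \<le> 1" for x
    using pos_mod_bound[of 2 x] by simp_all
  show "0 \<le> (heat ^^ k) (\<lambda>x. real_of_int (x mod 2)) x" "(heat ^^ k) (\<lambda>x. real_of_int (x mod 2)) x \<le> 1"
    using heat_pow_bounds[of 0 "\<lambda>x. real_of_int (x mod 2)" 1, OF *] by auto
qed

lemma flat_frozen: "(\<lambda>x. x mod 2) \<in> frozen (\<lambda>x. x mod 2)"
  using flat_configs by (simp add: frozen_def)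

text \<open>Adjacent mean slopes add up to at most 1 in absolute value, as the mean heights stay in
  \<open>[0, 1]\<close>; so their product is at most \<open>1/4\<close> and a definite fraction of the sites is flippable.\<close>

lemma expec_lap_square_ge:
  assumes "64 * q\<^sup>2 * k \<le> 1"
  shows "1 \<le> expec flip k (\<lambda>\<zeta>. (lap (\<lambda>x. real_of_int (\<zeta> x)) x)\<^sup>2) (\<lambda>x. x mod 2)"
proof -
  define h where "h k = (heat ^^ k) (\<lambda>x. real_of_int (x mod 2))" for k
  have h: "0 \<le> h k x" "h k x \<le> 1" for k x unfolding h_def by (rule flat_mean_bounds)+
  have "\<bar>h k (e + 1) - h k e\<bar> \<le> 1" for k e using h[of k e] h[of k "e + 1"] by linarith
  then have "expec flip k (\<lambda>\<zeta>. slope \<zeta> (x - 1) * slope \<zeta> x) (\<lambda>x. x mod 2)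
      \<le> (h k (x - 1 + 1) - h k (x - 1)) * (h k (x + 1) - h k x) + 16 * q\<^sup>2 * k"
    unfolding h_def by (intro two_point) auto
  also have "(h k (x - 1 + 1) - h k (x - 1)) * (h k (x + 1) - h k x) \<le> 1 / 4"
  proof -
    define u v where "u = h k x - h k (x - 1)" and "v = h k (x + 1) - h k x"
    have "\<bar>u + v\<bar> \<le> 1" using h[of k "x - 1"] h[of k "x + 1"] by (simp add: u_def v_def)
    then have "(u + v)\<^sup>2 \<le> 1" by (simp add: abs_square_le_1)
    moreover have "0 \<le> (u - v)\<^sup>2" by simp
    ultimately have "u * v \<le> 1 / 4" by (simp add: power2_eq_square algebra_simps)
    then show ?thesis by (simp add: u_def v_def)
  qed
  \<comment> \<open>The hypothesis bounds the discretisation error \<open>16 * q\<^sup>2 * k\<close>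
    by 1/4.\<close>
  finally have "expec flip k (\<lambda>\<zeta>. slope \<zeta> (x - 1) * slope \<zeta> x) (\<lambda>x. x mod 2) \<le> 1 / 2"
    using assms by simp
  moreover have "expec flip k (\<lambda>\<zeta>. (lap (\<lambda>x. real_of_int (\<zeta> x)) x)\<^sup>2) (\<lambda>x. x mod 2)
      = expec flip k (\<lambda>\<zeta>. 2 - 2 * (slope \<zeta> (x - 1) * slope \<zeta> x)) (\<lambda>x. x mod 2)"
  proof (rule expec_cong[OF closed_flip _ flat_frozen])
    fix \<zeta> assume "\<zeta> \<in> frozen (\<lambda>x. x mod 2)"
    then have "\<zeta> \<in> configs" by (simp add: frozen_def)
    from configs_neighbours[OF this, of x]
    show "(lap (\<lambda>x. real_of_int (\<zeta> x)) x)\<^sup>2 = 2 - 2 * (slope \<zeta> (x - 1) * slope \<zeta> x)"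
      by (auto simp: lap_def slope_def)
  qed
  ultimately show ?thesis by (simp add: expec_diff expec_const expec_cmult)
qed

text \<open>The deviation of the free height from its mean has mean 0, so its mean absolute value is
  twice the mean of its positive part. The mean height being nonnegative, that part is at most the
  positive part of the height, which the wall chain dominates. \<open>s\<close> is the truncation
  level of \<open>abs_ge_moments\<close>; exponential moments at \<open>l\<close> and
  \<open>- l\<close> control the fourth moment.\<close>

lemma wall_chain_lower:
  assumes R: "R > 0" "\<And>x. \<bar>x\<bar> < R \<Longrightarrow> x \<in> B" "4 * q * k \<le> R\<^sup>2" and q: "64 * q\<^sup>2 * k \<le> 1"
    and l: "0 < l" "l \<le> 1 / 2" and s: "0 < s"
  shows "((q * k / (4 * (2 * R + 1)) - 4 * q\<^sup>2 * (real (card B))\<^sup>2 * k)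
      - 512 * exp (4 * l\<^sup>2 * (R / 4 + q * k / R)) / l ^ 4 / s\<^sup>2) / s / 2
    \<le> expec wall_flip k (\<lambda>\<xi>. real_of_int (\<xi> 0)) (\<lambda>x. x mod 2)"
proof -
  define \<zeta>0 :: "int \<Rightarrow> int" where "\<zeta>0 = (\<lambda>x. x mod 2)"
  define h where "h = (heat ^^ k) (\<lambda>x. real_of_int (\<zeta>0 x)) 0"
  define Z where "Z \<zeta> = real_of_int (\<zeta> 0) - h" for \<zeta> :: "int \<Rightarrow> int"
  define E where "E = (\<lambda>f. expec flip k f \<zeta>0)"
  define C where "C = exp (4 * l\<^sup>2 * (R / 4 + q * k / R))"
  have z: "0 \<in> B" using R by simp
  have c: "\<zeta>0 \<in> configs" unfolding \<zeta>0_def by (rule flat_configs)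
  have mono: "E f \<le> E g" if "\<And>\<zeta>. f \<zeta> \<le> g \<zeta>" for f g
    unfolding E_def by (rule expec_mono[of _ UNIV]) (use that in \<open>auto simp: closed_under_def\<close>)
  have h0: "0 \<le> h" unfolding h_def \<zeta>0_def by (rule flat_mean_bounds)
  have EZ: "E Z = 0"
    unfolding Z_def E_def expec_diff expec_const mean_flip by (simp add: h_def)
  have E4: "E (\<lambda>\<zeta>. Z \<zeta> ^ 4) \<le> 512 * C / l ^ 4"
  proof -
    have "E (\<lambda>\<zeta>. l ^ 4 * Z \<zeta> ^ 4) \<le> E (\<lambda>\<zeta>. 256 * (exp (l * Z \<zeta>) + exp ((- l) * Z \<zeta>)))"
    proof (rule mono)
      fix \<zeta> show "l ^ 4 * Z \<zeta> ^ 4 \<le> 256 * (exp (l * Z \<zeta>) + exp (- l * Z \<zeta>))"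
        using exp_ge_power4[of "l * Z \<zeta>"] by (simp add: power_mult_distrib)
    qed
    also have "\<dots> = 256 * (E (\<lambda>\<zeta>. exp (l * Z \<zeta>)) + E (\<lambda>\<zeta>. exp ((- l) * Z \<zeta>)))"
      unfolding E_def expec_cmult expec_add ..
    also have "\<dots> \<le> 256 * (C + C)"
    proof -
      have "\<bar>l\<bar> \<le> 1 / 2" "\<bar>- l\<bar> \<le> 1 / 2" using l by auto
      then have "E (\<lambda>\<zeta>. exp (l * Z \<zeta>)) \<le> C" "E (\<lambda>\<zeta>. exp ((- l) * Z \<zeta>)) \<le> C"
        using exp_moment_height[OF z R(1) _ c, of l k] exp_moment_height[OF z R(1) _ c, of "- l" k]
        unfolding E_def C_def Z_def h_def by simp_all
      then show ?thesis by simp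
    qed
    finally have "l ^ 4 * E (\<lambda>\<zeta>. Z \<zeta> ^ 4) \<le> 512 * C" unfolding E_def expec_cmult by simp
    then show ?thesis using l by (simp add: field_simps)
  qed
  have E2: "q * k / (4 * (2 * R + 1)) - 4 * q\<^sup>2 * (real (card B))\<^sup>2 * k \<le> E (\<lambda>\<zeta>. (Z \<zeta>)\<^sup>2)"
  proof -
    have "(\<Sum>j<k. 1 / (4 * (2 * R + 1))) \<le> (\<Sum>j<k. \<Sum>x\<in>B. ((heat ^^ j) (delta 0) x)\<^sup>2)"
    proof (intro sum_mono energy_lower R(1,2))
      fix j assume "j \<in> {..<k}"
      then have "4 * q * j \<le> 4 * q * k" using q_nonneg by (intro mult_left_mono) auto
      then show "4 * q * j \<le> R\<^sup>2" using R(3) by linarith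
    qed
    then have "q * (\<Sum>j<k. 1 / (4 * (2 * R + 1))) \<le> q * (\<Sum>j<k. \<Sum>x\<in>B. ((heat ^^ j) (delta 0) x)\<^sup>2)"
      using q_nonneg by (rule mult_left_mono)
    moreover have "q * (\<Sum>j<k. \<Sum>x\<in>B. ((heat ^^ j) (delta 0) x)\<^sup>2) - 4 * q\<^sup>2 * (real (card B))\<^sup>2 * k
        \<le> expec flip k (\<lambda>\<zeta>. (ip (delta 0) (dev ((heat ^^ k) (\<lambda>x. real_of_int (\<zeta>0 x))) \<zeta>))\<^sup>2) \<zeta>0"
    proof (rule second_moment[OF _ _ _ c _ order.refl])
      fix j x assume "j < k"
      then have "64 * q\<^sup>2 * j \<le> 64 * q\<^sup>2 * k" by (intro mult_left_mono) auto
      then show "1 \<le> expec flip j (\<lambda>\<zeta>. (lap (\<lambda>x. real_of_int (\<zeta> x)) x)\<^sup>2) \<zeta>0"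
        unfolding \<zeta>0_def using q by (intro expec_lap_square_ge) linarith
    qed (use z in \<open>auto simp: delta_def\<close>)
    ultimately show ?thesis using z by (simp add: ip_delta dev_def E_def Z_def h_def)
  qed
  have "((q * k / (4 * (2 * R + 1)) - 4 * q\<^sup>2 * (real (card B))\<^sup>2 * k) - 512 * C / l ^ 4 / s\<^sup>2) / s
      \<le> (E (\<lambda>\<zeta>. (Z \<zeta>)\<^sup>2) - E (\<lambda>\<zeta>. Z \<zeta> ^ 4) / s\<^sup>2) / s"
    using E2 E4 s by (intro divide_right_mono diff_mono) auto
  also have "\<dots> = E (\<lambda>\<zeta>. 1 / s * ((Z \<zeta>)\<^sup>2 - 1 / s\<^sup>2 * Z \<zeta> ^ 4))"
    unfolding E_def expec_cmult expec_diff by simp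
  also have "\<dots> \<le> E (\<lambda>\<zeta>. \<bar>Z \<zeta>\<bar>)"
  proof (rule mono)
    fix \<zeta> show "1 / s * ((Z \<zeta>)\<^sup>2 - 1 / s\<^sup>2 * Z \<zeta> ^ 4) \<le> \<bar>Z \<zeta>\<bar>"
      using abs_ge_moments[OF s, of "Z \<zeta>"] by simp
  qed
  also have "\<dots> = E (\<lambda>\<zeta>. \<bar>Z \<zeta>\<bar> + Z \<zeta>)"
    using EZ unfolding E_def expec_add by simp
  also have "\<dots> \<le> E (\<lambda>\<zeta>. 2 * max 0 (real_of_int (\<zeta> 0)))"
    by (rule mono) (use h0 in \<open>auto simp: Z_def\<close>)
  also have "\<dots> = 2 * E (\<lambda>\<zeta>. max 0 (real_of_int (\<zeta> 0)))"
    unfolding E_def expec_cmult ..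
  finally have "((q * k / (4 * (2 * R + 1)) - 4 * q\<^sup>2 * (real (card B))\<^sup>2 * k) - 512 * C / l ^ 4 / s\<^sup>2) / s
      \<le> 2 * E (\<lambda>\<zeta>. max 0 (real_of_int (\<zeta> 0)))" .
  moreover have "E (\<lambda>\<zeta>. max 0 (real_of_int (\<zeta> 0))) \<le> expec wall_flip k (\<lambda>\<xi>. real_of_int (\<xi> 0)) \<zeta>0"
    unfolding E_def
    by (rule expec_coupled[OF coupled_free_wall])
      (use c in \<open>auto simp: ordered_pair_def \<zeta>0_def\<close>)
  moreover have "a / 2 \<le> d" if "a \<le> 2 * b" "b \<le> d" for a b d :: real using that by linarith
  ultimately show ?thesis unfolding \<zeta>0_def C_def by blast
qed

text \<open>A Chernoff bound: by the maximum principle the mean height is at least \<open>c\<close>,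
  so a height of at most 1 lies at least \<open>c - 1\<close> below the mean.\<close>

lemma free_low_probability:
  assumes "x \<in> B" "R > 0" "0 \<le> l" "l \<le> 1 / 2" "even c"
  shows "expec flip k (\<lambda>\<zeta>. if \<zeta> x \<le> 1 then 1 else 0) (\<lambda>y. c + y mod 2)
    \<le> exp (l * (1 - real_of_int c)) * exp (4 * l\<^sup>2 * (R / 4 + q * k / R))"
proof -
  define \<zeta>0 :: "int \<Rightarrow> int" where "\<zeta>0 = (\<lambda>x. c + x mod 2)"
  define h where "h = (heat ^^ k) (\<lambda>x. real_of_int (\<zeta>0 x)) x"
  have c: "\<zeta>0 \<in> configs" unfolding \<zeta>0_def by (rule raised_configs[OF assms(5)])
  have "real_of_int c \<le> real_of_int (\<zeta>0 y)" "real_of_int (\<zeta>0 y) \<le> real_of_int (c + 1)" for y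
    using pos_mod_bound[of 2 y] unfolding \<zeta>0_def of_int_le_iff by auto
  then have h: "c \<le> h" unfolding h_def by (rule heat_pow_bounds(1))
  have "expec flip k (\<lambda>\<zeta>. if \<zeta> x \<le> 1 then 1 else 0) \<zeta>0
      \<le> expec flip k (\<lambda>\<zeta>. exp (l * (1 - real_of_int c)) * exp ((- l) * (real_of_int (\<zeta> x) - h))) \<zeta>0"
  proof (rule expec_mono[OF closed_flip[of \<zeta>0]])
    show "\<zeta>0 \<in> frozen \<zeta>0" using c by (simp add: frozen_def)
    fix \<zeta> :: "int \<Rightarrow> int"
    have "0 \<le> l * (1 - real_of_int c) + (- l) * (real_of_int (\<zeta> x) - h)" if "\<zeta> x \<le> 1"
    proof -
      have "l * (1 - real_of_int c) + (- l) * (real_of_int (\<zeta> x) - h) = l * ((1 - real_of_int (\<zeta> x)) + (h - real_of_int c))"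
        by (simp add: algebra_simps)
      also have "\<dots> \<ge> 0" using that h assms by (intro mult_nonneg_nonneg) auto
      finally show ?thesis .
    qed
    then show "(if \<zeta> x \<le> 1 then 1 else 0) \<le> exp (l * (1 - real_of_int c)) * exp ((- l) * (real_of_int (\<zeta> x) - h))"
      by (auto simp flip: exp_add)
  qed
  also have "\<dots> \<le> exp (l * (1 - real_of_int c)) * exp (4 * l\<^sup>2 * (R / 4 + q * k / R))"
    unfolding expec_cmult h_def
    using exp_moment_height[OF assms(1,2) _ c, of "- l" k] assms by (intro mult_left_mono) auto
  finally show ?thesis by (simp add: \<zeta>0_def)
qed

text \<open>The mean height obeys the heat equation up to the jumps that the wall suppresses. These
  add at most \<open>2 * q * \<epsilon>\<close> per step, and the maximum principle carries the
  bound along uniformly in the site.\<close>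

lemma wall_drift:
  assumes \<xi>0: "\<xi>0 \<in> configs" "\<And>x. 0 \<le> \<xi>0 x" "\<And>x. real_of_int (\<xi>0 x) \<le> A"
    and eps: "\<And>k x. k < K \<Longrightarrow> x \<in> B \<Longrightarrow> expec wall_flip k (\<lambda>\<xi>. if \<xi> x \<le> 1 then 1 else 0) \<xi>0 \<le> \<epsilon>"
    and "0 \<le> \<epsilon>" "k \<le> K"
  shows "expec wall_flip k (\<lambda>\<xi>. real_of_int (\<xi> x)) \<xi>0 \<le> A + 2 * q * k * \<epsilon>"
  using \<open>k \<le> K\<close>
proof (induction k arbitrary: x)
  case 0
  then show ?case using \<xi>0(3) by simp
next
  case (Suc k)
  define i where "i = (\<lambda>\<xi>::int\<Rightarrow>int. if \<xi> x \<le> 1 then 1 else 0 :: real)"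
  define c where "c = (if x \<in> B then q else 0)"
  have c: "0 \<le> c" "c \<le> q" using q_nonneg by (auto simp: c_def)
  have "expec wall_flip (Suc k) (\<lambda>\<xi>. real_of_int (\<xi> x)) \<xi>0
      = expec wall_flip k (pick_op q B wall_flip (\<lambda>\<xi>. real_of_int (\<xi> x))) \<xi>0"
    by (simp add: expec_Suc)
  also have "\<dots> \<le> expec wall_flip k (\<lambda>\<xi>. heat (\<lambda>x. real_of_int (\<xi> x)) x + 2 * c * i \<xi>) \<xi>0"
  proof (rule expec_mono[OF closed_wall_flip[of \<xi>0]])
    show "\<xi>0 \<in> frozen \<xi>0 \<inter> {\<xi>. \<forall>x. 0 \<le> \<xi> x}" using \<xi>0 by (simp add: frozen_def)
    fix \<xi> assume \<xi>: "\<xi> \<in> frozen \<xi>0 \<inter> {\<xi>. \<forall>x. 0 \<le> \<xi> x}"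
    then have \<xi>c: "\<xi> \<in> configs" by (simp add: frozen_def)
    have "(\<Sum>y\<in>B. real_of_int (wall_flip y \<xi> x) - real_of_int (\<xi> x))
        = (\<Sum>y\<in>B. if y = x then real_of_int (wall_update \<xi> x - \<xi> x) else 0)"
      by (intro sum.cong) (auto simp: wall_flip_def)
    then have "pick_op q B wall_flip (\<lambda>\<xi>. real_of_int (\<xi> x)) \<xi>
        = real_of_int (\<xi> x) + c * real_of_int (wall_update \<xi> x - \<xi> x)"
      by (simp add: pick_op_def c_def)
    also have "\<dots> \<le> real_of_int (\<xi> x) + c * (lap (\<lambda>x. real_of_int (\<xi> x)) x + 2 * i \<xi>)"
    proof (intro add_left_mono mult_left_mono c)
      \<comment> \<open>In a nonnegative configuration suppression needs a local maximum at height
        1, and the update then exceeds the linear one by exactly 2.\<close>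
      have "wall_update \<xi> x - \<xi> x \<le> laplacian \<xi> x + 2 * (if \<xi> x \<le> 1 then 1 else 0)"
        using configs_neighbours[OF \<xi>c, of x] \<xi> by (auto simp: wall_update_def laplacian_def)
      then have "real_of_int (wall_update \<xi> x - \<xi> x) \<le> real_of_int (laplacian \<xi> x + 2 * (if \<xi> x \<le> 1 then 1 else 0))"
        by (rule of_int_le_iff[THEN iffD2])
      then show "real_of_int (wall_update \<xi> x - \<xi> x) \<le> lap (\<lambda>x. real_of_int (\<xi> x)) x + 2 * i \<xi>"
        by (simp add: lap_of_int i_def split: if_splits)
    qed
    also have "\<dots> = heat (\<lambda>x. real_of_int (\<xi> x)) x + 2 * c * i \<xi>"
      by (simp add: heat_def c_def algebra_simps)
    finally show "pick_op q B wall_flip (\<lambda>\<xi>. real_of_int (\<xi> x)) \<xi> \<le> heat (\<lambda>x. real_of_int (\<xi> x)) x + 2 * c * i \<xi>" .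
  qed
  also have "\<dots> = heat (\<lambda>x. expec wall_flip k (\<lambda>\<xi>. real_of_int (\<xi> x)) \<xi>0) x + 2 * c * expec wall_flip k i \<xi>0"
    by (cases "x \<in> B")
      (simp_all add: heat_def lap_def expec_add expec_diff expec_cmult)
  also have "\<dots> \<le> (A + 2 * q * k * \<epsilon>) + 2 * q * \<epsilon>"
  proof (rule add_mono)
    have "heat (\<lambda>x. expec wall_flip k (\<lambda>\<xi>. real_of_int (\<xi> x)) \<xi>0) x \<le> heat (\<lambda>_. A + 2 * q * k * \<epsilon>) x"
      using Suc by (intro heat_mono) auto
    then show "heat (\<lambda>x. expec wall_flip k (\<lambda>\<xi>. real_of_int (\<xi> x)) \<xi>0) x \<le> A + 2 * q * k * \<epsilon>"
      by (simp only: heat_const)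
    show "2 * c * expec wall_flip k i \<xi>0 \<le> 2 * q * \<epsilon>"
    proof (cases "x \<in> B")
      case True
      then show ?thesis using eps[of k x] Suc.prems q_nonneg by (auto simp: c_def i_def intro!: mult_left_mono)
    next
      case False
      then show ?thesis using \<open>0 \<le> \<epsilon>\<close> q_nonneg by (simp add: c_def)
    qed
  qed
  finally show ?case by (simp add: algebra_simps)
qed

text \<open>An even \<open>c\<close> keeps the raised start in the parity class of the flat one, so
  the two are comparable. The exponent grows with the number of steps, so its value at time
  \<open>k\<close> serves for all earlier times.\<close>

lemma wall_chain_upper:
  assumes "R > 0" "0 \<le> l" "l \<le> 1 / 2" "even c" "0 \<le> c"
  shows "expec wall_flip k (\<lambda>\<xi>. real_of_int (\<xi> x)) (\<lambda>y. y mod 2)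
    \<le> c + 1 + 2 * q * k * (exp (l * (1 - real_of_int c)) * exp (4 * l\<^sup>2 * (R / 4 + q * k / R)))"
proof -
  define \<epsilon> where "\<epsilon> = exp (l * (1 - real_of_int c)) * exp (4 * l\<^sup>2 * (R / 4 + q * k / R))"
  have cc: "(\<lambda>y. c + y mod 2) \<in> configs" by (rule raised_configs[OF assms(4)])
  have "expec wall_flip k (\<lambda>\<xi>. real_of_int (\<xi> x)) (\<lambda>y. y mod 2)
      \<le> expec wall_flip k (\<lambda>\<xi>. real_of_int (\<xi> x)) (\<lambda>y. c + y mod 2)"
    by (rule expec_coupled[OF coupled_wall_wall])
      (use cc flat_configs assms in \<open>auto simp: ordered_pair_def\<close>)
  also have "\<dots> \<le> (c + 1) + 2 * q * k * \<epsilon>"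
  proof (rule wall_drift[OF cc _ _ _ _ order.refl])
    fix y :: int
    show "0 \<le> c + y mod 2" using assms by simp
    show "real_of_int (c + y mod 2) \<le> c + 1" using pos_mod_bound[of 2 y] by linarith
  next
    fix j y assume j: "j < k" and y: "y \<in> B"
    have "expec wall_flip j (\<lambda>\<xi>. if \<xi> y \<le> 1 then 1 else 0) (\<lambda>y. c + y mod 2)
        \<le> expec flip j (\<lambda>\<zeta>. if \<zeta> y \<le> 1 then 1 else 0) (\<lambda>y. c + y mod 2)"
    proof -
      \<comment> \<open>The indicator of a low height is decreasing, so the coupling is applied to
        its negative.\<close>
      have "expec flip j (\<lambda>\<zeta>. - (if \<zeta> y \<le> 1 then 1 else 0)) (\<lambda>y. c + y mod 2)
        \<le> expec wall_flip j (\<lambda>\<zeta>. - (if \<zeta> y \<le> 1 then 1 else 0)) (\<lambda>y. c + y mod 2)"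
      proof (rule expec_coupled[OF coupled_free_wall])
        fix \<zeta> \<xi> assume "ordered_pair \<zeta> \<xi>"
        then have "\<zeta> y \<le> \<xi> y" by (simp add: ordered_pair_def)
        then show "- (if \<zeta> y \<le> 1 then 1 else 0) \<le> - (if \<xi> y \<le> 1 then 1 else 0 :: real)" by auto
      qed (use cc assms in \<open>auto simp: ordered_pair_def\<close>)
      then show ?thesis
        using expec_cmult[of flip j "-1" "\<lambda>\<zeta>. if \<zeta> y \<le> 1 then 1 else 0"]
          expec_cmult[of wall_flip j "-1" "\<lambda>\<zeta>. if \<zeta> y \<le> 1 then 1 else 0"] by simp
    qed
    also have "\<dots> \<le> exp (l * (1 - real_of_int c)) * exp (4 * l\<^sup>2 * (R / 4 + q * j / R))"
      by (rule free_low_probability[OF y assms(1-4)])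
    also have "\<dots> \<le> \<epsilon>"
      unfolding \<epsilon>_def using j q_nonneg assms
      by (intro mult_left_mono exp_le_cancel_iff[THEN iffD2] add_left_mono divide_right_mono) auto
    finally show "expec wall_flip j (\<lambda>\<xi>. if \<xi> y \<le> 1 then 1 else 0) (\<lambda>y. c + y mod 2) \<le> \<epsilon>" .
  qed (simp add: \<epsilon>_def)
  finally show ?thesis by (simp add: \<epsilon>_def)
qed

end

section \<open>Chains driven by independent choices\<close>

definition move :: "(int \<Rightarrow> 's \<Rightarrow> 's) \<Rightarrow> int option \<Rightarrow> 's \<Rightarrow> 's" where
  "move u p s = (case p of None \<Rightarrow> s | Some x \<Rightarrow> u x s)"

definition run :: "(int \<Rightarrow> 's \<Rightarrow> 's) \<Rightarrow> (nat \<Rightarrow> int option) \<Rightarrow> nat \<Rightarrow> 's \<Rightarrow> 's" where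
  "run u p k = fold (move u) (map p [0..<k])"

lemma run_0 [simp]: "run u p 0 s = s"
  by (simp add: run_def)

lemma run_Suc [simp]: "run u p (Suc k) s = move u (p k) (run u p k s)"
  by (simp add: run_def)

text \<open>\<open>None\<close> stands both for a step without events in \<open>B\<close> and for
  one with several; the second case is counted as an error later.\<close>

definition pick :: "int set \<Rightarrow> (int \<Rightarrow> nat) \<Rightarrow> int option" where
  "pick B v = (if \<exists>x\<in>B. v x = 1 \<and> (\<forall>y\<in>B - {x}. v y = 0)
    then Some (SOME x. x \<in> B \<and> v x = 1 \<and> (\<forall>y\<in>B - {x}. v y = 0)) else None)"

text \<open>The chain and the true process agree on an interval that loses an end point only when
  that end point is picked; \<open>frontier c\<close> counts these losses, \<open>c d\<close> being the end point after
  \<open>d\<close> of them.\<close>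

definition frontier :: "(nat \<Rightarrow> int) \<Rightarrow> int \<Rightarrow> nat \<Rightarrow> nat" where
  "frontier c x d = (if x = c d then Suc d else d)"

lemma pick_Some: "pick B v = Some x \<longleftrightarrow> x \<in> B \<and> v x = 1 \<and> (\<forall>y\<in>B - {x}. v y = 0)"
proof
  assume "pick B v = Some x"
  then have ex: "\<exists>x. x \<in> B \<and> v x = 1 \<and> (\<forall>y\<in>B - {x}. v y = 0)"
    and x: "x = (SOME x. x \<in> B \<and> v x = 1 \<and> (\<forall>y\<in>B - {x}. v y = 0))"
    by (auto simp: pick_def split: if_splits)
  show "x \<in> B \<and> v x = 1 \<and> (\<forall>y\<in>B - {x}. v y = 0)"
    unfolding x by (rule someI_ex[OF ex])
next
  assume x: "x \<in> B \<and> v x = 1 \<and> (\<forall>y\<in>B - {x}. v y = 0)"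
  have "(SOME x. x \<in> B \<and> v x = 1 \<and> (\<forall>y\<in>B - {x}. v y = 0)) = x"
  proof (rule some_equality, rule x)
    fix y assume y: "y \<in> B \<and> v y = 1 \<and> (\<forall>z\<in>B - {y}. v z = 0)"
    show "y = x"
    proof (rule ccontr)
      assume "y \<noteq> x"
      then have "y \<in> B - {x}" using y by blast
      then have "v y = 0" using x by blast
      then show False using y by simp
    qed
  qed
  then show "pick B v = Some x" using x by (auto simp: pick_def)
qed

lemma pick_range: "pick B v \<in> insert None (Some ` B)"
  by (cases "pick B v") (auto simp: pick_Some)

lemma lists_Suc: "{us. set us \<subseteq> A \<and> length us = Suc k} = (\<lambda>(a, us). a # us) ` (A \<times> {us. set us \<subseteq> A \<and> length us = k})"
  by (force simp: length_Suc_conv)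

context box_chain
begin

definition weight :: "int option \<Rightarrow> real" where
  "weight p = (case p of None \<Rightarrow> 1 - q * card B | Some x \<Rightarrow> q)"

text \<open>Expands the power of \<open>pick_op\<close> over all histories of choices; splitting off
  the first choice matches \<open>expec_Suc'\<close>.\<close>

lemma expec_as_list_sum:
  "(\<Sum>us | set us \<subseteq> insert None (Some ` B) \<and> length us = k. (\<Prod>p\<leftarrow>us. weight p) * f (fold (move u) us s))
    = expec u k f s"
proof (induction k arbitrary: s)
  case 0
  have "{us :: int option list. us = []} = {[]}" by auto
  then show ?case by (simp cong: conj_cong)
next
  case (Suc k)
  let ?A = "insert None (Some ` B)"
  have inj: "inj_on (\<lambda>(a, us). a # us) (?A \<times> {us. set us \<subseteq> ?A \<and> length us = k})"
    by (auto simp: inj_on_def)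
  have "(\<Sum>us | set us \<subseteq> ?A \<and> length us = Suc k. (\<Prod>p\<leftarrow>us. weight p) * f (fold (move u) us s))
      = (\<Sum>(a, us) \<in> ?A \<times> {us. set us \<subseteq> ?A \<and> length us = k}.
          weight a * ((\<Prod>p\<leftarrow>us. weight p) * f (fold (move u) us (move u a s))))"
    unfolding lists_Suc by (subst sum.reindex[OF inj]) (auto intro!: sum.cong simp: mult.assoc)
  also have "\<dots> = (\<Sum>a\<in>?A. weight a * expec u k f (move u a s))"
    by (subst sum.cartesian_product[symmetric]) (simp add: sum_distrib_left[symmetric] Suc)
  also have "\<dots> = pick_op q B u (expec u k f) s"
    by (subst sum.insert)
      (auto simp: sum.reindex weight_def move_def pick_op_alt sum_distrib_left)
  finally show ?case by (simp add: expec_Suc')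
qed

text \<open>There are finitely many histories, so the final value is a finite combination of their
  indicators. This allows any state type and any \<open>f\<close>, with no \<sigma>-algebra on
  states.\<close>

lemma run_expectation:
  fixes P :: "nat \<Rightarrow> 'w \<Rightarrow> int option" and f :: "'s \<Rightarrow> real"
  assumes M: "prob_space M"
    and indep: "prob_space.indep_vars M (\<lambda>_. count_space UNIV) P {..<m}"
    and range: "\<And>k \<omega>. P k \<omega> \<in> insert None (Some ` B)"
    and prob: "\<And>k x. k < m \<Longrightarrow> x \<in> B \<Longrightarrow> measure M {\<omega> \<in> space M. P k \<omega> = Some x} = q"
  shows "integrable M (\<lambda>\<omega>. f (run u (\<lambda>k. P k \<omega>) m s))"
    and "(\<integral>\<omega>. f (run u (\<lambda>k. P k \<omega>) m s) \<partial>M) = expec u m f s"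
proof -
  interpret prob_space M by fact
  define A where "A = insert None (Some ` B)"
  define L where "L = {us. set us \<subseteq> A \<and> length us = m}"
  define W where "W us = {\<omega> \<in> space M. \<forall>k<m. P k \<omega> = us ! k}" for us
  have rv [measurable]: "P k \<in> measurable M (count_space UNIV)" if "k < m" for k
    using indep that by (auto simp: indep_vars_def)
  have ev: "{\<omega> \<in> space M. P k \<omega> = p} \<in> events" if "k < m" for k p
  proof -
    have "P k -` {p} \<inter> space M \<in> events" using rv[OF that] by (rule measurable_sets) simp
    then show ?thesis by (simp add: vimage_def Int_def conj_commute)
  qed
  have fin: "finite L" unfolding L_def A_def by (rule finite_lists_length_eq) simp
  have weight: "prob {\<omega> \<in> space M. P k \<omega> = p} = weight p" if k: "k < m" and p: "p \<in> A" for k p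
  proof (cases p)
    case None
    have "{\<omega> \<in> space M. P k \<omega> = None} = space M - (\<Union>x\<in>B. {\<omega> \<in> space M. P k \<omega> = Some x})"
      using range[of k] by auto
    moreover have "(\<Union>x\<in>B. {\<omega> \<in> space M. P k \<omega> = Some x}) \<in> events"
      using ev[OF k] by (intro sets.finite_UN) auto
    ultimately have "prob {\<omega> \<in> space M. P k \<omega> = None} = 1 - prob (\<Union>x\<in>B. {\<omega> \<in> space M. P k \<omega> = Some x})"
      by (simp add: prob_compl)
    also have "prob (\<Union>x\<in>B. {\<omega> \<in> space M. P k \<omega> = Some x}) = (\<Sum>x\<in>B. prob {\<omega> \<in> space M. P k \<omega> = Some x})"
      using ev[OF k] by (intro finite_measure_finite_Union) (auto simp: disjoint_family_on_def)
    also have "\<dots> = q * card B" using prob[OF k] by simp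
    finally show ?thesis using None by (simp add: weight_def)
  next
    case (Some x)
    then show ?thesis using p prob[OF k] by (auto simp: weight_def A_def)
  qed
  have Wp: "prob (W us) = (\<Prod>p\<leftarrow>us. weight p)" and We: "W us \<in> events" if us: "us \<in> L" for us
  proof -
    have len: "length us = m" and set: "set us \<subseteq> A" using us by (auto simp: L_def)
    show "W us \<in> events"
    proof (cases "m = 0")
      case False
      have "W us = (\<Inter>k\<in>{..<m}. {\<omega> \<in> space M. P k \<omega> = us ! k})" using False by (auto simp: W_def)
      then show ?thesis using ev False by (auto intro!: sets.finite_INT)
    qed (simp add: W_def)
    show "prob (W us) = (\<Prod>p\<leftarrow>us. weight p)"
    proof (cases "m = 0")
      case True
      then show ?thesis using len by (simp add: W_def prob_space)
    next
      case False
      have "W us = (\<Inter>k\<in>{..<m}. P k -` {us ! k} \<inter> space M)" using False by (auto simp: W_def)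
      then have "prob (W us) = prob (\<Inter>k\<in>{..<m}. P k -` {us ! k} \<inter> space M)" by (simp only:)
      also have "\<dots> = (\<Prod>k<m. prob (P k -` {us ! k} \<inter> space M))"
        by (rule indep_varsD[OF indep]) (use False in auto)
      also have "\<dots> = (\<Prod>k<m. weight (us ! k))"
      proof (intro prod.cong refl)
        fix k assume "k \<in> {..<m}"
        then have "prob {\<omega> \<in> space M. P k \<omega> = us ! k} = weight (us ! k)"
          using len set by (intro weight) auto
        then show "prob (P k -` {us ! k} \<inter> space M) = weight (us ! k)"
          by (simp add: vimage_def Int_def conj_commute)
      qed
      also have "\<dots> = (\<Prod>p\<leftarrow>us. weight p)"
        by (simp add: prod.list_conv_set_nth len atLeast0LessThan)
      finally show ?thesis .
    qed
  qed
  have eq: "f (run u (\<lambda>k. P k \<omega>) m s) = (\<Sum>us\<in>L. f (fold (move u) us s) * indicator (W us) \<omega>)"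
    if \<omega>: "\<omega> \<in> space M" for \<omega>
  proof -
    define us where "us = map (\<lambda>k. P k \<omega>) [0..<m]"
    have us: "us \<in> L" using range by (auto simp: L_def us_def A_def)
    have "indicator (W vs) \<omega> = (if vs = us then 1 else 0 :: real)" if "vs \<in> L" for vs
      using that \<omega> by (auto simp: W_def us_def L_def indicator_def list_eq_iff_nth_eq)
    then have "(\<Sum>vs\<in>L. f (fold (move u) vs s) * indicator (W vs) \<omega>)
        = (\<Sum>vs\<in>L. if vs = us then f (fold (move u) us s) else 0)"
      by (intro sum.cong) auto
    also have "\<dots> = f (fold (move u) us s)" using us fin by simp
    finally show ?thesis by (simp add: run_def us_def)
  qed
  have int: "integrable M (\<lambda>\<omega>. \<Sum>us\<in>L. f (fold (move u) us s) * indicator (W us) \<omega>)"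
    using We by (intro Bochner_Integration.integrable_sum integrable_mult_right) (auto simp: less_top[symmetric])
  show "integrable M (\<lambda>\<omega>. f (run u (\<lambda>k. P k \<omega>) m s))"
    using int by (rule Bochner_Integration.integrable_cong[THEN iffD1, rotated 2]) (simp_all add: eq)
  have "(\<integral>\<omega>. f (run u (\<lambda>k. P k \<omega>) m s) \<partial>M)
      = (\<integral>\<omega>. (\<Sum>us\<in>L. f (fold (move u) us s) * indicator (W us) \<omega>) \<partial>M)"
    by (intro Bochner_Integration.integral_cong) (simp_all add: eq)
  also have "\<dots> = (\<Sum>us\<in>L. f (fold (move u) us s) * prob (W us))"
    using We sets.sets_into_space
    by (subst Bochner_Integration.integral_sum)
      (auto intro!: integrable_mult_right sum.cong simp: less_top[symmetric] Int_absorb2)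
  also have "\<dots> = (\<Sum>us\<in>L. (\<Prod>p\<leftarrow>us. weight p) * f (fold (move u) us s))"
    using Wp by (intro sum.cong) auto
  also have "\<dots> = expec u m f s" unfolding L_def A_def by (rule expec_as_list_sum)
  finally show "(\<integral>\<omega>. f (run u (\<lambda>k. P k \<omega>) m s) \<partial>M) = expec u m f s" .
qed

text \<open>In each step only the site \<open>c d\<close> matters, so the mean of
  \<open>2 ^ d\<close> grows by a factor of at most \<open>1 + q\<close>, whatever the size of
  \<open>B\<close>. Markov's inequality then gives the tail.\<close>

lemma frontier_tail:
  "expec (frontier c) k (\<lambda>d. if d \<ge> n then 1 else 0) 0 \<le> exp (q * k) / 2 ^ n"
proof -
  have closed: "closed_under (frontier c) UNIV" by (simp add: closed_under_def)
  have pow: "expec (frontier c) k (\<lambda>d. 2 ^ d) d \<le> (1 + q) ^ k * 2 ^ d" for d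
  proof (induction k)
    case (Suc k)
    have pick: "pick_op q B (frontier c) (\<lambda>d. 2 ^ d) d \<le> (1 + q) * 2 ^ d" for d
    proof -
      have "(\<Sum>x\<in>B. 2 ^ frontier c x d - 2 ^ d) = (\<Sum>x\<in>B. if x = c d then 2 ^ d else 0 :: real)"
        by (intro sum.cong) (auto simp: frontier_def)
      then show ?thesis using q_nonneg by (simp add: pick_op_def algebra_simps)
    qed
    have "expec (frontier c) (Suc k) (\<lambda>d. 2 ^ d) d \<le> expec (frontier c) k (\<lambda>d. (1 + q) * 2 ^ d) d"
      unfolding expec_Suc using pick by (intro expec_mono[OF closed]) auto
    also have "\<dots> \<le> (1 + q) * ((1 + q) ^ k * 2 ^ d)"
      unfolding expec_cmult using Suc q_nonneg by (intro mult_left_mono) auto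
    finally show ?case by simp
  qed simp
  have "expec (frontier c) k (\<lambda>d. if d \<ge> n then 1 else 0) 0 \<le> expec (frontier c) k (\<lambda>d. 1 / 2 ^ n * 2 ^ d) 0"
    by (intro expec_mono[OF closed]) (auto intro: power_increasing)
  also have "\<dots> \<le> 1 / 2 ^ n * (1 + q) ^ k"
    unfolding expec_cmult using pow[of 0] by (intro mult_left_mono) auto
  also have "\<dots> \<le> 1 / 2 ^ n * exp q ^ k"
    using q_nonneg exp_ge_add_one_self[of q] by (intro mult_left_mono power_mono) auto
  also have "\<dots> = exp (q * k) / 2 ^ n" by (simp add: exp_of_nat_mult[symmetric] mult.commute)
  finally show ?thesis .
qed

end

section \<open>Joint independence of Poisson increments\<close>

lemma measurable_increment:
  assumes "a \<in> I" "b \<in> I"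
  shows "(\<lambda>p. p a - p b) \<in> measurable (PiM I (\<lambda>_. count_space UNIV)) (count_space (UNIV :: nat set))"
proof (rule measurable_compose_countable[where g = "\<lambda>p. p a" and f = "\<lambda>i p. i - p b"])
  show "(\<lambda>p. p a) \<in> measurable (PiM I (\<lambda>_. count_space UNIV)) (count_space UNIV)"
    using assms by measurable
  show "(\<lambda>p. i - p b) \<in> measurable (PiM I (\<lambda>_. count_space UNIV)) (count_space UNIV)" for i
    using measurable_component_singleton[OF assms(2), of "\<lambda>_. count_space UNIV"]
    by (rule measurable_compose) simp
qed

text \<open>Paths are independent over sites, and at each site increments are independent over time.
  Conditions on the increments at one site form an event of its path, so the two combine to
  independence over the rectangle.\<close>

lemma indep_increments:
  fixes N :: "int \<Rightarrow> real \<Rightarrow> 'w \<Rightarrow> nat"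
  assumes M: "prob_space M" and N: "indep_poisson_processes M r N" and B: "finite B"
    and u: "0 \<le> u 0" "mono u"
  shows "prob_space.indep_vars M (\<lambda>_. count_space UNIV)
    (\<lambda>(x, k) \<omega>. N x (u (Suc k)) \<omega> - N x (u k) \<omega>) (B \<times> {..<m})"
proof -
  interpret prob_space M by fact
  define X where "X = (\<lambda>(x, k) \<omega>. N x (u (Suc k)) \<omega> - N x (u k) \<omega>)"
  have u0: "0 \<le> u k" for k using u monoD[of u 0 k] by simp
  have pp: "poisson_process M r (N x)" for x using N by (simp add: indep_poisson_processes_def)
  have indx: "indep_vars (\<lambda>_. count_space UNIV) (\<lambda>k \<omega>. N x (u (Suc k)) \<omega> - N x (u k) \<omega>) UNIV" for x
    using pp[of x] u unfolding poisson_process_def by blast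
  have indN: "indep_vars (\<lambda>_. PiM {0..} (\<lambda>_. count_space UNIV)) (\<lambda>x \<omega>. \<lambda>t\<in>{0..}. N x t \<omega>) UNIV"
    using N by (simp add: indep_poisson_processes_def)
  have rv: "X j \<in> measurable M (count_space UNIV)" for j
    using indx[of "fst j"] by (auto simp: indep_vars_def X_def split_beta)
  have product: "prob (\<Inter>j\<in>B \<times> {..<m}. X j -` T j \<inter> space M) = (\<Prod>j\<in>B \<times> {..<m}. prob (X j -` T j \<inter> space M))"
    if ne: "B \<times> {..<m} \<noteq> {}" for T
  proof -
    define A where "A x = {p \<in> space (PiM {0..} (\<lambda>_. count_space UNIV)). \<forall>k\<in>{..<m}. p (u (Suc k)) - p (u k) \<in> T (x, k)}" for x
    have A: "A x \<in> sets (PiM {0..} (\<lambda>_. count_space UNIV))" for x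
      unfolding A_def
    proof (rule sets.sets_Collect_finite_All')
      fix k assume "k \<in> {..<m}"
      have "(\<lambda>p. p (u (Suc k)) - p (u k)) \<in> measurable (PiM {0..} (\<lambda>_. count_space UNIV)) (count_space (UNIV :: nat set))"
        using u0 by (intro measurable_increment) auto
      from measurable_sets[OF this, of "T (x, k)"]
      show "{p \<in> space (PiM {0..} (\<lambda>_. count_space UNIV)). p (u (Suc k)) - p (u k) \<in> T (x, k)} \<in> sets (PiM {0..} (\<lambda>_. count_space UNIV))"
        by (simp add: vimage_def Int_def conj_commute)
    qed (use ne in auto)
    have pre: "(\<lambda>\<omega>. \<lambda>t\<in>{0..}. N x t \<omega>) -` A x \<inter> space M = (\<Inter>k\<in>{..<m}. X (x, k) -` T (x, k) \<inter> space M)" for x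
      using ne u0 by (auto simp: A_def X_def space_PiM)
    have "(\<Inter>j\<in>B \<times> {..<m}. X j -` T j \<inter> space M) = (\<Inter>x\<in>B. (\<lambda>\<omega>. \<lambda>t\<in>{0..}. N x t \<omega>) -` A x \<inter> space M)"
      unfolding pre using ne by auto
    also have "prob \<dots> = (\<Prod>x\<in>B. prob ((\<lambda>\<omega>. \<lambda>t\<in>{0..}. N x t \<omega>) -` A x \<inter> space M))"
      using ne B A by (intro indep_varsD[OF indN]) auto
    also have "\<dots> = (\<Prod>x\<in>B. \<Prod>k<m. prob (X (x, k) -` T (x, k) \<inter> space M))"
    proof (intro prod.cong refl)
      fix x
      show "prob ((\<lambda>\<omega>. \<lambda>t\<in>{0..}. N x t \<omega>) -` A x \<inter> space M) = (\<Prod>k<m. prob (X (x, k) -` T (x, k) \<inter> space M))"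
        unfolding pre X_def prod.case using ne by (intro indep_varsD[OF indx]) auto
    qed
    also have "\<dots> = (\<Prod>j\<in>B \<times> {..<m}. prob (X j -` T j \<inter> space M))"
      by (simp add: prod.cartesian_product split_beta)
    finally show ?thesis .
  qed
  have "indep_vars (\<lambda>_. count_space UNIV) X (B \<times> {..<m})"
    unfolding indep_vars_def2
  proof (intro conjI ballI indep_setsI)
    show "random_variable (count_space UNIV) (X j)" for j by (rule rv)
    show "{X j -` A \<inter> space M |A. A \<in> sets (count_space UNIV)} \<subseteq> events" for j
      using rv[of j] by (auto intro: measurable_sets)
    fix A J assume J: "J \<noteq> {}" "J \<subseteq> B \<times> {..<m}" "finite J"
      "\<forall>j\<in>J. A j \<in> {X j -` A \<inter> space M |A. A \<in> sets (count_space UNIV)}"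
    then have "\<forall>j. \<exists>S. j \<in> J \<longrightarrow> A j = X j -` S \<inter> space M" by blast
    then obtain S where S: "\<And>j. j \<in> J \<Longrightarrow> A j = X j -` S j \<inter> space M" by metis
    \<comment> \<open>Imposing no condition outside \<open>J\<close> reduces an arbitrary index set
      to the full rectangle.\<close>
    define T where "T j = (if j \<in> J then S j else UNIV)" for j
    have fin: "finite (B \<times> {..<m})" using B by simp
    have "(\<Inter>j\<in>J. A j) = (\<Inter>j\<in>B \<times> {..<m}. X j -` T j \<inter> space M)"
    proof (intro set_eqI iffI)
      fix \<omega> assume \<omega>: "\<omega> \<in> (\<Inter>j\<in>J. A j)"
      then have "\<omega> \<in> space M" using J(1) S by blast
      moreover have "X j \<omega> \<in> T j" for j
      proof (cases "j \<in> J")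
        case True
        then have "\<omega> \<in> A j" using \<omega> by blast
        then show ?thesis using True by (simp add: S[OF True] T_def)
      qed (simp add: T_def)
      ultimately show "\<omega> \<in> (\<Inter>j\<in>B \<times> {..<m}. X j -` T j \<inter> space M)" by auto
    next
      fix \<omega> assume \<omega>: "\<omega> \<in> (\<Inter>j\<in>B \<times> {..<m}. X j -` T j \<inter> space M)"
      show "\<omega> \<in> (\<Inter>j\<in>J. A j)"
      proof (rule INT_I)
        fix j assume j: "j \<in> J"
        then have "\<omega> \<in> X j -` T j \<inter> space M" using \<omega> J(2) by blast
        then show "\<omega> \<in> A j" using S[OF j] j by (simp add: T_def)
      qed
    qed
    also have "prob \<dots> = (\<Prod>j\<in>B \<times> {..<m}. prob (X j -` T j \<inter> space M))"
      using J by (intro product) auto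
    also have "\<dots> = (\<Prod>j\<in>J. prob (X j -` T j \<inter> space M))"
      using J fin by (intro prod.mono_neutral_right) (auto simp: T_def prob_space)
    also have "\<dots> = (\<Prod>j\<in>J. prob (A j))" using S by (intro prod.cong) (auto simp: T_def)
    finally show "prob (\<Inter>j\<in>J. A j) = (\<Prod>j\<in>J. prob (A j))" .
  qed
  then show ?thesis by (simp add: X_def)
qed

section \<open>Agreement of a path with the box chain\<close>

lemma no_event_times:
  fixes n :: "real \<Rightarrow> nat"
  assumes mono: "mono_on {0..} n" and "0 \<le> a" "n b = n a"
  shows "{a<..b} \<inter> event_times n = {}"
proof -
  have "s \<notin> event_times n" if s: "a < s" "s \<le> b" for s
  proof
    assume "s \<in> event_times n"
    then have "n a < n s" using s assms(2) by (auto simp: event_times_def)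
    moreover have "n s \<le> n b" using mono s assms(2) by (auto intro: mono_onD)
    ultimately show False using assms(3) by simp
  qed
  then show ?thesis by auto
qed

lemma single_event_time:
  fixes n :: "real \<Rightarrow> nat"
  assumes mono: "mono_on {0..} n" and rc: "\<And>t. 0 \<le> t \<Longrightarrow> continuous (at_right t) n"
    and ab: "0 \<le> a" "a < b" and jump: "n b = Suc (n a)"
  shows "\<exists>s. a < s \<and> s \<le> b \<and> s \<in> event_times n \<and>
    (\<forall>c. a \<le> c \<longrightarrow> c < s \<longrightarrow> {a<..c} \<inter> event_times n = {}) \<and> {s<..b} \<inter> event_times n = {}"
proof -
  have le: "n u \<le> n v" if "0 \<le> u" "u \<le> v" for u v
    using mono_onD[OF mono, of u v] that by simp
  \<comment> \<open>The event time is the first time at which the final value is taken;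
    right-continuity of an integer-valued path shows that the infimum is attained.\<close>
  define S where "S = {u. a \<le> u \<and> u \<le> b \<and> n u = n b}"
  define s where "s = Inf S"
  have b: "b \<in> S" using ab by (simp add: S_def)
  have bdd: "bdd_below S" by (rule bdd_belowI[of _ a]) (simp add: S_def)
  have as: "a \<le> s" unfolding s_def using b by (intro cInf_greatest) (auto simp: S_def)
  have sb: "s \<le> b" unfolding s_def using b bdd by (rule cInf_lower)
  have after: "n u = n b" if "s < u" "u \<le> b" for u
  proof -
    obtain v where v: "v \<in> S" "v < u" using \<open>s < u\<close> b bdd unfolding s_def by (metis cInf_lessD empty_iff)
    then have "n v \<le> n u" "n u \<le> n b" using le[of v u] le[of u b] that as ab by (auto simp: S_def)
    then show ?thesis using v by (simp add: S_def)
  qed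
  have ns: "n s = n b"
  proof (cases "s = b")
    case False
    have "(n \<longlongrightarrow> n s) (at_right s)" using rc[of s] as ab by (simp add: continuous_within)
    then have "\<forall>\<^sub>F u in at_right s. n u = n s" by (simp add: tendsto_discrete)
    moreover have "\<forall>\<^sub>F u in at_right s. s < u \<and> u < b"
      using False sb by (auto simp: eventually_at_right[of s b] intro!: exI[of _ b])
    ultimately have "\<forall>\<^sub>F u in at_right s. n u = n s \<and> s < u \<and> u < b" by (rule eventually_conj)
    then obtain u where "n u = n s" "s < u" "u < b"
      using eventually_happens[of _ "at_right s"] by (auto simp: trivial_limit_at_right_real)
    then show ?thesis using after[of u] by simp
  qed simp
  have as': "a < s" using as ns jump by (cases "a = s") auto
  have before: "n u = n a" if "a \<le> u" "u < s" for u
  proof -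
    have "u \<notin> S" using that bdd unfolding s_def by (meson cInf_lower not_less)
    then have "n u \<noteq> n b" using that sb by (simp add: S_def)
    moreover have "n a \<le> n u" "n u \<le> n b" using le[of a u] le[of u b] that sb ab by auto
    ultimately show ?thesis using jump by linarith
  qed
  have ev: "s \<in> event_times n"
  proof -
    have "n v < n s" if "0 \<le> v" "v < s" for v
    proof (cases "a \<le> v")
      case True
      then show ?thesis using before[of v] that ns jump by simp
    next
      case False
      then have "n v \<le> n a" using that ab le[of v a] by auto
      then show ?thesis using ns jump by simp
    qed
    then show ?thesis using as' ab by (auto simp: event_times_def)
  qed
  have "{a<..c} \<inter> event_times n = {}" if "a \<le> c" "c < s" for c
    using before[OF that] ab by (intro no_event_times[OF mono]) auto
  moreover have "{s<..b} \<inter> event_times n = {}"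
    using ns as ab by (intro no_event_times[OF mono]) auto
  ultimately show ?thesis using as' sb ev by blast
qed

text \<open>A single sample path: the almost sure properties become hypotheses, so the comparison
  with the chain is deterministic.\<close>

locale graphical_path =
  fixes n :: "int \<Rightarrow> real \<Rightarrow> nat" and X :: "real \<Rightarrow> int \<Rightarrow> int" and \<eta> :: "int \<Rightarrow> int"
  assumes mono: "mono_on {0..} (n x)"
    and rc: "0 \<le> t \<Longrightarrow> continuous (at_right t) (n x)"
    and init: "X 0 = \<eta>"
    and const: "0 \<le> s \<Longrightarrow> s \<le> t \<Longrightarrow> {s<..t} \<inter> event_times (n x) = {} \<Longrightarrow> X t x = X s x"
    and update: "t \<in> event_times (n x) \<Longrightarrow> \<forall>\<^sub>F s in at_left t. X t x = wall_update (X s) x"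
begin

lemma const_no_increment:
  assumes "0 \<le> a" "a \<le> c" "c \<le> b" "n x b - n x a = 0"
  shows "X c x = X a x"
proof -
  have "n x a \<le> n x c" "n x c \<le> n x b" using assms mono_onD[OF mono[of x], of a c] mono_onD[OF mono[of x], of c b] by auto
  then have "n x c = n x a" using assms by simp
  then show ?thesis using assms no_event_times[OF mono, of a x c] by (intro const) auto
qed

text \<open>The neighbours have no event in the step, so just before the event the three relevant
  heights are still those at time \<open>a\<close>; afterwards nothing happens at
  \<open>x\<close>.\<close>

lemma update_single_increment:
  assumes ab: "0 \<le> a" "a < b" and 1: "n x b - n x a = 1"
    and 0: "n (x - 1) b - n (x - 1) a = 0" "n (x + 1) b - n (x + 1) a = 0"
  shows "X b x = wall_update (X a) x"
proof -
  have jump: "n x b = Suc (n x a)" using 1 by linarith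
  obtain s where s: "a < s" "s \<le> b" "s \<in> event_times (n x)"
    "\<And>c. a \<le> c \<Longrightarrow> c < s \<Longrightarrow> {a<..c} \<inter> event_times (n x) = {}" "{s<..b} \<inter> event_times (n x) = {}"
    using single_event_time[OF mono rc ab jump] by blast
  have "\<forall>\<^sub>F c in at_left s. X s x = wall_update (X c) x" by (rule update[OF s(3)])
  moreover have "\<forall>\<^sub>F c in at_left s. a < c \<and> c < s"
    using s(1) by (auto simp: eventually_at_left[of a s])
  ultimately have "\<forall>\<^sub>F c in at_left s. X s x = wall_update (X c) x \<and> a < c \<and> c < s"
    by (rule eventually_conj)
  then obtain c where c: "X s x = wall_update (X c) x" "a < c" "c < s"
    using eventually_happens[of _ "at_left s"] by (auto simp: trivial_limit_at_left_real)
  have "X c x = X a x" using s(4)[of c] c ab by (intro const) auto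
  moreover have "X c (x - 1) = X a (x - 1)" "X c (x + 1) = X a (x + 1)"
    using const_no_increment[of a c b "x - 1"] const_no_increment[of a c b "x + 1"] 0 ab c s(2) by auto
  ultimately have "wall_update (X c) x = wall_update (X a) x"
    by (simp add: wall_update_def laplacian_def)
  moreover have "X b x = X s x" using s ab by (intro const) auto
  ultimately show ?thesis using c by simp
qed

text \<open>By \<open>good\<close>, \<open>None\<close> means no event in the box. An update
  strictly inside the interval of agreement reads only heights that already agree; one at an end
  point reads a height outside, so that end point is given up.\<close>

lemma agreement:
  fixes u :: "nat \<Rightarrow> real" and L :: int
  defines "B \<equiv> {- L..L}" and "p \<equiv> \<lambda>k. pick {- L..L} (\<lambda>x. n x (u (Suc k)) - n x (u k))"
  assumes u: "u 0 = 0" "strict_mono u"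
    and good: "\<And>k. k < m \<Longrightarrow> p k \<noteq> None \<or> (\<forall>x\<in>B. n x (u (Suc k)) - n x (u k) = 0)"
    and "k \<le> m"
    and y: "- L + int (run (frontier (\<lambda>d. - L + int d)) p k 0) \<le> y"
      "y \<le> L - int (run (frontier (\<lambda>d. L - int d)) p k 0)"
  shows "X (u k) y = run wall_flip p k \<eta> y"
  using \<open>k \<le> m\<close> y
proof (induction k arbitrary: y)
  case 0
  then show ?case using init u by simp
next
  case (Suc k)
  define lo where "lo = - L + int (run (frontier (\<lambda>d. - L + int d)) p k 0)"
  define hi where "hi = L - int (run (frontier (\<lambda>d. L - int d)) p k 0)"
  have IH: "X (u k) z = run wall_flip p k \<eta> z" if "lo \<le> z" "z \<le> hi" for z
    using Suc that by (simp add: lo_def hi_def)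
  have lo: "- L \<le> lo" and hi: "hi \<le> L" by (simp_all add: lo_def hi_def)
  have uk: "0 \<le> u k" "u k < u (Suc k)"
    using u by (auto simp: strict_mono_def) (metis le_less le_numeral_extra(3) not_gr_zero)
  show ?case
  proof (cases "p k")
    case None
    then have "\<forall>x\<in>B. n x (u (Suc k)) - n x (u k) = 0" using good[of k] Suc.prems by auto
    moreover have y: "lo \<le> y" "y \<le> hi" using Suc.prems None by (auto simp: lo_def hi_def move_def)
    moreover have "y \<in> B" using y lo hi by (simp add: B_def)
    ultimately have "X (u (Suc k)) y = X (u k) y" using uk by (intro const_no_increment[of _ _ "u (Suc k)"]) auto
    then show ?thesis using IH y None by (simp add: move_def)
  next
    case (Some x)
    then have x: "x \<in> B" "n x (u (Suc k)) - n x (u k) = 1"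
      "\<And>z. z \<in> B \<Longrightarrow> z \<noteq> x \<Longrightarrow> n z (u (Suc k)) - n z (u k) = 0"
      by (auto simp: p_def pick_Some B_def)
    define dl dh where "dl = run (frontier (\<lambda>d. - L + int d)) p k 0"
      and "dh = run (frontier (\<lambda>d. L - int d)) p k 0"
    have "- L + int (frontier (\<lambda>d. - L + int d) x dl) \<le> y" "y \<le> L - int (frontier (\<lambda>d. L - int d) x dh)"
      using Suc.prems(2,3) unfolding run_Suc Some move_def option.case dl_def dh_def by simp_all
    then have y: "lo \<le> y" "y \<le> hi" "x = lo \<Longrightarrow> lo < y" "x = hi \<Longrightarrow> y < hi"
      unfolding lo_def hi_def dl_def[symmetric] dh_def[symmetric]
      by (auto simp: frontier_def split: if_splits)
    have yB: "y \<in> B" using y lo hi by (simp add: B_def)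
    show ?thesis
    proof (cases "y = x")
      case False
      then have "X (u (Suc k)) y = X (u k) y"
        using uk x(3)[OF yB] by (intro const_no_increment[of _ _ "u (Suc k)"]) auto
      then show ?thesis using IH y Some False by (simp add: move_def wall_flip_other)
    next
      case True
      then have xx: "lo < x" "x < hi" using y by force+
      have "X (u (Suc k)) x = wall_update (X (u k)) x"
        using xx lo hi uk x(2) by (intro update_single_increment x(3)) (auto simp: B_def)
      also have "\<dots> = wall_update (run wall_flip p k \<eta>) x"
        using IH[of x] IH[of "x + 1"] IH[of "x - 1"] xx by (simp add: wall_update_def laplacian_def)
      finally show ?thesis using Some True by (simp add: move_def wall_flip_same)
    qed
  qed
qed

end

section \<open>Discretisation of the wall process\<close>

lemma configs_lipschitz:
  assumes "\<zeta> \<in> configs"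
  shows "\<zeta> 0 \<le> \<zeta> (int k) + int k"
proof (induction k)
  case (Suc k)
  then show ?case using configs_neighbours(1)[OF assms, of "int k"] by (auto simp: add.commute)
qed simp

text \<open>\<open>\<tau>\<close> is the mean number of events per site and step: the clocks have
  rate 1/2 and a step has length \<open>t / m\<close>.\<close>

locale discretised_wall = prob_space M
  for M :: "'w measure" +
  fixes N :: "int \<Rightarrow> real \<Rightarrow> 'w \<Rightarrow> nat" and \<xi> :: "real \<Rightarrow> 'w \<Rightarrow> int \<Rightarrow> int"
    and t :: real and m :: nat and L :: nat and \<tau> :: real
  assumes wall: "wall_process M N (\<lambda>x. x mod 2) \<xi>"
    and t: "0 < t" and m: "0 < m" and \<tau>_def: "\<tau> = t / (2 * m)" and small: "4 * \<tau> * (2 * L + 1) \<le> 1"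
begin

abbreviation sites :: "int set" where "sites \<equiv> {- int L..int L}"

text \<open>The probability that a given site has exactly one event in a step and the other
  \<open>2 * L\<close> sites of the box have none.\<close>

abbreviation rate :: real where "rate \<equiv> \<tau> * exp (- (\<tau> * (2 * L + 1)))"

definition grid :: "nat \<Rightarrow> real" where "grid k = k * t / m"

definition inc :: "int \<times> nat \<Rightarrow> 'w \<Rightarrow> nat" where
  "inc = (\<lambda>(x, k) \<omega>. N x (grid (Suc k)) \<omega> - N x (grid k) \<omega>)"

definition choice :: "nat \<Rightarrow> 'w \<Rightarrow> int option" where
  "choice k \<omega> = pick sites (\<lambda>x. inc (x, k) \<omega>)"

lemma \<tau>: "0 < \<tau>" using t m by (simp add: \<tau>_def)

lemma card_sites: "card sites = 2 * L + 1" by simp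

lemma rate_le: "rate \<le> \<tau>" using \<tau> by (simp add: mult_le_cancel_left1)

lemma poissons: "indep_poisson_processes M (1 / 2) N"
  using wall by (simp add: wall_process_def)

lemma box_chain: "box_chain rate sites"
proof
  have "2 * rate * card sites \<le> 2 * \<tau> * card sites" using rate_le by (intro mult_right_mono) auto
  also have "\<dots> \<le> 4 * \<tau> * (2 * L + 1)" using \<tau> by (auto intro!: mult_right_mono)
  also have "\<dots> \<le> 1" by (rule small)
  finally show "2 * rate * card sites \<le> 1" .
  have "4 * rate \<le> 4 * \<tau> * 1" using rate_le by simp
  also have "\<dots> \<le> 4 * \<tau> * (2 * L + 1)" using \<tau> by (intro mult_left_mono) auto
  also have "\<dots> \<le> 1" by (rule small)
  finally show "4 * rate \<le> 1" .
qed (use \<tau> in auto)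

sublocale box_chain rate sites by (rule box_chain)

lemma grid_mono: "strict_mono grid"
  using t m by (auto simp: strict_mono_def grid_def divide_strict_right_mono)

lemma grid_0 [simp]: "grid 0 = 0" by (simp add: grid_def)

lemma grid_m [simp]: "grid m = t" using m by (simp add: grid_def)

lemma grid_nonneg: "0 \<le> grid k" using t by (simp add: grid_def)

lemma inc_measurable [measurable]: "inc j \<in> measurable M (count_space UNIV)"
proof -
  have "poisson_process M (1 / 2) (N (fst j))"
    using poissons unfolding indep_poisson_processes_def by blast
  then have "\<forall>u. 0 \<le> u 0 \<and> mono u \<longrightarrow>
      indep_vars (\<lambda>_. count_space UNIV) (\<lambda>k \<omega>. N (fst j) (u (Suc k)) \<omega> - N (fst j) (u k) \<omega>) UNIV"
    unfolding poisson_process_def by (elim conjE)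
  then have "indep_vars (\<lambda>_. count_space UNIV) (\<lambda>k \<omega>. N (fst j) (grid (Suc k)) \<omega> - N (fst j) (grid k) \<omega>) UNIV"
    using strict_mono_mono[OF grid_mono] by simp
  then show ?thesis by (auto simp: indep_vars_def inc_def split_beta)
qed

lemma inc_prob: "prob (inc j -` {i} \<inter> space M) = \<tau> ^ i / fact i * exp (- \<tau>)"
proof -
  obtain x k where j: "j = (x, k)" by (cases j)
  have d: "1 / 2 * (grid (Suc k) - grid k) = \<tau>"
    using m by (simp add: grid_def \<tau>_def field_simps)
  have less: "0 \<le> grid k \<and> grid k < grid (Suc k)"
    using grid_mono grid_nonneg by (simp add: strict_mono_def)
  have "poisson_process M (1 / 2) (N x)"
    using poissons unfolding indep_poisson_processes_def by blast
  then have "\<forall>s t. 0 \<le> s \<and> s < t \<longrightarrow>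
      distr M (count_space UNIV) (\<lambda>\<omega>. N x t \<omega> - N x s \<omega>) = measure_pmf (poisson_pmf (1 / 2 * (t - s)))"
    unfolding poisson_process_def by (elim conjE)
  then have "distr M (count_space UNIV) (inc j) = measure_pmf (poisson_pmf \<tau>)"
    using less unfolding d[symmetric] inc_def j prod.case by blast
  moreover have "prob (inc j -` {i} \<inter> space M) = measure (distr M (count_space UNIV) (inc j)) {i}"
    by (subst measure_distr) auto
  ultimately show ?thesis using \<tau> by (simp add: measure_pmf_single)
qed

lemma inc_indep: "indep_vars (\<lambda>_. count_space UNIV) inc (sites \<times> {..<m})"
  using indep_increments[OF prob_space_axioms poissons, of sites grid m] strict_mono_mono[OF grid_mono]
  by (simp add: inc_def)

lemma inc_joint_prob:
  assumes "k < m"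
  shows "prob {\<omega> \<in> space M. \<forall>y\<in>sites. inc (y, k) \<omega> = c y} = (\<Prod>y\<in>sites. \<tau> ^ c y / fact (c y) * exp (- \<tau>))"
proof -
  have "{\<omega> \<in> space M. \<forall>y\<in>sites. inc (y, k) \<omega> = c y} = (\<Inter>j\<in>sites \<times> {k}. inc j -` {c (fst j)} \<inter> space M)"
    by (auto simp del: atLeastAtMost_iff)
  also have "prob \<dots> = (\<Prod>j\<in>sites \<times> {k}. prob (inc j -` {c (fst j)} \<inter> space M))"
    by (rule indep_varsD[OF inc_indep]) (use assms in auto)
  also have "\<dots> = (\<Prod>y\<in>sites. prob (inc (y, k) -` {c y} \<inter> space M))"
    by (rule prod.reindex_bij_witness[of _ "\<lambda>y. (y, k)" fst]) auto
  finally show ?thesis by (simp add: inc_prob)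
qed

lemma no_inc_prob:
  assumes "k < m"
  shows "prob {\<omega> \<in> space M. \<forall>y\<in>sites. inc (y, k) \<omega> = 0} = exp (- (\<tau> * (2 * L + 1)))"
  using inc_joint_prob[OF assms, of "\<lambda>_. 0"] by (simp add: exp_of_nat_mult[symmetric] algebra_simps)

lemma choice_prob:
  assumes "k < m" "x \<in> sites"
  shows "prob {\<omega> \<in> space M. choice k \<omega> = Some x} = rate"
proof -
  define c where "c y = (if y = x then 1 else 0 :: nat)" for y
  have "{\<omega> \<in> space M. choice k \<omega> = Some x} = {\<omega> \<in> space M. \<forall>y\<in>sites. inc (y, k) \<omega> = c y}"
    using assms(2) by (auto simp: choice_def pick_Some c_def simp del: atLeastAtMost_iff)
  moreover have "(\<Prod>y\<in>sites. \<tau> ^ c y / fact (c y) * exp (- \<tau>)) = (\<Prod>y\<in>sites. (if y = x then \<tau> else 1) * exp (- \<tau>))"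
    by (intro prod.cong) (auto simp: c_def)
  moreover have "\<dots> = \<tau> * exp (- \<tau>) ^ (2 * L + 1)"
    using assms(2) by (simp only: prod.distrib prod_constant card_sites) (simp del: power_Suc)
  moreover have "exp (- \<tau>) ^ (2 * L + 1) = exp (- (\<tau> * (2 * L + 1)))"
    unfolding exp_of_nat_mult[symmetric] by (simp add: algebra_simps)
  ultimately show ?thesis using inc_joint_prob[OF assms(1), of c] by simp
qed

text \<open>Different steps use disjoint blocks of increments. Measurability of \<open>pick\<close>
  is checked on single values, of which there are countably many.\<close>

lemma choice_indep: "indep_vars (\<lambda>_. count_space UNIV) choice {..<m}"
proof -
  have "indep_vars (\<lambda>k. PiM (sites \<times> {k}) (\<lambda>_. count_space UNIV)) (\<lambda>k \<omega>. restrict (\<lambda>j. inc j \<omega>) (sites \<times> {k})) {..<m}"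
    by (rule indep_vars_restrict[OF inc_indep]) (auto simp: disjoint_family_on_def)
  then have "indep_vars (\<lambda>_. count_space UNIV)
      (\<lambda>k \<omega>. pick sites (\<lambda>x. restrict (\<lambda>j. inc j \<omega>) (sites \<times> {k}) (x, k))) {..<m}"
  proof (rule indep_vars_compose2)
    fix k :: nat
    define S where "S = PiM (sites \<times> {k}) (\<lambda>_. count_space (UNIV :: nat set))"
    have at: "{p \<in> space S. p (y, k) = i} \<in> sets S" if "y \<in> sites" for y i
    proof -
      have "(\<lambda>p. p (y, k)) \<in> measurable S (count_space UNIV)"
        unfolding S_def using that by (intro measurable_component_singleton) auto
      from measurable_sets[OF this, of "{i}"] show ?thesis by (simp add: vimage_def Int_def conj_commute)
    qed
    have Some: "{p \<in> space S. pick sites (\<lambda>x. p (x, k)) = Some x} \<in> sets S" for x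
    proof (cases "x \<in> sites")
      case True
      have "{p \<in> space S. pick sites (\<lambda>x. p (x, k)) = Some x}
          = {p \<in> space S. p (x, k) = 1} \<inter> {p \<in> space S. \<forall>y\<in>sites - {x}. p (y, k) = 0}"
        using True by (auto simp: pick_Some simp del: atLeastAtMost_iff)
      then show ?thesis using True at by (auto intro!: sets.Int sets.sets_Collect_finite_All)
    next
      case False
      then have "pick sites (\<lambda>x. p (x, k)) \<noteq> Some x" for p :: "int \<times> nat \<Rightarrow> nat"
        by (simp add: pick_Some del: atLeastAtMost_iff)
      then show ?thesis by simp
    qed
    have "{p \<in> space S. pick sites (\<lambda>x. p (x, k)) = None}
        = space S - (\<Union>x\<in>sites. {p \<in> space S. pick sites (\<lambda>x. p (x, k)) = Some x})"
      using pick_range[of sites] by (auto simp del: atLeastAtMost_iff)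
    then have None: "{p \<in> space S. pick sites (\<lambda>x. p (x, k)) = None} \<in> sets S"
      using Some by (auto intro!: sets.Diff sets.finite_UN)
    show "(\<lambda>p. pick sites (\<lambda>x. p (x, k))) \<in> measurable S (count_space UNIV)"
      unfolding measurable_count_space_eq2_countable
    proof (intro conjI ballI)
      fix a :: "int option"
      have "{p \<in> space S. pick sites (\<lambda>x. p (x, k)) = a} \<in> sets S"
        using Some None by (cases a) auto
      then show "(\<lambda>p. pick sites (\<lambda>x. p (x, k))) -` {a} \<inter> space S \<in> sets S"
        by (simp add: vimage_def Int_def conj_commute)
    qed auto
  qed
  moreover have "pick sites (\<lambda>x. restrict (\<lambda>j. inc j \<omega>) (sites \<times> {k}) (x, k)) = choice k \<omega>" for k \<omega>
  proof -
    have cong: "pick sites v = pick sites w" if "\<And>x. x \<in> sites \<Longrightarrow> v x = w x" for v w :: "int \<Rightarrow> nat"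
    proof -
      have "pick sites v = Some x \<longleftrightarrow> pick sites w = Some x" for x
        unfolding pick_Some using that by (metis DiffD1)
      then show ?thesis by (metis option.exhaust)
    qed
    show ?thesis unfolding choice_def by (rule cong) (simp del: atLeastAtMost_iff)
  qed
  ultimately show ?thesis by simp
qed

lemma choice_range: "choice k \<omega> \<in> insert None (Some ` sites)"
  unfolding choice_def by (rule pick_range)

lemmas chain_expectation = run_expectation[OF prob_space_axioms choice_indep choice_range choice_prob]

section \<open>Exceptional events\<close>

definition step_bad :: "nat \<Rightarrow> 'w set" where
  "step_bad k = {\<omega> \<in> space M. choice k \<omega> = None \<and> \<not> (\<forall>y\<in>sites. inc (y, k) \<omega> = 0)}"

text \<open>The number of events in the box during a step has mean \<open>a\<close>, and two or more
  occur with probability 1 - exp (- a) (1 + a), at most the square of a because exp (- a) \<ge> 1 -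
  a.\<close>

lemma step_bad_prob:
  assumes "k < m"
  shows "step_bad k \<in> events" "prob (step_bad k) \<le> (\<tau> * (2 * L + 1))\<^sup>2"
proof -
  define a where "a = \<tau> * (2 * L + 1)"
  define Z where "Z = {\<omega> \<in> space M. \<forall>y\<in>sites. inc (y, k) \<omega> = 0}"
  define C where "C x = {\<omega> \<in> space M. choice k \<omega> = Some x}" for x
  have "choice k \<in> measurable M (count_space UNIV)"
    using choice_indep assms by (simp add: indep_vars_def)
  from measurable_sets[OF this, of "{Some x}" for x] have C: "C x \<in> events" for x
    by (simp add: C_def vimage_def Int_def conj_commute)
  have "{\<omega> \<in> space M. inc j \<omega> = 0} \<in> events" for j
    using measurable_sets[OF inc_measurable, of "{0}" j] by (simp add: vimage_def Int_def conj_commute)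
  then have Z: "Z \<in> events" unfolding Z_def by (intro sets.sets_Collect_finite_All) auto
  have CZ: "(\<Union>x\<in>sites. C x) \<inter> Z = {}"
    by (auto simp: C_def Z_def choice_def pick_Some simp del: atLeastAtMost_iff)
  have eq: "step_bad k = space M - (Z \<union> (\<Union>x\<in>sites. C x))"
    using choice_range[of k] by (auto simp: step_bad_def Z_def C_def simp del: atLeastAtMost_iff)
  have U: "(\<Union>x\<in>sites. C x) \<in> events" using C by (intro sets.finite_UN) auto
  then show "step_bad k \<in> events" unfolding eq using Z by auto
  have "prob (\<Union>x\<in>sites. C x) = (\<Sum>x\<in>sites. prob (C x))"
    using C by (intro finite_measure_finite_Union) (auto simp: disjoint_family_on_def C_def)
  also have "\<dots> = card sites * rate"
    unfolding C_def using choice_prob[OF assms] by simp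
  also have "\<dots> = a * exp (- a)" unfolding card_sites by (simp add: a_def algebra_simps)
  finally have PU: "prob (\<Union>x\<in>sites. C x) = a * exp (- a)" .
  have PZ: "prob Z = exp (- a)" unfolding Z_def a_def by (rule no_inc_prob[OF assms])
  have "prob (step_bad k) = 1 - prob (Z \<union> (\<Union>x\<in>sites. C x))"
    unfolding eq using Z U by (intro prob_compl) auto
  also have "\<dots> = 1 - exp (- a) * (1 + a)"
    using CZ by (subst finite_measure_Union[OF Z U]) (auto simp: PU PZ algebra_simps)
  also have "\<dots> \<le> 1 - (1 - a) * (1 + a)"
    using exp_ge_add_one_self[of "- a"] \<tau> by (intro diff_left_mono mult_right_mono) (auto simp: a_def)
  also have "\<dots> = a\<^sup>2" by (simp add: power2_eq_square algebra_simps)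
  finally show "prob (step_bad k) \<le> (\<tau> * (2 * L + 1))\<^sup>2" by (simp add: a_def)
qed

definition losses :: "(nat \<Rightarrow> int) \<Rightarrow> 'w \<Rightarrow> nat" where
  "losses c \<omega> = run (frontier c) (\<lambda>k. choice k \<omega>) m 0"

lemma losses_prob:
  shows "{\<omega> \<in> space M. n \<le> losses c \<omega>} \<in> events" (is ?A)
    "prob {\<omega> \<in> space M. n \<le> losses c \<omega>} \<le> exp (t / 2) / 2 ^ n" (is ?B)
proof -
  define f where "f d = (if d \<ge> n then 1 else 0 :: real)" for d :: nat
  have int: "integrable M (\<lambda>\<omega>. f (losses c \<omega>))" unfolding losses_def
    by (rule chain_expectation(1))
  have "(\<lambda>\<omega>. f (losses c \<omega>)) -` {1} \<inter> space M \<in> events"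
    using int by (intro measurable_sets[of _ _ borel]) auto
  moreover have "(\<lambda>\<omega>. f (losses c \<omega>)) -` {1} \<inter> space M = {\<omega> \<in> space M. n \<le> losses c \<omega>}"
    by (auto simp: f_def split: if_splits)
  ultimately show A: ?A by simp
  have "prob {\<omega> \<in> space M. n \<le> losses c \<omega>} = (\<integral>\<omega>. indicator {\<omega> \<in> space M. n \<le> losses c \<omega>} \<omega> \<partial>M)"
    using A by (simp add: Int_absorb2)
  also have "\<dots> = (\<integral>\<omega>. f (losses c \<omega>) \<partial>M)"
    by (intro Bochner_Integration.integral_cong) (auto simp: f_def)
  also have "\<dots> = expec (frontier c) m f 0"
    unfolding losses_def by (rule chain_expectation(2))
  also have "\<dots> \<le> exp (rate * m) / 2 ^ n" unfolding f_def by (rule frontier_tail)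
  also have "rate * m \<le> \<tau> * m" using rate_le by (intro mult_right_mono) auto
  also have "\<tau> * m = t / 2" using m by (simp add: \<tau>_def)
  finally show ?B by (simp add: divide_right_mono)
qed

text \<open>The interval of agreement starts with \<open>L\<close> sites on each side of the origin,
  so the origin is lost only after \<open>L + 1\<close> losses on one side.\<close>

definition bad :: "'w set" where
  "bad = (\<Union>k<m. step_bad k) \<union> {\<omega> \<in> space M. L + 1 \<le> losses (\<lambda>d. - int L + int d) \<omega>}
    \<union> {\<omega> \<in> space M. L + 1 \<le> losses (\<lambda>d. int L - int d) \<omega>}"

definition err :: real where
  "err = m * (\<tau> * (2 * L + 1))\<^sup>2 + 2 * exp (t / 2) / 2 ^ (L + 1)"

lemma bad_event: "bad \<in> events"
  unfolding bad_def using step_bad_prob(1) losses_prob(1) by (intro sets.Un sets.finite_UN) auto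

lemma bad_prob: "prob bad \<le> err"
proof -
  have 1: "prob (\<Union>k<m. step_bad k) \<le> m * (\<tau> * (2 * L + 1))\<^sup>2"
  proof -
    have "prob (\<Union>k<m. step_bad k) \<le> (\<Sum>k<m. prob (step_bad k))"
      using step_bad_prob(1) by (intro finite_measure_subadditive_finite) auto
    also have "\<dots> \<le> (\<Sum>k<m. (\<tau> * (2 * L + 1))\<^sup>2)" using step_bad_prob(2) by (intro sum_mono) auto
    finally show ?thesis by simp
  qed
  have ev: "(\<Union>k<m. step_bad k) \<in> events" using step_bad_prob(1) by (intro sets.finite_UN) auto
  have "prob bad \<le> prob (\<Union>k<m. step_bad k) + prob {\<omega> \<in> space M. L + 1 \<le> losses (\<lambda>d. - int L + int d) \<omega>}
      + prob {\<omega> \<in> space M. L + 1 \<le> losses (\<lambda>d. int L - int d) \<omega>}"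
    unfolding bad_def
    using measure_Un_le[OF ev losses_prob(1)] measure_Un_le[OF sets.Un[OF ev losses_prob(1)] losses_prob(1)]
    by (meson add_right_mono order_trans)
  moreover have "2 * exp (t / 2) / 2 ^ (L + 1) = exp (t / 2) / 2 ^ (L + 1) + exp (t / 2) / 2 ^ (L + 1)"
    by simp
  ultimately show ?thesis
    using 1 losses_prob(2)[of "L + 1" "\<lambda>d. - int L + int d"] losses_prob(2)[of "L + 1" "\<lambda>d. int L - int d"]
    unfolding err_def by linarith
qed

section \<open>Heights of the process and of the chain compared\<close>

definition box_height :: "'w \<Rightarrow> int" where
  "box_height \<omega> = run wall_flip (\<lambda>k. choice k \<omega>) m (\<lambda>x. x mod 2) 0"

lemma path_agreement: "AE \<omega> in M. \<omega> \<notin> bad \<longrightarrow> \<xi> t \<omega> 0 = box_height \<omega>"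
proof -
  have "AE \<omega> in M. N x 0 \<omega> = 0 \<and> mono_on {0..} (\<lambda>t. N x t \<omega>) \<and> (\<forall>t\<ge>0. continuous (at_right t) (\<lambda>s. N x s \<omega>))" for x
    using poissons unfolding indep_poisson_processes_def poisson_process_def by blast
  then have "AE \<omega> in M. \<forall>x. N x 0 \<omega> = 0 \<and> mono_on {0..} (\<lambda>t. N x t \<omega>) \<and> (\<forall>t\<ge>0. continuous (at_right t) (\<lambda>s. N x s \<omega>))"
    by (simp add: AE_all_countable)
  moreover have "AE \<omega> in M. \<xi> 0 \<omega> = (\<lambda>x. x mod 2) \<and>
        (\<forall>x s t. 0 \<le> s \<and> s \<le> t \<and> {s<..t} \<inter> event_times (\<lambda>u. N x u \<omega>) = {} \<longrightarrow> \<xi> t \<omega> x = \<xi> s \<omega> x) \<and>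
        (\<forall>x. \<forall>t\<in>event_times (\<lambda>u. N x u \<omega>). \<forall>\<^sub>F s in at_left t. \<xi> t \<omega> x = wall_update (\<xi> s \<omega>) x)"
    using wall by (simp add: wall_process_def)
  ultimately show ?thesis using AE_space
  proof eventually_elim
    case (elim \<omega>)
    interpret graphical_path "\<lambda>x t. N x t \<omega>" "\<lambda>t. \<xi> t \<omega>" "\<lambda>x. x mod 2"
      by standard (use elim in auto)
    show ?case
    proof
      assume good: "\<omega> \<notin> bad"
      have "\<xi> (grid m) \<omega> 0 = run wall_flip (\<lambda>k. choice k \<omega>) m (\<lambda>x. x mod 2) 0"
        unfolding choice_def inc_def prod.case
      proof (rule agreement[OF grid_0 grid_mono _ order.refl])
        fix k assume "k < m"
        then have "\<omega> \<notin> step_bad k" using good by (auto simp: bad_def)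
        then show "pick sites (\<lambda>x. N x (grid (Suc k)) \<omega> - N x (grid k) \<omega>) \<noteq> None \<or>
            (\<forall>x\<in>sites. N x (grid (Suc k)) \<omega> - N x (grid k) \<omega> = 0)"
          using elim by (auto simp: step_bad_def choice_def inc_def)
      next
        have "losses (\<lambda>d. - int L + int d) \<omega> \<le> L" "losses (\<lambda>d. int L - int d) \<omega> \<le> L"
          using good elim by (auto simp: bad_def not_le)
        then show "- int L + int (run (frontier (\<lambda>d. - int L + int d))
              (\<lambda>k. pick sites (\<lambda>x. N x (grid (Suc k)) \<omega> - N x (grid k) \<omega>)) m 0) \<le> 0"
          "0 \<le> int L - int (run (frontier (\<lambda>d. int L - int d))
              (\<lambda>k. pick sites (\<lambda>x. N x (grid (Suc k)) \<omega> - N x (grid k) \<omega>)) m 0)"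
          by (simp_all add: losses_def choice_def inc_def)
      qed
      then show "\<xi> t \<omega> 0 = box_height \<omega>" by (simp add: box_height_def)
    qed
  qed
qed

lemma box_height_bounds: "0 \<le> box_height \<omega>" "box_height \<omega> \<le> int L + 2"
proof -
  define S where "S = frozen (\<lambda>x. x mod 2) \<inter> {\<xi>. \<forall>x. 0 \<le> \<xi> x}"
  have S: "run wall_flip (\<lambda>k. choice k \<omega>) k (\<lambda>x. x mod 2) \<in> S" for k
  proof (induction k)
    case 0
    show ?case using flat_frozen by (simp add: S_def)
  next
    case (Suc k)
    then show ?case
      using choice_range[of k \<omega>] closed_wall_flip[of "\<lambda>x. x mod 2"]
      by (auto simp: move_def closed_under_def S_def simp del: atLeastAtMost_iff)
  qed
  then show "0 \<le> box_height \<omega>" by (simp add: S_def box_height_def)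
  have "run wall_flip (\<lambda>k. choice k \<omega>) m (\<lambda>x. x mod 2) \<in> configs"
    "run wall_flip (\<lambda>k. choice k \<omega>) m (\<lambda>x. x mod 2) (int (L + 1)) = int (L + 1) mod 2"
    using S[of m] by (auto simp: S_def frozen_def)
  \<comment> \<open>Site \<open>L + 1\<close> lies outside the box and keeps its initial height, at
    most 1; unit slopes do the rest.\<close>
  from configs_lipschitz[OF this(1), of "L + 1"] this(2) show "box_height \<omega> \<le> int L + 2"
    using pos_mod_bound[of 2 "int (L + 1)"] unfolding box_height_def by simp
qed

lemma box_height_expectation:
  "integrable M (\<lambda>\<omega>. real_of_int (box_height \<omega>))"
  "(\<integral>\<omega>. real_of_int (box_height \<omega>) \<partial>M) = expec wall_flip m (\<lambda>\<xi>. real_of_int (\<xi> 0)) (\<lambda>x. x mod 2)"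
  using chain_expectation[of "\<lambda>s. real_of_int (s 0)" wall_flip "\<lambda>x. x mod 2"]
  by (simp_all add: box_height_def)

lemma height_measurable [measurable]: "(\<lambda>\<omega>. real_of_int (\<xi> t \<omega> 0)) \<in> borel_measurable M"
proof -
  have "(\<lambda>\<omega>. \<xi> t \<omega> 0) \<in> measurable M (count_space UNIV)"
    using wall t by (simp add: wall_process_def)
  then show ?thesis by measurable
qed

lemma height_nonneg: "\<omega> \<in> space M \<Longrightarrow> 0 \<le> \<xi> t \<omega> 0"
  using wall t by (simp add: wall_process_def wall_configs_def)

text \<open>Truncation replaces integrability, which is not yet available, and bounds the cost of
  \<open>bad\<close> by \<open>A\<close> times its probability.\<close>

lemma truncated_height_le:
  assumes "0 \<le> A"
  shows "(\<integral>\<omega>. min (real_of_int (\<xi> t \<omega> 0)) A \<partial>M)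
    \<le> expec wall_flip m (\<lambda>\<xi>. real_of_int (\<xi> 0)) (\<lambda>x. x mod 2) + A * err"
proof -
  have "(\<integral>\<omega>. min (real_of_int (\<xi> t \<omega> 0)) A \<partial>M) \<le> (\<integral>\<omega>. real_of_int (box_height \<omega>) + A * indicator bad \<omega> \<partial>M)"
  proof (rule integral_mono_AE)
    show "integrable M (\<lambda>\<omega>. min (real_of_int (\<xi> t \<omega> 0)) A)"
      by (rule integrable_const_bound[of _ A]) (use height_nonneg assms in \<open>auto intro!: AE_I2\<close>)
    show "integrable M (\<lambda>\<omega>. real_of_int (box_height \<omega>) + A * indicator bad \<omega>)"
      using bad_event box_height_expectation(1)
      by (intro Bochner_Integration.integrable_add integrable_mult_right) (auto simp: less_top[symmetric])
    show "AE \<omega> in M. min (real_of_int (\<xi> t \<omega> 0)) A \<le> real_of_int (box_height \<omega>) + A * indicator bad \<omega>"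
      using path_agreement
    proof eventually_elim
      case (elim \<omega>)
      then show ?case using box_height_bounds(1)[of \<omega>] assms by (cases "\<omega> \<in> bad") auto
    qed
  qed
  also have "\<dots> = expec wall_flip m (\<lambda>\<xi>. real_of_int (\<xi> 0)) (\<lambda>x. x mod 2) + A * prob bad"
    using bad_event box_height_expectation sets.sets_into_space[OF bad_event]
    by (subst Bochner_Integration.integral_add) (auto simp: less_top[symmetric] Int_absorb2)
  also have "\<dots> \<le> expec wall_flip m (\<lambda>\<xi>. real_of_int (\<xi> 0)) (\<lambda>x. x mod 2) + A * err"
    using bad_prob assms by (intro add_left_mono mult_left_mono)
  finally show ?thesis .
qed

text \<open>Here the chain must be controlled on \<open>bad\<close>, by its deterministic bound
  \<open>L + 2\<close>, while the true height is merely nonnegative there.\<close>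

lemma height_ge:
  assumes "integrable M (\<lambda>\<omega>. real_of_int (\<xi> t \<omega> 0))"
  shows "expec wall_flip m (\<lambda>\<xi>. real_of_int (\<xi> 0)) (\<lambda>x. x mod 2) - (L + 2) * err
    \<le> (\<integral>\<omega>. real_of_int (\<xi> t \<omega> 0) \<partial>M)"
proof -
  have "(\<integral>\<omega>. real_of_int (box_height \<omega>) \<partial>M) \<le> (\<integral>\<omega>. real_of_int (\<xi> t \<omega> 0) + real (L + 2) * indicator bad \<omega> \<partial>M)"
  proof (rule integral_mono_AE[OF box_height_expectation(1)])
    show "integrable M (\<lambda>\<omega>. real_of_int (\<xi> t \<omega> 0) + real (L + 2) * indicator bad \<omega>)"
      using bad_event assms
      by (intro Bochner_Integration.integrable_add integrable_mult_right) (auto simp: less_top[symmetric])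
    show "AE \<omega> in M. real_of_int (box_height \<omega>) \<le> real_of_int (\<xi> t \<omega> 0) + real (L + 2) * indicator bad \<omega>"
      using path_agreement AE_space
    proof eventually_elim
      case (elim \<omega>)
      have "real_of_int (box_height \<omega>) \<le> real_of_int (int L + 2)"
        using box_height_bounds(2) by (rule of_int_le_iff[THEN iffD2])
      then show ?case using elim height_nonneg[of \<omega>] by (cases "\<omega> \<in> bad") auto
    qed
  qed
  also have "\<dots> = (\<integral>\<omega>. real_of_int (\<xi> t \<omega> 0) \<partial>M) + (L + 2) * prob bad"
    using bad_event assms sets.sets_into_space[OF bad_event]
    by (subst Bochner_Integration.integral_add) (auto simp: less_top[symmetric] Int_absorb2)
  also have "\<dots> \<le> (\<integral>\<omega>. real_of_int (\<xi> t \<omega> 0) \<partial>M) + (L + 2) * err"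
    using bad_prob by (intro add_left_mono mult_left_mono) auto
  finally show ?thesis by (simp add: box_height_expectation(2))
qed

end

section \<open>The bounds\<close>

lemma box_size_exists:
  fixes t A R :: real
  obtains L :: nat where "R \<le> L" "(A + L + 2) * (2 * exp (t / 2) / 2 ^ (L + 1)) \<le> 1 / 2"
proof -
  have "((\<lambda>L::nat. (A + L + 2) / 2 ^ (L + 1)) \<longlongrightarrow> 0) at_top" by real_asymp
  from tendsto_mult_left_zero[OF this, of "2 * exp (t / 2)"]
  have "\<forall>\<^sub>F L in at_top. (A + real L + 2) / 2 ^ (L + 1) * (2 * exp (t / 2)) < 1 / 2"
    by (rule order_tendstoD) simp
  moreover have "\<forall>\<^sub>F L :: nat in at_top. R \<le> L" by real_asymp
  ultimately have "\<forall>\<^sub>F L in at_top. (A + real L + 2) / 2 ^ (L + 1) * (2 * exp (t / 2)) < 1 / 2 \<and> R \<le> L"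
    by (rule eventually_conj)
  then obtain L :: nat where "(A + real L + 2) / 2 ^ (L + 1) * (2 * exp (t / 2)) < 1 / 2" "R \<le> L"
    using eventually_happens[of _ "at_top :: nat filter"] by auto
  then show thesis by (intro that[of L]) (simp_all add: field_simps)
qed

text \<open>\<open>L\<close> comes first: the tail of the losses decays like \<open>2 ^ L\<close> in
  the denominator and beats the factor \<open>A + L + 2\<close>. The remaining errors are of order
  \<open>1 / m\<close> for fixed \<open>L\<close>, so \<open>m\<close> comes second.\<close>

lemma discretisation_exists:
  fixes M :: "'w measure"
  assumes wall: "wall_process M N (\<lambda>x. x mod 2) \<xi>" and t: "0 < t" and A: "0 \<le> A"
  obtains L m \<tau> where "discretised_wall M N \<xi> t m L \<tau>" "R \<le> real L"
    "(A + L + 2) * discretised_wall.err t m L \<tau> \<le> 1"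
    "t / 4 \<le> (\<tau> * exp (- (\<tau> * real (2 * L + 1)))) * m"
    "(\<tau> * exp (- (\<tau> * real (2 * L + 1)))) * m \<le> t / 2"
    "64 * (\<tau> * exp (- (\<tau> * real (2 * L + 1))))\<^sup>2 * m \<le> 1"
    "4 * (\<tau> * exp (- (\<tau> * real (2 * L + 1))))\<^sup>2 * (real (card {- int L..int L}))\<^sup>2 * m \<le> 1 / 128"
proof -
  obtain L :: nat where L: "R \<le> L" "(A + L + 2) * (2 * exp (t / 2) / 2 ^ (L + 1)) \<le> 1 / 2"
    by (rule box_size_exists)
  define b where "b = real (2 * L + 1)"
  have b: "1 \<le> b" by (simp add: b_def)
  \<comment> \<open>One summand per requirement: the locale assumption \<open>small\<close>, the
    several-event part of \<open>err\<close>, the slope correlation error, and the squared drift in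
    \<open>second_moment\<close>.\<close>
  define m where "m = nat \<lceil>2 * t * b + (A + L + 2) * t\<^sup>2 * b\<^sup>2 + 16 * t\<^sup>2 + 128 * t\<^sup>2 * b\<^sup>2\<rceil>"
  define \<tau> where "\<tau> = t / (2 * m)"
  define q where "q = \<tau> * exp (- (\<tau> * b))"
  have nn: "0 < 2 * t * b" "0 \<le> (A + L + 2) * t\<^sup>2 * b\<^sup>2" "0 \<le> 16 * t\<^sup>2" "0 \<le> 128 * t\<^sup>2 * b\<^sup>2"
    using t A b by simp_all
  have "2 * t * b + (A + L + 2) * t\<^sup>2 * b\<^sup>2 + 16 * t\<^sup>2 + 128 * t\<^sup>2 * b\<^sup>2 \<le> m"
    unfolding m_def by (rule real_nat_ceiling_ge)
  then have m: "2 * t * b \<le> m" "(A + L + 2) * t\<^sup>2 * b\<^sup>2 \<le> m" "16 * t\<^sup>2 \<le> m" "128 * t\<^sup>2 * b\<^sup>2 \<le> m"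
    using nn by linarith+
  then have m0: "0 < real m" using nn by linarith
  have \<tau>: "0 < \<tau>" "\<tau> * m = t / 2" using t m0 by (simp_all add: \<tau>_def)
  have small: "4 * \<tau> * b \<le> 1" using m(1) m0 by (simp add: \<tau>_def field_simps)
  have half: "1 / 2 \<le> exp (- (\<tau> * b))" using exp_ge_add_one_self[of "- (\<tau> * b)"] small by linarith
  have q: "0 \<le> q" "q \<le> \<tau>" using \<tau> b by (simp_all add: q_def mult_le_cancel_left1)
  have sq: "q\<^sup>2 * m \<le> t\<^sup>2 / (4 * m)"
  proof -
    have "q\<^sup>2 * m \<le> \<tau>\<^sup>2 * m" using q by (intro mult_right_mono power_mono) auto
    also have "\<dots> = t\<^sup>2 / (4 * m)" using m0 by (simp add: \<tau>_def field_simps power2_eq_square)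
    finally show ?thesis .
  qed
  interpret prob_space M using wall by (simp add: wall_process_def)
  have d: "discretised_wall M N \<xi> t m L \<tau>"
    by standard (use wall t m0 small in \<open>auto simp: \<tau>_def b_def\<close>)
  show thesis
  proof (rule that[OF d L(1)])
    have "(A + L + 2) * (m * (\<tau> * b)\<^sup>2) = (A + L + 2) * t\<^sup>2 * b\<^sup>2 / (4 * m)"
      using m0 by (simp add: \<tau>_def power_mult_distrib power_divide power2_eq_square field_simps)
    also have "\<dots> \<le> m / (4 * m)" using m(2) m0 by (intro divide_right_mono) auto
    also have "\<dots> \<le> 1 / 2" using m0 by simp
    finally have "(A + L + 2) * (m * (\<tau> * b)\<^sup>2) + (A + L + 2) * (2 * exp (t / 2) / 2 ^ (L + 1)) \<le> 1"
      using L(2) by linarith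
    then show "(A + L + 2) * discretised_wall.err t m L \<tau> \<le> 1"
      unfolding discretised_wall.err_def[OF d] b_def distrib_left .
    show "t / 4 \<le> \<tau> * exp (- (\<tau> * real (2 * L + 1))) * m"
    proof -
      have "t / 2 * (1 / 2) \<le> \<tau> * m * exp (- (\<tau> * b))"
        unfolding \<tau>(2) using half t by (intro mult_left_mono) auto
      then show ?thesis by (simp add: b_def mult_ac)
    qed
    show "\<tau> * exp (- (\<tau> * real (2 * L + 1))) * m \<le> t / 2"
      using mult_right_mono[OF q(2), of m] \<tau>(2) by (simp add: q_def b_def)
    have "64 * (q\<^sup>2 * m) \<le> 64 * (t\<^sup>2 / (4 * m))" using sq by (intro mult_left_mono) auto
    also have "\<dots> \<le> 1" using m(3) m0 by simp
    finally show "64 * (\<tau> * exp (- (\<tau> * real (2 * L + 1))))\<^sup>2 * m \<le> 1" by (simp add: q_def b_def)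
    have "4 * b\<^sup>2 * (q\<^sup>2 * m) \<le> 4 * b\<^sup>2 * (t\<^sup>2 / (4 * m))" using sq by (intro mult_left_mono) auto
    also have "\<dots> \<le> 1 / 128" using m(4) m0 by (simp add: field_simps)
    finally have "4 * q\<^sup>2 * b\<^sup>2 * m \<le> 1 / 128" by (simp add: mult_ac)
    moreover have "real (card {- int L..int L}) = b" by (simp add: b_def)
    ultimately show "4 * (\<tau> * exp (- (\<tau> * real (2 * L + 1))))\<^sup>2 * (real (card {- int L..int L}))\<^sup>2 * m \<le> 1 / 128"
      unfolding b_def[symmetric] q_def[symmetric] by simp
  qed
qed

text \<open>With \<open>R = r\<^sup>2\<close> and \<open>l = 1 / r\<close> the exponent of the
  moment bound is at most 3, whatever \<open>t\<close>. The result does not involve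
  \<open>A\<close>, as required for removing the truncation.\<close>

lemma truncated_height_upper:
  assumes wall: "wall_process M N (\<lambda>x. x mod 2) \<xi>" and r: "2 \<le> r" "t = r ^ 4" and A: "0 \<le> A"
  shows "(\<integral>\<omega>. min (real_of_int (\<xi> t \<omega> 0)) A \<partial>M) \<le> (6 + exp 4) * (r * ln t)"
proof -
  have t16: "16 \<le> t" using power_mono[OF r(1), of 4] r(2) by simp
  then have t0: "0 < t" by simp
  obtain L m \<tau> where d: "discretised_wall M N \<xi> t m L \<tau>"
    and err: "(A + real L + 2) * discretised_wall.err t m L \<tau> \<le> 1"
    and q: "t / 4 \<le> (\<tau> * exp (- (\<tau> * real (2 * L + 1)))) * m" "(\<tau> * exp (- (\<tau> * real (2 * L + 1)))) * m \<le> t / 2"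
    by (rule discretisation_exists[OF wall t0 A, of 0])
  interpret discretised_wall M N \<xi> t m L \<tau> by fact
  \<comment> \<open>Even, and with \<open>l * c\<close> at least \<open>2 * ln t\<close>, so that
    the low-height probability outweighs the factor \<open>2 * rate * m\<close>, which is at most
    \<open>t\<close>.\<close>
  define c where "c = 2 * \<lceil>r * ln t\<rceil>"
  define l where "l = 1 / r"
  have ln: "1 \<le> ln t"
  proof -
    have "exp 1 \<le> t" using exp_le t16 by linarith
    then show ?thesis using t0 by (simp add: ln_ge_iff)
  qed
  have r0: "0 < r" using r by simp
  have rl: "2 \<le> r * ln t" using mult_mono[OF r(1) ln] r by simp
  have c: "even c" "0 \<le> c" "2 * (r * ln t) \<le> c" "c \<le> 2 * (r * ln t) + 2"
    using rl ceiling_correct[of "r * ln t"] unfolding c_def by auto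
  have E: "4 * l\<^sup>2 * (r\<^sup>2 / 4 + rate * m / r\<^sup>2) \<le> 3"
  proof -
    have "rate * m / r\<^sup>2 \<le> (r ^ 4 / 2) / r\<^sup>2" using q(2) r(2) by (intro divide_right_mono) auto
    also have "\<dots> = r\<^sup>2 / 2" using r0 by (simp add: power2_eq_square power4_eq_xxxx)
    finally have "4 * l\<^sup>2 * (r\<^sup>2 / 4 + rate * m / r\<^sup>2) \<le> 4 * l\<^sup>2 * (r\<^sup>2 / 4 + r\<^sup>2 / 2)"
      by (intro mult_left_mono add_left_mono) auto
    also have "\<dots> = 3" using r0 by (simp add: l_def power2_eq_square)
    finally show ?thesis .
  qed
  have low: "2 * rate * m * (exp (l * (1 - real_of_int c)) * exp (4 * l\<^sup>2 * (r\<^sup>2 / 4 + rate * m / r\<^sup>2))) \<le> exp 4"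
  proof -
    have "l * (1 - real_of_int c) \<le> 1 - 2 * ln t"
    proof -
      have "2 * ln t = l * (2 * (r * ln t))" using r0 by (simp add: l_def)
      also have "\<dots> \<le> l * c" using c(3) r0 by (intro mult_left_mono) (auto simp: l_def)
      finally have "2 * ln t \<le> l * c" .
      moreover have "l \<le> 1" using r by (simp add: l_def)
      ultimately show ?thesis by (simp add: algebra_simps)
    qed
    then have "l * (1 - real_of_int c) \<le> 1 - ln t" using ln by linarith
    then have "exp (l * (1 - real_of_int c)) \<le> exp (1 - ln t)" by simp
    also have "\<dots> = exp 1 / t" using t0 by (simp add: exp_diff)
    finally have e: "exp (l * (1 - real_of_int c)) \<le> exp 1 / t" .
    have "2 * rate * m * (exp (l * (1 - real_of_int c)) * exp (4 * l\<^sup>2 * (r\<^sup>2 / 4 + rate * m / r\<^sup>2)))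
      \<le> t * (exp 1 / t * exp 3)"
      using E e q(2) t0 \<tau> by (intro mult_mono) auto
    also have "\<dots> = exp (1 + 3)" unfolding exp_add using t0 by simp
    finally show ?thesis by simp
  qed
  have "expec wall_flip m (\<lambda>\<xi>. real_of_int (\<xi> 0)) (\<lambda>x. x mod 2)
      \<le> real_of_int (c + 1) + 2 * rate * m * (exp (l * (1 - real_of_int c)) * exp (4 * l\<^sup>2 * (r\<^sup>2 / 4 + rate * m / r\<^sup>2)))"
    using wall_chain_upper[where R = "r\<^sup>2" and l = l and c = c and k = m and x = 0] r c by (auto simp: l_def)
  also have "\<dots> \<le> 2 * (r * ln t) + 3 + exp 4" using low c(4) by simp
  finally have 1: "expec wall_flip m (\<lambda>\<xi>. real_of_int (\<xi> 0)) (\<lambda>x. x mod 2) \<le> 2 * (r * ln t) + 3 + exp 4" .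
  have err0: "0 \<le> err" unfolding err_def by simp
  then have "A * err \<le> (A + real L + 2) * err" by (intro mult_right_mono) auto
  then have "(\<integral>\<omega>. min (real_of_int (\<xi> t \<omega> 0)) A \<partial>M) \<le> 2 * (r * ln t) + 3 + exp 4 + 1"
    using truncated_height_le[OF A] 1 err by linarith
  \<comment> \<open>As \<open>r * ln t\<close> exceeds 1, it absorbs 3 + exp 4 from the chain and 1
    from the discretisation.\<close>
  also have "\<dots> \<le> 2 * (r * ln t) + (4 + exp 4) * (r * ln t)"
  proof -
    have "(4 + exp 4) * 1 \<le> (4 + exp 4) * (r * ln t)" using rl by (intro mult_left_mono) (auto intro: add_nonneg_nonneg)
    then show ?thesis by simp
  qed
  finally show ?thesis by (simp add: algebra_simps)
qed

lemma (in prob_space) integral_le_of_truncations: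
  fixes f :: "'a \<Rightarrow> real"
  assumes f: "f \<in> borel_measurable M" "\<And>\<omega>. \<omega> \<in> space M \<Longrightarrow> 0 \<le> f \<omega>"
    and U: "\<And>A. 0 \<le> A \<Longrightarrow> (\<integral>\<omega>. min (f \<omega>) A \<partial>M) \<le> U"
  shows "integrable M f" "(\<integral>\<omega>. f \<omega> \<partial>M) \<le> U"
proof -
  define g where "g n \<omega> = min (f \<omega>) (real n)" for n \<omega>
  have int: "integrable M (g n)" for n unfolding g_def
    by (rule integrable_const_bound[of _ n]) (use f in \<open>auto intro!: AE_I2\<close>)
  have le: "(\<integral>\<omega>. g n \<omega> \<partial>M) \<le> U" for n unfolding g_def by (rule U) simp
  have inc: "incseq (\<lambda>n. \<integral>\<omega>. g n \<omega> \<partial>M)"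
    by (intro incseq_SucI Bochner_Integration.integral_mono int) (auto simp: g_def)
  obtain x where x: "(\<lambda>n. \<integral>\<omega>. g n \<omega> \<partial>M) \<longlonglongrightarrow> x"
    using incseq_convergent[OF inc] le by blast
  have mono: "AE \<omega> in M. mono (\<lambda>n. g n \<omega>)"
    by (intro AE_I2 monoI) (auto simp: g_def)
  have lim: "AE \<omega> in M. (\<lambda>n. g n \<omega>) \<longlonglongrightarrow> f \<omega>"
  proof (rule AE_I2)
    fix \<omega>
    have "\<forall>\<^sub>F n in sequentially. g n \<omega> = f \<omega>"
      using eventually_ge_at_top[of "nat \<lceil>f \<omega>\<rceil>"] by eventually_elim (simp add: g_def)
    then show "(\<lambda>n. g n \<omega>) \<longlonglongrightarrow> f \<omega>" by (rule tendsto_eventually)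
  qed
  note mc = int mono lim x f(1)
  show "integrable M f" by (rule integrable_monotone_convergence[OF mc])
  have "(\<integral>\<omega>. f \<omega> \<partial>M) = x" by (rule integral_monotone_convergence[OF mc])
  also have "x \<le> U" using le by (intro LIMSEQ_le_const2[OF x]) auto
  finally show "(\<integral>\<omega>. f \<omega> \<partial>M) \<le> U" .
qed

text \<open>\<open>\<sigma>\<close> is chosen so that at truncation level
  \<open>\<sigma> * r\<close> the fourth-moment term is \<open>r\<^sup>2 / 320\<close>, half of the
  second-moment bound \<open>r\<^sup>2 / 160\<close>: 163840 is 512 times 320. The subtracted 1 pays
  for the discretisation.\<close>

lemma height_lower:
  assumes wall: "wall_process M N (\<lambda>x. x mod 2) \<xi>" and r: "2 \<le> r" "t = r ^ 4"
    and int: "integrable M (\<lambda>\<omega>. real_of_int (\<xi> t \<omega> 0))"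
  defines "\<sigma> \<equiv> sqrt (163840 * exp 3)"
  shows "r / (640 * \<sigma>) - 1 \<le> (\<integral>\<omega>. real_of_int (\<xi> t \<omega> 0) \<partial>M)"
proof -
  have t16: "16 \<le> t" using power_mono[OF r(1), of 4] r(2) by simp
  then have t0: "0 < t" by simp
  obtain L m \<tau> where d: "discretised_wall M N \<xi> t m L \<tau>" and L: "2 * r\<^sup>2 \<le> real L"
    and err: "(0 + real L + 2) * discretised_wall.err t m L \<tau> \<le> 1"
    and q: "t / 4 \<le> (\<tau> * exp (- (\<tau> * real (2 * L + 1)))) * m" "(\<tau> * exp (- (\<tau> * real (2 * L + 1)))) * m \<le> t / 2"
    "64 * (\<tau> * exp (- (\<tau> * real (2 * L + 1))))\<^sup>2 * m \<le> 1"
    "4 * (\<tau> * exp (- (\<tau> * real (2 * L + 1))))\<^sup>2 * (real (card {- int L..int L}))\<^sup>2 * m \<le> 1 / 128"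
    by (rule discretisation_exists[OF wall t0 order.refl, of "2 * r\<^sup>2"])
  interpret discretised_wall M N \<xi> t m L \<tau> by fact
  define l where "l = 1 / r"
  define s where "s = \<sigma> * r"
  \<comment> \<open>Large enough for \<open>4 * rate * m \<le> R\<^sup>2\<close>, which keeps half
    of the heat kernel's mass within distance \<open>R\<close>; the box was chosen to contain this
    range.\<close>
  define R where "R = 2 * r\<^sup>2"
  have r0: "0 < r" using r by simp
  have r2: "4 \<le> r\<^sup>2" using power_mono[OF r(1), of 2] by simp
  have \<sigma>: "0 < \<sigma>" "\<sigma>\<^sup>2 = 163840 * exp 3" by (simp_all add: \<sigma>_def)
  have R: "0 < R" "R\<^sup>2 = 4 * t" using r0 r(2) by (simp_all add: R_def power2_eq_square power4_eq_xxxx)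
  have E: "4 * l\<^sup>2 * (R / 4 + rate * m / R) \<le> 3"
  proof -
    have "rate * m / R \<le> (r ^ 4 / 2) / R" using q(2) r(2) R by (intro divide_right_mono) auto
    also have "\<dots> = r\<^sup>2 / 4" using r0 by (simp add: R_def power2_eq_square power4_eq_xxxx)
    finally have "4 * l\<^sup>2 * (R / 4 + rate * m / R) \<le> 4 * l\<^sup>2 * (R / 4 + r\<^sup>2 / 4)"
      by (intro mult_left_mono add_left_mono) auto
    also have "\<dots> = 3" using r0 by (simp add: l_def R_def power2_eq_square field_simps)
    finally show ?thesis .
  qed
  \<comment> \<open>Of the main term \<open>r\<^sup>2 / 80\<close> half survives, because the error
    1/128 is below \<open>r\<^sup>2 / 160\<close> once \<open>r\<^sup>2\<close> is at least
    4.\<close>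
  have first: "r\<^sup>2 / 160 \<le> rate * m / (4 * (2 * R + 1)) - 4 * rate\<^sup>2 * (real (card sites))\<^sup>2 * m"
  proof -
    have "r\<^sup>2 / 80 = (r ^ 4 / 4) / (4 * (5 * r\<^sup>2))" using r0 by (simp add: power2_eq_square power4_eq_xxxx)
    also have "\<dots> \<le> rate * m / (4 * (2 * R + 1))"
      using mult_nonneg_nonneg[of rate "real m"] \<tau>
      using q(1) r(2) r2 R t0 by (intro frac_le) (auto simp: R_def)
    finally show ?thesis using q(4) r2 by linarith
  qed
  have second: "512 * exp (4 * l\<^sup>2 * (R / 4 + rate * m / R)) / l ^ 4 / s\<^sup>2 \<le> r\<^sup>2 / 320"
  proof -
    have "512 * exp (4 * l\<^sup>2 * (R / 4 + rate * m / R)) / l ^ 4 / s\<^sup>2 \<le> 512 * exp 3 / l ^ 4 / s\<^sup>2"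
      using E by (intro divide_right_mono) auto
    also have "\<dots> = r\<^sup>2 / 320"
      using r0 \<sigma> by (simp add: s_def l_def power_mult_distrib power_divide) (simp add: power2_eq_square power4_eq_xxxx field_simps)
    finally show ?thesis .
  qed
  have gap: "x / 320 \<le> a - b" if "x / 160 \<le> a" "b \<le> x / 320" for x a b :: real
    using that by linarith
  have s0: "0 < s" using \<sigma> r0 by (simp add: s_def)
  have "r / (640 * \<sigma>) = r\<^sup>2 / 320 / s / 2"
    using r0 \<sigma> by (simp add: s_def power2_eq_square)
  also have "\<dots> \<le> ((rate * m / (4 * (2 * R + 1)) - 4 * rate\<^sup>2 * (real (card sites))\<^sup>2 * m)
      - 512 * exp (4 * l\<^sup>2 * (R / 4 + rate * m / R)) / l ^ 4 / s\<^sup>2) / s / 2"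
    using s0 by (intro divide_right_mono gap[OF first second]) auto
  also have "\<dots> \<le> expec wall_flip m (\<lambda>\<xi>. real_of_int (\<xi> 0)) (\<lambda>x. x mod 2)"
  proof (rule wall_chain_lower[OF R(1) _ _ q(3) _ _ s0])
    have "4 * (rate * m) \<le> R\<^sup>2" using q(2) R(2) t0 by linarith
    then show "4 * rate * m \<le> R\<^sup>2" by (simp only: mult.assoc)
    fix x :: int assume "\<bar>x\<bar> < R"
    then have "\<bar>real_of_int x\<bar> \<le> real L" using L by (simp add: R_def)
    then have "real_of_int \<bar>x\<bar> \<le> real_of_int (int L)" by simp
    then have "\<bar>x\<bar> \<le> int L" by (simp only: of_int_le_iff)
    then show "x \<in> sites" by auto
  qed (use r in \<open>auto simp: l_def\<close>)
  finally have "r / (640 * \<sigma>) \<le> expec wall_flip m (\<lambda>\<xi>. real_of_int (\<xi> 0)) (\<lambda>x. x mod 2)" .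
  moreover have "real (L + 2) * err \<le> 1" using err by (simp add: add.commute)
  ultimately show ?thesis using height_ge[OF int] by linarith
qed

theorem theorem3:
  fixes M :: "'w measure" and N :: "int \<Rightarrow> real \<Rightarrow> 'w \<Rightarrow> nat"
    and \<xi> :: "real \<Rightarrow> 'w \<Rightarrow> int \<Rightarrow> int"
  assumes "wall_process M N (\<lambda>x. x mod 2) \<xi>"
  shows "\<exists>c1 > 0. \<exists>c2 > 0. \<forall>\<^sub>F t in at_top.
           c1 * t powr (1 / 4) \<le> (\<integral>\<omega>. real_of_int (\<xi> t \<omega> 0) \<partial>M) \<and>
           (\<integral>\<omega>. real_of_int (\<xi> t \<omega> 0) \<partial>M) \<le> c2 * t powr (1 / 4) * ln t"
proof -
  define \<sigma> :: real where "\<sigma> = sqrt (163840 * exp 3)"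
  have \<sigma>: "0 < \<sigma>" by (simp add: \<sigma>_def)
  \<comment> \<open>Twice the constant 640 of \<open>height_lower\<close>: from here on half of the
    linear term absorbs the subtracted 1.\<close>
  have "\<forall>\<^sub>F t in at_top. max 2 (1280 * \<sigma>) \<le> t powr (1 / 4)"
    by real_asymp
  then have "\<forall>\<^sub>F t in at_top. 1 / (1280 * \<sigma>) * t powr (1 / 4) \<le> (\<integral>\<omega>. real_of_int (\<xi> t \<omega> 0) \<partial>M) \<and>
      (\<integral>\<omega>. real_of_int (\<xi> t \<omega> 0) \<partial>M) \<le> (6 + exp 4) * t powr (1 / 4) * ln t"
    using eventually_gt_at_top[of 0]
  proof eventually_elim
    case (elim t)
    define r where "r = t powr (1 / 4)"
    have r: "2 \<le> r" "1280 * \<sigma> \<le> r" using elim by (simp_all add: r_def)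
    have "r powr real 4 = r ^ 4" using r by (intro powr_realpow) auto
    moreover have "r powr real 4 = t" unfolding r_def powr_powr using elim by simp
    ultimately have tr: "t = r ^ 4" by simp
    interpret prob_space M using assms by (simp add: wall_process_def)
    have meas: "(\<lambda>\<omega>. real_of_int (\<xi> t \<omega> 0)) \<in> borel_measurable M"
    proof -
      have "(\<lambda>\<omega>. \<xi> t \<omega> 0) \<in> measurable M (count_space UNIV)"
        using assms elim by (simp add: wall_process_def)
      then show ?thesis by measurable
    qed
    have nonneg: "0 \<le> real_of_int (\<xi> t \<omega> 0)" if "\<omega> \<in> space M" for \<omega>
      using assms elim that by (simp add: wall_process_def wall_configs_def)
    note upper = integral_le_of_truncations[OF meas nonneg truncated_height_upper[OF assms r(1) tr]]
    have "1 \<le> r / (1280 * \<sigma>)" using r \<sigma> by simp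
    then have "r / (1280 * \<sigma>) \<le> r / (640 * \<sigma>) - 1" using \<sigma> by (simp add: field_simps)
    also have "\<dots> \<le> (\<integral>\<omega>. real_of_int (\<xi> t \<omega> 0) \<partial>M)"
      unfolding \<sigma>_def by (rule height_lower[OF assms r(1) tr upper(1)])
    finally show ?case using upper(2) unfolding r_def[symmetric] by (simp add: mult.assoc)
  qed
  moreover have "0 < 1 / (1280 * \<sigma>)" using \<sigma> by simp
  moreover have "(0::real) < 6 + exp 4" by (simp add: add_pos_pos)
  ultimately show ?thesis by blast
qed

end
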